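(* Suppose (H.1) and (H.2) (stated in the context) hold, let $\varepsilon>0$, and suppose that the function $H$ in (H.2) is in $C^3(\mathbb R^K)$. Let $\boldsymbol\vartheta_0=((\sigma_k\sigma_k^T/2,b_k,c_k,f_k)_{k\in\mathcal K},g)$, let $u^\varepsilon$ be the solution to $H_\varepsilon(\mathbf L^{\boldsymbol\vartheta_0}u^\varepsilon+\mathbf f^{\boldsymbol\vartheta_0})=0$ in $\mathcal O$, $u^\varepsilon=g$ on $\partial\mathcal O$, let $\lambda^{u^\varepsilon}=(\nabla H_\varepsilon)(\mathbf L^{\boldsymbol\vartheta_0}u^\varepsilon+\mathbf f^{\boldsymbol\vartheta_0})$, and let $\beta_0$ be the constant described in the context. Let $\beta\in(0,\min(\beta_0,\theta)]$ and let $\mathcal S:\mathcal V\to\mathcal W$ be the solution map described in the context. Then $$\lambda^{\mathcal S[\boldsymbol\vartheta_0+\delta\boldsymbol\vartheta]}=\lambda^{u^\varepsilon}+\big((\nabla^2H_\varepsilon)(\mathbf L^{\boldsymbol\vartheta_0}u^\varepsilon+\mathbf f^{\boldsymbol\vartheta_0})\big)\big(\mathbf L^{\boldsymbol\vartheta_0}\delta u+\mathbf L^{\delta\boldsymbol\vartheta}u^\varepsilon+\mathbf f^{\delta\boldsymbol\vartheta}\big)+o(|\delta\boldsymbol\vartheta|_{\Theta^\beta})$$ in $C^\beta(\overline{\mathcal O},\mathbb R^K)$ as $|\delta\boldsymbol\vartheta|_{\Theta^\beta}\to0$, where $\lambda^{\mathcal S[\boldsymbol\vartheta_0+\delta\boldsymbol\vartheta]}$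 is the optimal feedback control of the relaxed control problem with coefficients $\boldsymbol\vartheta_0+\delta\boldsymbol\vartheta$, i.e. $\lambda^{\mathcal S[\boldsymbol\vartheta]}=(\nabla H_\varepsilon)(\mathbf L^{\boldsymbol\vartheta}\mathcal S[\boldsymbol\vartheta]+\mathbf f^{\boldsymbol\vartheta})$ for $\boldsymbol\vartheta\in\mathcal V$, and $\delta u$ is the classical solution to $$(\lambda^{u^\varepsilon})^T\big(\mathbf L^{\boldsymbol\vartheta_0}\delta u+\mathbf L^{\delta\boldsymbol\vartheta}u^\varepsilon+\mathbf f^{\delta\boldsymbol\vartheta}\big)=0\ \text{ in }\mathcal O,\qquad\delta u=g^{\delta\boldsymbol\vartheta}\ \text{ on }\partial\mathcal O.$$
   Context: Norms: for open $\mathcal O\subset\mathbb R^n$, $k\in\mathbb N\cup\{0\}$, $\theta\in(0,1]$, $[\phi]_0=\sup|\phi|$, $[\phi]_\theta=\sup_{x\ne y}|\phi(x)-\phi(y)|/|x-y|^\theta$, $[\phi]_{k,0}=\sum_{|\gamma|=k}[D^\gamma\phi]_0$, $[\phi]_{k,\theta}=\sum_{|\gamma|=k}[D^\gamma\phi]_\theta$, $|\phi|_k=\sum_{m=0}^k[\phi]_{m,0}$, $|\phi|_{k,\theta}=|\phi|_k+[\phi]_{k,\theta}$, $|\cdot|_\theta=|\cdot|_{0,\theta}$; domain subscript omitted when it is $\overline{\mathcal O}$; $C^{k,\theta}(\overline{\mathcal O})$ are the corresponding Hölder spaces, $C^\theta=C^{0,\theta}$. Repeated indices $i,j$ are summed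 from $1$ to $n$. $\nabla^2H_\varepsilon$ is the Hessian of $H_\varepsilon$. (H.1): $n,K\in\mathbb N$, $\mathcal K=\{1,\dots,K\}$, $\mathbf A=\{\mathbf a_k\}_{k\in\mathcal K}$ is a set of cardinality $K$, $\mathcal O\subset\mathbb R^n$ is a bounded domain. There are constants $\nu,\Lambda>0$, $\theta\in(0,1]$ such that $\partial\mathcal O$ is of class $C^{2,\theta}$, $g\in C^{2,\theta}(\overline{\mathcal O})$, and $b:\mathbb R^n\times\mathbf A\to\mathbb R^n$, $\sigma:\mathbb R^n\times\mathbf A\to\mathbb R^{n\times n}$, $c:\overline{\mathcal O}\times\mathbf A\to[0,\infty)$, $f:\overline{\mathcal O}\times\mathbf A\to\mathbb R$ satisfy for each $k$: $\sigma(x,\mathbf a_k)\sigma^T(x,\mathbf a_k)\ge\nu I_n$ for all $x\in\mathbb R^n$, and $\sum_{i,j}|\sigma^{ij}(\cdot,\mathbf a_k)|_{0,1;\mathbb R^n}+\sum_i|b^i(\cdot,\mathbf a_k)|_{0,1;\mathbb R^n}+|c(\cdot,\mathbf a_k)|_{\theta;\overline{\mathcal O}}+|f(\cdot,\mathbf a_k)|_{\theta;\overline{\mathcal O}}\le\Lambda$. Write $\phi_k=\phi(\cdot,\mathbf a_k)$. (H.2): there exist a convex $H\in C^2(\mathbb R^K)$ and $c_0>0$ such that for all $x,y\in\mathbb R^K$, $H(x)-c_0\le\max_kx_k\le H(x)$ and $\rho(y)=\sup_{z\in\mathbb R^K}(z^Ty-H(z))$. For $\varepsilon>0$, $H_\varepsilon(x)=\varepsilon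 H(\varepsilon^{-1}x)$. Coefficient space: for $\beta\in(0,1]$, $\Theta^\beta=\big(C^\beta(\overline{\mathcal O},\mathbb R^{n\times n})\times C^\beta(\overline{\mathcal O},\mathbb R^n)\times C^\beta(\overline{\mathcal O})\times C^\beta(\overline{\mathcal O})\big)^K\times C^{2,\beta}(\overline{\mathcal O})$ with the product norm $|\cdot|_{\Theta^\beta}$. For $\boldsymbol\vartheta=((a_k,b_k,c_k,f_k)_{k\in\mathcal K},g)\in\Theta^\beta$ put $\mathbf f^{\boldsymbol\vartheta}=(f_k)_k$, $g^{\boldsymbol\vartheta}=g$, $\mathbf L^{\boldsymbol\vartheta}=(\mathcal L^{\boldsymbol\vartheta}_k)_k$ with $\mathcal L^{\boldsymbol\vartheta}_k\phi=a_k^{ij}\partial_{ij}\phi+b_k^i\partial_i\phi-c_k\phi$. The constant $\beta_0=\beta_0(n,\nu,M)\in(0,1)$, $M=\sup_{i,j,k}|\sigma_k^{ij}|_{0;\overline{\mathcal O}}$, depends only on $n,\nu,M$ and is such that, under (H.1)–(H.2), for every $\varepsilon>0$ the unique solution $u^\varepsilon\in C(\overline{\mathcal O})\cap C^2(\mathcal O)$ of the Dirichlet problem for $\boldsymbol\vartheta_0$ lies in $C^{2,\min(\beta_0,\theta)}(\overline{\mathcal O})$, and for every $\beta\in(0,\min(\beta_0,\theta)]$ every $C^{2,\beta}(\overline{\mathcal O})$ solution satisfies $|u^\varepsilon|_{2,\beta}\le C(|g|_{2,\beta}+\varepsilon c_0+1)$ with $C$ depending only on $n,\nu,\Lambda,\beta,\mathcal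 O$. Solution map: for $\beta\in(0,\min(\beta_0,\theta)]$ there are a neighborhood $\mathcal V$ of $\boldsymbol\vartheta_0$ in $\Theta^\beta$, a neighborhood $\mathcal W$ of $u^\varepsilon$ in $C^{2,\beta}(\overline{\mathcal O})$ and a continuously differentiable $\mathcal S:\mathcal V\to\mathcal W$ such that for each $\tilde{\boldsymbol\vartheta}\in\mathcal V$, $\mathcal S[\tilde{\boldsymbol\vartheta}]$ is the classical solution of $H_\varepsilon(\mathbf L^{\tilde{\boldsymbol\vartheta}}u+\mathbf f^{\tilde{\boldsymbol\vartheta}})=0$ in $\mathcal O$, $u=g^{\tilde{\boldsymbol\vartheta}}$ on $\partial\mathcal O$; in particular $\mathcal S[\boldsymbol\vartheta_0]=u^\varepsilon$, and $\mathcal S'[\boldsymbol\vartheta_0]\delta\boldsymbol\vartheta=\delta u$ is the solution of the linear Dirichlet problem displayed in the claim. *)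

theory Defs
  imports "HOL-Analysis.Analysis" "HOL-Library.Multiset" "HOL-Library.Function_Algebras"
begin

section \<open>Pointwise real vector space structure on functions\<close>

instantiation "fun" :: (type, real_vector) real_vector
begin

definition scaleR_fun :: "real \<Rightarrow> ('a \<Rightarrow> 'b) \<Rightarrow> 'a \<Rightarrow> 'b"
  where "scaleR_fun r f = (\<lambda>x. r *\<^sub>R f x)"

instance
  by standard
    (simp_all add: scaleR_fun_def fun_eq_iff scaleR_add_left scaleR_add_right)

end

section \<open>Partial derivatives, \<open>C\<^sup>k\<close> functions and Hoelder spaces\<close>

definition partial_deriv ::
  "'n::finite \<Rightarrow> (real^'n \<Rightarrow> 'b::real_normed_vector) \<Rightarrow> real^'n \<Rightarrow> 'b"
  where "partial_deriv i \<phi> x = vector_derivative (\<lambda>t. \<phi> (x + t *\<^sub>R axis i 1)) (at 0)"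

definition iter_partial ::
  "'n::finite list \<Rightarrow> (real^'n \<Rightarrow> 'b::real_normed_vector) \<Rightarrow> real^'n \<Rightarrow> 'b"
  where "iter_partial l \<phi> = foldr partial_deriv l \<phi>"

text \<open>
  A multi-index is a multiset of coordinate directions; its order is its size. For a function
  of class \<open>C\<^sup>k\<close> and a multi-index of order at most \<open>k\<close>, the order of differentiation that is
  chosen here is irrelevant.
\<close>

definition multi_deriv ::
  "'n::finite multiset \<Rightarrow> (real^'n \<Rightarrow> 'b::real_normed_vector) \<Rightarrow> real^'n \<Rightarrow> 'b"
  where "multi_deriv \<gamma> \<phi> = iter_partial (SOME l. mset l = \<gamma>) \<phi>"

definition Ck_on :: "nat \<Rightarrow> (real^'n::finite) set \<Rightarrow> (real^'n \<Rightarrow> 'b::real_normed_vector) \<Rightarrow> bool"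
  where "Ck_on k U \<phi> \<longleftrightarrow>
    (\<forall>l. length l < k \<longrightarrow>
      (\<forall>x\<in>U. \<forall>i. (\<lambda>t::real. iter_partial l \<phi> (x + t *\<^sub>R axis i 1)) differentiable (at 0))) \<and>
    (\<forall>l. length l \<le> k \<longrightarrow> continuous_on U (iter_partial l \<phi>))"

text \<open>
  Derivatives on the closure of an open set \<open>U\<close>: at a boundary point a derivative is the limit
  of the derivative in \<open>U\<close>. For the empty multi-index this is the function itself.
\<close>

definition deriv_cl ::
  "(real^'n::finite) set \<Rightarrow> 'n multiset \<Rightarrow> (real^'n \<Rightarrow> 'b::real_normed_vector) \<Rightarrow> real^'n \<Rightarrow> 'b"
  where "deriv_cl U \<gamma> \<phi> x =
    (if \<gamma> = {#} then \<phi> x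
     else if x \<in> U then multi_deriv \<gamma> \<phi> x
     else Lim (at x within U) (multi_deriv \<gamma> \<phi>))"

definition sup_seminorm :: "'a set \<Rightarrow> ('a \<Rightarrow> 'b::real_normed_vector) \<Rightarrow> real"
  where "sup_seminorm S \<psi> = (SUP x\<in>S. norm (\<psi> x))"

definition holder_quotients ::
  "real \<Rightarrow> 'a::metric_space set \<Rightarrow> ('a \<Rightarrow> 'b::real_normed_vector) \<Rightarrow> real set"
  where "holder_quotients \<theta> S \<psi> =
    {norm (\<psi> x - \<psi> y) / dist x y powr \<theta> | x y. x \<in> S \<and> y \<in> S \<and> x \<noteq> y}"

definition holder_seminorm ::
  "real \<Rightarrow> 'a::metric_space set \<Rightarrow> ('a \<Rightarrow> 'b::real_normed_vector) \<Rightarrow> real"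
  where "holder_seminorm \<theta> S \<psi> = Sup (holder_quotients \<theta> S \<psi>)"

text \<open>
  The space \<open>C\<^sup>k\<^sup>,\<^sup>\<theta>\<close> on the closure of the open set \<open>U\<close>, and its norm. Elements are represented by
  functions on the whole space, of which only the values on \<open>closure U\<close> matter: two elements are
  the same if they agree on \<open>closure U\<close>. The real-valued norm is only meaningful for elements of
  the space; outside it, the suprema are unspecified.
\<close>

definition holder_space ::
  "(real^'n::finite) set \<Rightarrow> nat \<Rightarrow> real \<Rightarrow> (real^'n \<Rightarrow> 'b::real_normed_vector) set"
  where "holder_space U k \<theta> = {\<phi>. Ck_on k U \<phi> \<and>
    (\<forall>\<gamma>. size \<gamma> \<le> k \<longrightarrow> continuous_on (closure U) (deriv_cl U \<gamma> \<phi>)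
      \<and> bounded (deriv_cl U \<gamma> \<phi> ` closure U)) \<and>
    (\<forall>\<gamma>. size \<gamma> = k \<longrightarrow> bdd_above (holder_quotients \<theta> (closure U) (deriv_cl U \<gamma> \<phi>)))}"

definition holder_norm ::
  "(real^'n::finite) set \<Rightarrow> nat \<Rightarrow> real \<Rightarrow> (real^'n \<Rightarrow> 'b::real_normed_vector) \<Rightarrow> real"
  where "holder_norm U k \<theta> \<phi> =
    (\<Sum>m\<le>k. \<Sum>\<gamma> | size \<gamma> = m. sup_seminorm (closure U) (deriv_cl U \<gamma> \<phi>))
    + (\<Sum>\<gamma> | size \<gamma> = k. holder_seminorm \<theta> (closure U) (deriv_cl U \<gamma> \<phi>))"

text \<open>
  Boundary of class \<open>C\<^sup>k\<^sup>,\<^sup>\<theta>\<close>, by local straightening (Gilbarg and Trudinger, Section 6.2). The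
  half-space may be taken with respect to any coordinate \<open>i\<close>.
\<close>

definition boundary_of_class :: "nat \<Rightarrow> real \<Rightarrow> (real^'n::finite) set \<Rightarrow> bool"
  where "boundary_of_class k \<theta> U \<longleftrightarrow>
    (\<forall>x0\<in>frontier U. \<exists>r>0. \<exists>(\<psi>::real^'n \<Rightarrow> real^'n) (\<psi>'::real^'n \<Rightarrow> real^'n) i.
      (\<forall>x\<in>ball x0 r. \<psi>' (\<psi> x) = x) \<and> open (\<psi> ` ball x0 r) \<and>
      \<psi> \<in> holder_space (ball x0 r) k \<theta> \<and> \<psi>' \<in> holder_space (\<psi> ` ball x0 r) k \<theta> \<and>
      \<psi> ` (ball x0 r \<inter> U) \<subseteq> {y. y $ i > 0} \<and>
      \<psi> ` (ball x0 r \<inter> frontier U) \<subseteq> {y. y $ i = 0})"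

section \<open>Continuously differentiable maps between subspaces with a given norm\<close>

text \<open>
  A carrier \<open>X\<close> and a real-valued \<open>N\<close> that is a norm on \<open>X\<close> up to identification of elements at
  distance zero; identities between elements are stated as \<open>N (x - y) = 0\<close>.
\<close>

definition norm_open :: "'x::real_vector set \<Rightarrow> ('x \<Rightarrow> real) \<Rightarrow> 'x set \<Rightarrow> bool"
  where "norm_open X N V \<longleftrightarrow>
    V \<subseteq> X \<and> (\<forall>x\<in>V. \<exists>r>0. \<forall>y\<in>X. N (y - x) < r \<longrightarrow> y \<in> V)"

definition bounded_linear_between ::
  "'x::real_vector set \<Rightarrow> ('x \<Rightarrow> real) \<Rightarrow> 'y::real_vector set \<Rightarrow> ('y \<Rightarrow> real) \<Rightarrow> ('x \<Rightarrow> 'y) \<Rightarrow> bool"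
  where "bounded_linear_between X NX Y NY T \<longleftrightarrow>
    T ` X \<subseteq> Y \<and>
    (\<forall>h\<in>X. \<forall>h'\<in>X. NY (T (h + h') - (T h + T h')) = 0) \<and>
    (\<forall>h\<in>X. \<forall>r. NY (T (r *\<^sub>R h) - r *\<^sub>R T h) = 0) \<and>
    (\<exists>B. \<forall>h\<in>X. NY (T h) \<le> B * NX h)"

definition has_frechet_deriv ::
  "'x::real_vector set \<Rightarrow> ('x \<Rightarrow> real) \<Rightarrow> 'y::real_vector set \<Rightarrow> ('y \<Rightarrow> real) \<Rightarrow>
   ('x \<Rightarrow> 'y) \<Rightarrow> 'x \<Rightarrow> ('x \<Rightarrow> 'y) \<Rightarrow> bool"
  where "has_frechet_deriv X NX Y NY F x T \<longleftrightarrow>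
    bounded_linear_between X NX Y NY T \<and>
    (\<forall>e>0. \<exists>d>0. \<forall>h\<in>X. NX h < d \<longrightarrow> NY (F (x + h) - F x - T h) \<le> e * NX h)"

definition cont_differentiable_on ::
  "'x::real_vector set \<Rightarrow> ('x \<Rightarrow> real) \<Rightarrow> 'y::real_vector set \<Rightarrow> ('y \<Rightarrow> real) \<Rightarrow>
   ('x \<Rightarrow> 'y) \<Rightarrow> 'x set \<Rightarrow> bool"
  where "cont_differentiable_on X NX Y NY F V \<longleftrightarrow>
    (\<exists>D. (\<forall>x\<in>V. has_frechet_deriv X NX Y NY F x (D x)) \<and>
      (\<forall>x\<in>V. \<forall>e>0. \<exists>d>0. \<forall>x'\<in>V. NX (x' - x) < d \<longrightarrow>
        (\<forall>h\<in>X. NY (D x' h - D x h) \<le> e * NX h)))"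

section \<open>Coefficients, operators and Dirichlet problems\<close>

type_synonym ('n, 'k) coeffs =
  "('k \<Rightarrow> (real^'n \<Rightarrow> real^'n^'n) \<times> (real^'n \<Rightarrow> real^'n) \<times> (real^'n \<Rightarrow> real) \<times> (real^'n \<Rightarrow> real))
   \<times> (real^'n \<Rightarrow> real)"

definition co_a :: "('n::finite, 'k::finite) coeffs \<Rightarrow> 'k \<Rightarrow> real^'n \<Rightarrow> real^'n^'n"
  where "co_a \<tau> k = fst (fst \<tau> k)"

definition co_b :: "('n::finite, 'k::finite) coeffs \<Rightarrow> 'k \<Rightarrow> real^'n \<Rightarrow> real^'n"
  where "co_b \<tau> k = fst (snd (fst \<tau> k))"

definition co_c :: "('n::finite, 'k::finite) coeffs \<Rightarrow> 'k \<Rightarrow> real^'n \<Rightarrow> real"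
  where "co_c \<tau> k = fst (snd (snd (fst \<tau> k)))"

definition co_f :: "('n::finite, 'k::finite) coeffs \<Rightarrow> 'k \<Rightarrow> real^'n \<Rightarrow> real"
  where "co_f \<tau> k = snd (snd (snd (fst \<tau> k)))"

definition co_g :: "('n::finite, 'k::finite) coeffs \<Rightarrow> real^'n \<Rightarrow> real"
  where "co_g \<tau> = snd \<tau>"

definition Theta_space :: "(real^'n::finite) set \<Rightarrow> real \<Rightarrow> ('n, 'k::finite) coeffs set"
  where "Theta_space U \<beta> = {\<tau>.
    (\<forall>k. co_a \<tau> k \<in> holder_space U 0 \<beta> \<and> co_b \<tau> k \<in> holder_space U 0 \<beta> \<and>
         co_c \<tau> k \<in> holder_space U 0 \<beta> \<and> co_f \<tau> k \<in> holder_space U 0 \<beta>) \<and>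
    co_g \<tau> \<in> holder_space U 2 \<beta>}"

definition Theta_norm :: "(real^'n::finite) set \<Rightarrow> real \<Rightarrow> ('n, 'k::finite) coeffs \<Rightarrow> real"
  where "Theta_norm U \<beta> \<tau> =
    (\<Sum>k\<in>UNIV. holder_norm U 0 \<beta> (co_a \<tau> k) + holder_norm U 0 \<beta> (co_b \<tau> k)
      + holder_norm U 0 \<beta> (co_c \<tau> k) + holder_norm U 0 \<beta> (co_f \<tau> k))
    + holder_norm U 2 \<beta> (co_g \<tau>)"

definition Lop ::
  "(real^'n::finite) set \<Rightarrow> ('n, 'k::finite) coeffs \<Rightarrow> (real^'n \<Rightarrow> real) \<Rightarrow> real^'n \<Rightarrow> real^'k"
  where "Lop U \<tau> \<phi> x = (\<chi> k.
    (\<Sum>i\<in>UNIV. \<Sum>j\<in>UNIV. co_a \<tau> k x $ i $ j * deriv_cl U {#i, j#} \<phi> x)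
    + (\<Sum>i\<in>UNIV. co_b \<tau> k x $ i * deriv_cl U {#i#} \<phi> x)
    - co_c \<tau> k x * \<phi> x)"

definition fvec :: "('n::finite, 'k::finite) coeffs \<Rightarrow> real^'n \<Rightarrow> real^'k"
  where "fvec \<tau> x = (\<chi> k. co_f \<tau> k x)"

definition gradient :: "(real^'k::finite \<Rightarrow> real) \<Rightarrow> real^'k \<Rightarrow> real^'k"
  where "gradient F x = (\<chi> k. multi_deriv {#k#} F x)"

definition hessian :: "(real^'k::finite \<Rightarrow> real) \<Rightarrow> real^'k \<Rightarrow> real^'k^'k"
  where "hessian F x = (\<chi> k l. multi_deriv {#k, l#} F x)"

definition H_eps :: "(real^'k::finite \<Rightarrow> real) \<Rightarrow> real \<Rightarrow> real^'k \<Rightarrow> real"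
  where "H_eps H \<epsilon> x = \<epsilon> * H ((1 / \<epsilon>) *\<^sub>R x)"

definition classical_solution ::
  "(real^'n::finite) set \<Rightarrow> (real^'k::finite \<Rightarrow> real) \<Rightarrow> real \<Rightarrow> ('n, 'k) coeffs \<Rightarrow>
   (real^'n \<Rightarrow> real) \<Rightarrow> bool"
  where "classical_solution U H \<epsilon> \<tau> u \<longleftrightarrow>
    continuous_on (closure U) u \<and> Ck_on 2 U u \<and>
    (\<forall>x\<in>U. H_eps H \<epsilon> (Lop U \<tau> u x + fvec \<tau> x) = 0) \<and>
    (\<forall>x\<in>frontier U. u x = co_g \<tau> x)"

definition feedback_control ::
  "(real^'n::finite) set \<Rightarrow> (real^'k::finite \<Rightarrow> real) \<Rightarrow> real \<Rightarrow> ('n, 'k) coeffs \<Rightarrow>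
   (real^'n \<Rightarrow> real) \<Rightarrow> real^'n \<Rightarrow> real^'k"
  where "feedback_control U H \<epsilon> \<tau> u x = gradient (H_eps H \<epsilon>) (Lop U \<tau> u x + fvec \<tau> x)"

definition linearized_solution ::
  "(real^'n::finite) set \<Rightarrow> (real^'k::finite \<Rightarrow> real) \<Rightarrow> real \<Rightarrow> ('n, 'k) coeffs \<Rightarrow>
   (real^'n \<Rightarrow> real) \<Rightarrow> ('n, 'k) coeffs \<Rightarrow> (real^'n \<Rightarrow> real) \<Rightarrow> bool"
  where "linearized_solution U H \<epsilon> \<tau> u \<delta>\<tau> \<delta>u \<longleftrightarrow>
    continuous_on (closure U) \<delta>u \<and> Ck_on 2 U \<delta>u \<and>
    (\<forall>x\<in>U. feedback_control U H \<epsilon> \<tau> u x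
        \<bullet> (Lop U \<tau> \<delta>u x + Lop U \<delta>\<tau> u x + fvec \<delta>\<tau> x) = 0) \<and>
    (\<forall>x\<in>frontier U. \<delta>u x = co_g \<delta>\<tau> x)"

section \<open>Standing assumptions\<close>

text \<open>
  The index set \<open>{1,\<dots>,K}\<close> is the finite type \<open>'k\<close>, and \<open>a\<close> enumerates the action set \<open>A\<close> without
  repetition.
\<close>

definition H1 ::
  "(real^'n::finite) set \<Rightarrow> 'a set \<Rightarrow> ('k::finite \<Rightarrow> 'a) \<Rightarrow> real \<Rightarrow> real \<Rightarrow> real \<Rightarrow>
   (real^'n \<Rightarrow> 'a \<Rightarrow> real^'n) \<Rightarrow> (real^'n \<Rightarrow> 'a \<Rightarrow> real^'n^'n) \<Rightarrow>
   (real^'n \<Rightarrow> 'a \<Rightarrow> real) \<Rightarrow> (real^'n \<Rightarrow> 'a \<Rightarrow> real) \<Rightarrow> (real^'n \<Rightarrow> real) \<Rightarrow> bool"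
  where "H1 U A a \<nu> \<Lambda> \<theta> b \<sigma> c f g \<longleftrightarrow>
    bij_betw a UNIV A \<and>
    U \<noteq> {} \<and> open U \<and> connected U \<and> bounded U \<and>
    \<nu> > 0 \<and> \<Lambda> > 0 \<and> 0 < \<theta> \<and> \<theta> \<le> 1 \<and>
    boundary_of_class 2 \<theta> U \<and> g \<in> holder_space U 2 \<theta> \<and>
    (\<forall>k. \<forall>x\<in>closure U. c x (a k) \<ge> 0) \<and>
    (\<forall>k x \<xi>. \<xi> \<bullet> ((\<sigma> x (a k) ** transpose (\<sigma> x (a k))) *v \<xi>) \<ge> \<nu> * (\<xi> \<bullet> \<xi>)) \<and>
    (\<forall>k. (\<forall>i j. (\<lambda>x. \<sigma> x (a k) $ i $ j) \<in> holder_space UNIV 0 1) \<and>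
         (\<forall>i. (\<lambda>x. b x (a k) $ i) \<in> holder_space UNIV 0 1) \<and>
         (\<lambda>x. c x (a k)) \<in> holder_space U 0 \<theta> \<and>
         (\<lambda>x. f x (a k)) \<in> holder_space U 0 \<theta> \<and>
         (\<Sum>i\<in>UNIV. \<Sum>j\<in>UNIV. holder_norm UNIV 0 1 (\<lambda>x. \<sigma> x (a k) $ i $ j))
         + (\<Sum>i\<in>UNIV. holder_norm UNIV 0 1 (\<lambda>x. b x (a k) $ i))
         + holder_norm U 0 \<theta> (\<lambda>x. c x (a k)) + holder_norm U 0 \<theta> (\<lambda>x. f x (a k)) \<le> \<Lambda>)"

definition H2 :: "(real^'k::finite \<Rightarrow> real) \<Rightarrow> real \<Rightarrow> (real^'k \<Rightarrow> ereal) \<Rightarrow> bool"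
  where "H2 H c0 \<rho> \<longleftrightarrow>
    convex_on UNIV H \<and> Ck_on 2 UNIV H \<and> c0 > 0 \<and>
    (\<forall>x. H x - c0 \<le> Max (range (\<lambda>k. x $ k)) \<and> Max (range (\<lambda>k. x $ k)) \<le> H x) \<and>
    (\<forall>y. \<rho> y = (SUP z. ereal (z \<bullet> y - H z)))"

definition base_coeffs ::
  "('k::finite \<Rightarrow> 'a) \<Rightarrow> (real^'n::finite \<Rightarrow> 'a \<Rightarrow> real^'n) \<Rightarrow> (real^'n \<Rightarrow> 'a \<Rightarrow> real^'n^'n) \<Rightarrow>
   (real^'n \<Rightarrow> 'a \<Rightarrow> real) \<Rightarrow> (real^'n \<Rightarrow> 'a \<Rightarrow> real) \<Rightarrow> (real^'n \<Rightarrow> real) \<Rightarrow> ('n, 'k) coeffs"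
  where "base_coeffs a b \<sigma> c f g =
    (\<lambda>k. (\<lambda>x. (1/2) *\<^sub>R (\<sigma> x (a k) ** transpose (\<sigma> x (a k))),
          \<lambda>x. b x (a k), \<lambda>x. c x (a k), \<lambda>x. f x (a k)), g)"

definition sigma_bound ::
  "(real^'n::finite) set \<Rightarrow> ('k::finite \<Rightarrow> 'a) \<Rightarrow> (real^'n \<Rightarrow> 'a \<Rightarrow> real^'n^'n) \<Rightarrow> real"
  where "sigma_bound U a \<sigma> =
    (SUP (i, j, k)\<in>UNIV. sup_seminorm (closure U) (\<lambda>x. \<sigma> x (a k) $ i $ j))"

text \<open>
  The exponent \<open>\<beta>0\<close> as a function of \<open>\<nu>\<close> and \<open>M\<close>; the dimension is the type \<open>'n\<close>. The constant
  \<open>C\<close> of the a priori bound is likewise a function of the quantities it may depend on. Since types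
  cannot be quantified, independence of \<open>K\<close> is not required, which only enlarges the class of
  admissible \<open>\<beta>0\<close>.
\<close>

definition regularity_exponent ::
  "'n::finite itself \<Rightarrow> 'k::finite itself \<Rightarrow> 'a itself \<Rightarrow> (real \<Rightarrow> real \<Rightarrow> real) \<Rightarrow> bool"
  where "regularity_exponent _ _ _ \<beta>0 \<longleftrightarrow>
    (\<forall>\<nu>>0. \<forall>M>0. 0 < \<beta>0 \<nu> M \<and> \<beta>0 \<nu> M < 1) \<and>
    (\<exists>C::real \<Rightarrow> real \<Rightarrow> real \<Rightarrow> (real^'n) set \<Rightarrow> real.
      \<forall>U (A::'a set) (a::'k \<Rightarrow> 'a) \<nu> \<Lambda> \<theta> b \<sigma> c f g H c0 \<rho> \<epsilon>.
        H1 U A a \<nu> \<Lambda> \<theta> b \<sigma> c f g \<and> H2 H c0 \<rho> \<and> \<epsilon> > 0 \<longrightarrow>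
        (\<exists>u. classical_solution U H \<epsilon> (base_coeffs a b \<sigma> c f g) u \<and>
             u \<in> holder_space U 2 (min (\<beta>0 \<nu> (sigma_bound U a \<sigma>)) \<theta>) \<and>
             (\<forall>w. classical_solution U H \<epsilon> (base_coeffs a b \<sigma> c f g) w \<longrightarrow>
                  (\<forall>x\<in>closure U. w x = u x))) \<and>
        (\<forall>\<beta> u. 0 < \<beta> \<and> \<beta> \<le> min (\<beta>0 \<nu> (sigma_bound U a \<sigma>)) \<theta> \<and>
               u \<in> holder_space U 2 \<beta> \<and>
               classical_solution U H \<epsilon> (base_coeffs a b \<sigma> c f g) u \<longrightarrow>
             holder_norm U 2 \<beta> u \<le> C \<nu> \<Lambda> \<beta> U * (holder_norm U 2 \<beta> g + \<epsilon> * c0 + 1)))"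

definition solution_map ::
  "(real^'n::finite) set \<Rightarrow> (real^'k::finite \<Rightarrow> real) \<Rightarrow> real \<Rightarrow> real \<Rightarrow> ('n, 'k) coeffs \<Rightarrow>
   (real^'n \<Rightarrow> real) \<Rightarrow> ('n, 'k) coeffs set \<Rightarrow> (real^'n \<Rightarrow> real) set \<Rightarrow>
   (('n, 'k) coeffs \<Rightarrow> real^'n \<Rightarrow> real) \<Rightarrow> bool"
  where "solution_map U H \<epsilon> \<beta> \<tau>0 u V W S \<longleftrightarrow>
    norm_open (Theta_space U \<beta>) (Theta_norm U \<beta>) V \<and> \<tau>0 \<in> V \<and>
    norm_open (holder_space U 2 \<beta>) (holder_norm U 2 \<beta>) W \<and> u \<in> W \<and>
    S ` V \<subseteq> W \<and>
    cont_differentiable_on (Theta_space U \<beta>) (Theta_norm U \<beta>)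
      (holder_space U 2 \<beta>) (holder_norm U 2 \<beta>) S V \<and>
    (\<forall>\<tau>\<in>V. classical_solution U H \<epsilon> \<tau> (S \<tau>))"

end

theory Submission
  imports Defs
begin

text \<open>
  The feedback control is \<open>\<lambda> = \<nabla>H\<^sub>\<epsilon> \<circ> Q\<close> with \<open>Q = L\<^sup>\<tau> u + f\<^sup>\<tau>\<close> and \<open>u = S \<tau>\<close>. The solution map \<open>S\<close> is
  differentiable into \<open>C\<^sup>2\<^sup>,\<^sup>\<beta>\<close>, the map \<open>(\<tau>, u) \<mapsto> L\<^sup>\<tau> u\<close> is bounded and bilinear into \<open>C\<^sup>0\<^sup>,\<^sup>\<beta>\<close>
  (\<open>Lop_bound_exists\<close>), and composition with \<open>\<nabla>H\<^sub>\<epsilon>\<close> is differentiable on \<open>C\<^sup>0\<^sup>,\<^sup>\<beta>\<close> because \<open>H\<close> is of class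
  \<open>C\<^sup>3\<close> (\<open>gradient_superposition\<close>). The chain rule gives the expansion, with \<open>S' \<delta>\<tau>\<close> in the place of
  \<open>\<delta>u\<close>.

  It remains to identify \<open>S' \<delta>\<tau>\<close> with the solution of the linearized Dirichlet problem. It is a
  solution, since the equation \<open>H\<^sub>\<epsilon> (L\<^sup>\<tau> (S \<tau>) + f\<^sup>\<tau>) = 0\<close> and the boundary condition can be
  differentiated in \<open>\<tau>\<close> pointwise. It is the only one: \<open>H\<close> is convex and stays within a bounded
  distance of the maximum of the coordinates, so \<open>\<nabla>H\<^sub>\<epsilon>\<close> takes values in the probability simplex
  (\<open>gradient_in_simplex\<close>), \<open>\<lambda>\<^sup>T L\<close> is uniformly elliptic with nonpositive zeroth-order part, and the weak
  maximum principle holds (\<open>weak_maximum_principle\<close>, \<open>linearized_solution_le\<close>).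

  Boundedness of the bilinear map is where the boundary regularity enters. The norm of \<open>C\<^sup>2\<^sup>,\<^sup>\<beta>\<close>
  contains the Hoelder seminorms of the second derivatives only, and those of \<open>u\<close> and its gradient
  must be recovered from suprema of derivatives (\<open>holder_space_2_deriv_bounds\<close>). This is possible because the
  straightening maps show that nearby points are joined inside the domain by paths of comparable
  length.
\<close>

section \<open>Calculus with partial derivatives\<close>

lemma iter_partial_Nil [simp]: "iter_partial [] \<phi> = \<phi>"
  by (simp add: iter_partial_def)

lemma iter_partial_Cons [simp]: "iter_partial (i # l) \<phi> = partial_deriv i (iter_partial l \<phi>)"
  by (simp add: iter_partial_def)

lemma iter_partial_snoc: "iter_partial (l @ [i]) \<phi> = iter_partial l (partial_deriv i \<phi>)"
  by (simp add: iter_partial_def)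

lemma Ck_on_mono: "Ck_on k U \<phi> \<Longrightarrow> j \<le> k \<Longrightarrow> Ck_on j U \<phi>"
  unfolding Ck_on_def by auto

lemma Ck_on_partial: "Ck_on (Suc k) U \<phi> \<Longrightarrow> Ck_on k U (partial_deriv i \<phi>)"
  unfolding Ck_on_def
  by (auto simp flip: iter_partial_snoc)

lemma Ck_on_continuous: "Ck_on k U \<phi> \<Longrightarrow> continuous_on U \<phi>"
  unfolding Ck_on_def by (metis iter_partial_Nil le0 list.size(3))

lemma Ck_on_differentiable:
  "Ck_on (Suc k) U \<phi> \<Longrightarrow> x \<in> U \<Longrightarrow> (\<lambda>t::real. \<phi> (x + t *\<^sub>R axis i 1)) differentiable (at 0)"
  unfolding Ck_on_def by (metis iter_partial_Nil list.size(3) zero_less_Suc)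

lemma Ck_on_SucI:
  assumes "\<And>x i. x \<in> U \<Longrightarrow> (\<lambda>t::real. \<phi> (x + t *\<^sub>R axis i 1)) differentiable (at 0)"
    and "continuous_on U \<phi>" and "\<And>i. Ck_on k U (partial_deriv i \<phi>)"
  shows "Ck_on (Suc k) U \<phi>"
  unfolding Ck_on_def
proof (intro conjI allI impI ballI)
  fix l x i assume l: "length (l::'a list) < Suc k" and x: "x \<in> U"
  show "(\<lambda>t. iter_partial l \<phi> (x + t *\<^sub>R axis i 1)) differentiable (at 0)"
  proof (cases l rule: rev_cases)
    case Nil then show ?thesis using assms(1) x by simp
  next
    case (snoc l' j)
    then show ?thesis using assms(3)[of j] l x unfolding Ck_on_def by (auto simp: iter_partial_snoc)
  qed
next
  fix l :: "'a list" assume l: "length l \<le> Suc k"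
  show "continuous_on U (iter_partial l \<phi>)"
  proof (cases l rule: rev_cases)
    case Nil then show ?thesis using assms(2) by simp
  next
    case (snoc l' j)
    then show ?thesis using assms(3)[of j] l unfolding Ck_on_def by (auto simp: iter_partial_snoc)
  qed
qed

lemma Ck_on_0: "Ck_on 0 U \<phi> \<longleftrightarrow> continuous_on U \<phi>"
  by (simp add: Ck_on_def)

lemma partial_deriv_at:
  assumes "Ck_on (Suc k) U \<phi>" "y + s *\<^sub>R axis i 1 \<in> U"
  shows "((\<lambda>t. \<phi> (y + t *\<^sub>R axis i 1)) has_vector_derivative
           partial_deriv i \<phi> (y + s *\<^sub>R axis i 1)) (at s)"
proof -
  have "((\<lambda>t. \<phi> ((y + s *\<^sub>R axis i 1) + t *\<^sub>R axis i 1)) has_vector_derivative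
           partial_deriv i \<phi> (y + s *\<^sub>R axis i 1)) (at 0)"
    using Ck_on_differentiable[OF assms] unfolding partial_deriv_def
    by (simp add: vector_derivative_works)
  then have "((\<lambda>t. \<phi> ((y + s *\<^sub>R axis i 1) + t *\<^sub>R axis i 1)) \<circ> (\<lambda>t. t - s) has_vector_derivative
           (1 *\<^sub>R partial_deriv i \<phi> (y + s *\<^sub>R axis i 1))) (at s)"
    by (intro vector_diff_chain_at) (auto intro!: derivative_eq_intros)
  moreover have "(\<lambda>t. \<phi> ((y + s *\<^sub>R axis i 1) + t *\<^sub>R axis i 1)) \<circ> (\<lambda>t. t - s)
      = (\<lambda>t. \<phi> (y + t *\<^sub>R axis i 1))"
    by (auto simp: fun_eq_iff algebra_simps)
  ultimately show ?thesis by simp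
qed

lemma partial_deriv_eqI:
  assumes "((\<lambda>t. \<phi> (x + t *\<^sub>R axis i 1)) has_vector_derivative D) (at 0)"
  shows "partial_deriv i \<phi> x = D"
  using assms unfolding partial_deriv_def by (rule vector_derivative_at)

lemma vector_derivative_linearization_bound:
  fixes f :: "real \<Rightarrow> 'b::real_normed_vector"
  assumes f': "\<And>t. t \<in> closed_segment a b \<Longrightarrow> (f has_vector_derivative f' t) (at t within closed_segment a b)"
    and B: "\<And>t. t \<in> closed_segment a b \<Longrightarrow> norm (f' t - c) \<le> B"
  shows "norm (f b - f a - (b - a) *\<^sub>R c) \<le> B * \<bar>b - a\<bar>"
proof -
  have "norm ((f b - b *\<^sub>R c) - (f a - a *\<^sub>R c)) \<le> B * norm (b - a)"
  proof (rule differentiable_bound[where S = "closed_segment a b" and f = "\<lambda>t. f t - t *\<^sub>R c"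
        and f' = "\<lambda>t h. h *\<^sub>R (f' t - c)"])
    show "((\<lambda>t. f t - t *\<^sub>R c) has_derivative (\<lambda>h. h *\<^sub>R (f' t - c))) (at t within closed_segment a b)"
      if "t \<in> closed_segment a b" for t
      using f'[OF that] unfolding has_vector_derivative_def
      by (auto intro!: derivative_eq_intros simp: algebra_simps)
    show "onorm (\<lambda>h. h *\<^sub>R (f' t - c)) \<le> B" if "t \<in> closed_segment a b" for t
      using B[OF that] by (intro onorm_le) (auto simp: mult.commute[of B] intro: mult_left_mono)
  qed auto
  then show ?thesis by (simp add: algebra_simps)
qed

lemma has_vector_derivative_at_0I:
  fixes y :: "real \<Rightarrow> 'b::real_normed_vector"
  assumes "\<And>e. e > 0 \<Longrightarrow> \<exists>d>0. \<forall>t. \<bar>t\<bar> < d \<longrightarrow> norm (y t - y 0 - t *\<^sub>R D) \<le> e * \<bar>t\<bar>"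
  shows "(y has_vector_derivative D) (at 0)"
  unfolding has_vector_derivative_def has_derivative_at_alt
  using assms by (auto intro: bounded_linear_scaleR_left)

text \<open>The increment is split into increments along the coordinate axes; along each of them only one
  partial derivative occurs, and it is close to its value at \<open>x\<close> by continuity.\<close>

lemma C1_has_derivative:
  fixes \<phi> :: "real^'n::finite \<Rightarrow> 'b::real_normed_vector"
  assumes U: "open U" and C1: "Ck_on (Suc 0) U \<phi>" and x: "x \<in> U"
  shows "(\<phi> has_derivative (\<lambda>h. \<Sum>i\<in>UNIV. h $ i *\<^sub>R partial_deriv i \<phi> x)) (at x)"
proof -
  let ?D = "\<lambda>i. partial_deriv i \<phi>"
  have bl: "bounded_linear (\<lambda>h::real^'n. \<Sum>i\<in>UNIV. h $ i *\<^sub>R ?D i x)"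
    by (intro bounded_linear_sum bounded_linear_scaleR_const bounded_linear_vec_nth)
  have cD: "continuous_on U (?D i)" for i
    using Ck_on_partial[OF C1] Ck_on_continuous by blast
  have "\<exists>d>0. \<forall>y. norm (y - x) < d \<longrightarrow>
      norm (\<phi> y - \<phi> x - (\<Sum>i\<in>UNIV. (y - x) $ i *\<^sub>R ?D i x)) \<le> e * norm (y - x)" if e: "e > 0" for e
  proof -
    define e' where "e' = e / CARD('n)"
    have e': "e' > 0" using e by (simp add: e'_def)
    have "\<forall>\<^sub>F y in at x. \<forall>i. dist (?D i y) (?D i x) < e'"
    proof -
      have "(?D i \<longlongrightarrow> ?D i x) (at x)" for i
        using cD[of i] U x by (simp add: continuous_on_eq_continuous_at isCont_def)
      then show ?thesis
        using e' by (intro eventually_all_finite) (auto dest: tendstoD)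
    qed
    moreover have "\<forall>\<^sub>F y in at x. y \<in> U"
      using U x by (simp add: eventually_at_in_open')
    ultimately have "\<forall>\<^sub>F y in at x. y \<in> U \<and> (\<forall>i. dist (?D i y) (?D i x) < e')"
      by eventually_elim auto
    then obtain d where d: "d > 0" and
      dd: "\<And>y. y \<noteq> x \<Longrightarrow> dist y x < d \<Longrightarrow> y \<in> U \<and> (\<forall>i. dist (?D i y) (?D i x) < e')"
      unfolding eventually_at by auto
    have dd': "y \<in> U" "norm (?D i y - ?D i x) \<le> e'" if "norm (y - x) < d" for y i
    proof -
      have "y = x \<or> y \<in> U \<and> dist (?D i y) (?D i x) < e'"
        using dd[of y] that by (auto simp: dist_norm)
      then show "y \<in> U" "norm (?D i y - ?D i x) \<le> e'"
        using x e' by (auto simp: dist_norm)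
    qed
    have claim: "norm (\<phi> (x + (\<chi> i. if i \<in> I then h $ i else 0)) - \<phi> x - (\<Sum>i\<in>I. h $ i *\<^sub>R ?D i x))
        \<le> card I * (e' * norm h)" if h: "norm h < d" for h I
      using finite[of I]
    proof (induction I rule: finite_induct)
      case empty
      have "(\<chi> i. if i \<in> {} then h $ i else 0) = (0::real^'n)" by (simp add: vec_eq_iff)
      then show ?case by simp
    next
      case (insert i I)
      define hI where "hI = (\<chi> i. if i \<in> I then h $ i else 0)"
      have hI': "(\<chi> j. if j \<in> insert i I then h $ j else 0) = hI + h $ i *\<^sub>R axis i 1"
        using insert.hyps by (auto simp: hI_def vec_eq_iff axis_def)
      have seg: "norm (hI + t *\<^sub>R axis i 1) \<le> norm h" if "t \<in> closed_segment 0 (h $ i)" for t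
      proof (rule norm_le_componentwise_cart)
        fix j
        have "\<bar>t\<bar> \<le> \<bar>h $ i\<bar>" using that by (auto simp: closed_segment_eq_real_ivl split: if_splits)
        then show "norm ((hI + t *\<^sub>R axis i 1) $ j) \<le> norm (h $ j)"
          using insert.hyps by (auto simp: hI_def axis_def)
      qed
      have "norm (\<phi> ((x + hI) + h $ i *\<^sub>R axis i 1) - \<phi> ((x + hI) + 0 *\<^sub>R axis i 1)
              - (h $ i - 0) *\<^sub>R ?D i x) \<le> e' * \<bar>h $ i - 0\<bar>"
      proof (rule vector_derivative_linearization_bound)
        fix t assume t: "t \<in> closed_segment 0 (h $ i)"
        have n: "norm ((x + hI) + t *\<^sub>R axis i 1 - x) < d" using seg[OF t] h by (simp add: add.assoc)
        show "((\<lambda>t. \<phi> (x + hI + t *\<^sub>R axis i 1)) has_vector_derivative ?D i (x + hI + t *\<^sub>R axis i 1))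
               (at t within closed_segment 0 (h $ i))"
          by (rule has_vector_derivative_at_within, rule partial_deriv_at[OF C1]) (rule dd'(1)[OF n])
        show "norm (?D i (x + hI + t *\<^sub>R axis i 1) - ?D i x) \<le> e'"
          by (rule dd'(2)[OF n])
      qed
      also have "\<dots> \<le> e' * norm h"
        using component_le_norm_cart[of h i] e' by simp
      finally have "norm (\<phi> (x + hI + h $ i *\<^sub>R axis i 1) - \<phi> (x + hI) - h $ i *\<^sub>R ?D i x) \<le> e' * norm h"
        by simp
      moreover have "norm (\<phi> (x + hI) - \<phi> x - (\<Sum>i\<in>I. h $ i *\<^sub>R ?D i x)) \<le> card I * (e' * norm h)"
        using insert.IH by (simp add: hI_def)
      moreover have "\<phi> (x + (hI + h $ i *\<^sub>R axis i 1)) - \<phi> x - (\<Sum>i\<in>insert i I. h $ i *\<^sub>R ?D i x)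
          = (\<phi> (x + hI + h $ i *\<^sub>R axis i 1) - \<phi> (x + hI) - h $ i *\<^sub>R ?D i x)
            + (\<phi> (x + hI) - \<phi> x - (\<Sum>i\<in>I. h $ i *\<^sub>R ?D i x))"
        using insert.hyps by (simp add: add.assoc)
      ultimately have "norm (\<phi> (x + (hI + h $ i *\<^sub>R axis i 1)) - \<phi> x - (\<Sum>i\<in>insert i I. h $ i *\<^sub>R ?D i x))
          \<le> e' * norm h + card I * (e' * norm h)"
        by (metis (no_types, lifting) norm_triangle_mono)
      then show ?case
        unfolding hI' using insert.hyps by (simp add: algebra_simps)
    qed
    show ?thesis
    proof (intro exI[of _ d] conjI allI impI d)
      fix y assume y: "norm (y - x) < d"
      have "(\<chi> i. if i \<in> UNIV then (y - x) $ i else 0) = y - x" by (simp add: vec_eq_iff)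
      then show "norm (\<phi> y - \<phi> x - (\<Sum>i\<in>UNIV. (y - x) $ i *\<^sub>R ?D i x)) \<le> e * norm (y - x)"
        using claim[OF y, of UNIV] by (simp add: e'_def)
    qed
  qed
  then show ?thesis
    unfolding has_derivative_at_alt using bl by blast
qed

lemma onorm_partials_le:
  fixes D :: "'n::finite \<Rightarrow> 'b::real_normed_vector"
  assumes "\<And>i. norm (D i) \<le> B"
  shows "onorm (\<lambda>h::real^'n. \<Sum>i\<in>UNIV. h $ i *\<^sub>R D i) \<le> real CARD('n) * B"
proof (rule onorm_le)
  fix h :: "real^'n"
  have "norm (\<Sum>i\<in>UNIV. h $ i *\<^sub>R D i) \<le> (\<Sum>i\<in>(UNIV::'n set). norm h * B)"
    using component_le_norm_cart[of h] assms
    by (intro sum_norm_le) (auto intro!: mult_mono)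
  then show "norm (\<Sum>i\<in>UNIV. h $ i *\<^sub>R D i) \<le> CARD('n) * B * norm h"
    by (simp add: algebra_simps)
qed

lemma C1_lipschitz_on_convex:
  fixes \<phi> :: "real^'n::finite \<Rightarrow> 'b::real_normed_vector"
  assumes U: "open U" and C1: "Ck_on (Suc 0) U \<phi>" and S: "S \<subseteq> U" "convex S"
    and B: "\<And>x i. x \<in> S \<Longrightarrow> norm (partial_deriv i \<phi> x) \<le> B" and xy: "x \<in> S" "y \<in> S"
  shows "norm (\<phi> x - \<phi> y) \<le> real CARD('n) * B * norm (x - y)"
proof (rule differentiable_bound[OF S(2) _ _ xy])
  fix z assume z: "z \<in> S"
  show "(\<phi> has_derivative (\<lambda>h. \<Sum>i\<in>UNIV. h $ i *\<^sub>R partial_deriv i \<phi> z)) (at z within S)"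
    using C1_has_derivative[OF U C1, of z] z S by (auto intro: has_derivative_at_withinI)
  show "onorm (\<lambda>h. \<Sum>i\<in>UNIV. h $ i *\<^sub>R partial_deriv i \<phi> z) \<le> real CARD('n) * B"
    by (rule onorm_partials_le) (rule B[OF z])
qed

text \<open>The left-hand side is symmetric in \<open>i\<close> and \<open>j\<close>, so each of the two mixed derivatives is a limit
  of the same difference quotients. This is what makes the unspecified order of differentiation in
  \<^const>\<open>multi_deriv\<close> harmless.\<close>

lemma second_difference_mvt:
  fixes \<phi> :: "real^'n::finite \<Rightarrow> real"
  assumes C2: "Ck_on 2 U \<phi>" and s: "s > 0"
    and box: "\<And>p q. p \<in> {0..s} \<Longrightarrow> q \<in> {0..s} \<Longrightarrow> x + p *\<^sub>R axis i 1 + q *\<^sub>R axis j 1 \<in> U"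
  shows "\<exists>p\<in>{0..s}. \<exists>q\<in>{0..s}.
    \<phi> (x + s *\<^sub>R axis i 1 + s *\<^sub>R axis j 1) - \<phi> (x + s *\<^sub>R axis i 1) - \<phi> (x + s *\<^sub>R axis j 1) + \<phi> x
    = s * s * partial_deriv j (partial_deriv i \<phi>) (x + p *\<^sub>R axis i 1 + q *\<^sub>R axis j 1)"
proof -
  have C2': "Ck_on (Suc (Suc 0)) U \<phi>" using C2 by (simp add: numeral_2_eq_2)
  let ?F = "\<lambda>p. \<phi> ((x + s *\<^sub>R axis j 1) + p *\<^sub>R axis i 1) - \<phi> (x + p *\<^sub>R axis i 1)"
  let ?F' = "\<lambda>p. partial_deriv i \<phi> ((x + s *\<^sub>R axis j 1) + p *\<^sub>R axis i 1) - partial_deriv i \<phi> (x + p *\<^sub>R axis i 1)"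
  have "\<exists>p. 0 < p \<and> p < s \<and> ?F s - ?F 0 = (s - 0) * ?F' p"
  proof (rule MVT2)
    fix p assume p: "0 \<le> p" "p \<le> s"
    show "(?F has_real_derivative ?F' p) (at p)"
      unfolding has_real_derivative_iff_has_vector_derivative
      using box[of p s] box[of p 0] p s
      by (intro has_vector_derivative_diff partial_deriv_at[OF C2']) (auto simp: algebra_simps)
  qed (use s in auto)
  then obtain p where p: "0 < p" "p < s" "?F s - ?F 0 = s * ?F' p" by auto
  let ?G = "\<lambda>q. partial_deriv i \<phi> ((x + p *\<^sub>R axis i 1) + q *\<^sub>R axis j 1)"
  let ?G' = "\<lambda>q. partial_deriv j (partial_deriv i \<phi>) ((x + p *\<^sub>R axis i 1) + q *\<^sub>R axis j 1)"
  have "\<exists>q. 0 < q \<and> q < s \<and> ?G s - ?G 0 = (s - 0) * ?G' q"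
  proof (rule MVT2)
    fix q assume q: "0 \<le> q" "q \<le> s"
    show "(?G has_real_derivative ?G' q) (at q)"
      unfolding has_real_derivative_iff_has_vector_derivative
      using box[of p q] p q
      by (intro partial_deriv_at[OF Ck_on_partial[OF C2']]) auto
  qed (use s in auto)
  then obtain q where q: "0 < q" "q < s" "?G s - ?G 0 = s * ?G' q" by auto
  have "?F' p = ?G s - ?G 0" by (simp add: algebra_simps)
  then have "?F s - ?F 0 = s * s * ?G' q" using p q by simp
  then show ?thesis using p(1,2) q(1,2)
    by (intro bexI[of _ p] bexI[of _ q]) (auto simp: algebra_simps)
qed

lemma Schwarz_partial_deriv:
  fixes \<phi> :: "real^'n::finite \<Rightarrow> real"
  assumes U: "open U" and C2: "Ck_on 2 U \<phi>" and x: "x \<in> U"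
  shows "partial_deriv i (partial_deriv j \<phi>) x = partial_deriv j (partial_deriv i \<phi>) x"
proof (rule ccontr)
  let ?A = "partial_deriv i (partial_deriv j \<phi>)" and ?B = "partial_deriv j (partial_deriv i \<phi>)"
  assume ne: "?A x \<noteq> ?B x"
  define e where "e = \<bar>?A x - ?B x\<bar> / 2"
  have e: "e > 0" using ne by (simp add: e_def)
  have C2': "Ck_on (Suc (Suc 0)) U \<phi>" using C2 by (simp add: numeral_2_eq_2)
  have "isCont ?A x" "isCont ?B x"
    using Ck_on_continuous[OF Ck_on_partial[OF Ck_on_partial[OF C2']]] U x
    by (simp_all add: continuous_on_eq_continuous_at)
  then obtain d1 d2 where d1: "d1 > 0" "\<And>y. dist y x < d1 \<Longrightarrow> dist (?A y) (?A x) < e"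
    and d2: "d2 > 0" "\<And>y. dist y x < d2 \<Longrightarrow> dist (?B y) (?B x) < e"
    using e unfolding continuous_at_eps_delta by (metis dist_commute)
  obtain d3 where d3: "d3 > 0" "ball x d3 \<subseteq> U" using U x openE by blast
  define s where "s = min d1 (min d2 d3) / 3"
  have s: "s > 0" "2 * s < d1" "2 * s < d2" "2 * s < d3" using d1 d2 d3 by (auto simp: s_def)
  have near: "dist (x + p *\<^sub>R axis k 1 + q *\<^sub>R axis l 1) x \<le> 2 * s"
    if "p \<in> {0..s}" "q \<in> {0..s}" for p q and k l :: 'n
  proof -
    have "norm (p *\<^sub>R axis k 1 + q *\<^sub>R axis l (1::real)) \<le> \<bar>p\<bar> + \<bar>q\<bar>"
      by (rule order_trans[OF norm_triangle_ineq]) simp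
    then show ?thesis using that by (simp add: dist_norm add.assoc)
  qed
  have box: "x + p *\<^sub>R axis k 1 + q *\<^sub>R axis l 1 \<in> U"
    if "p \<in> {0..s}" "q \<in> {0..s}" for p q and k l :: 'n
    using near[OF that, of k l] s d3 by (auto simp: dist_commute subset_iff)
  from second_difference_mvt[OF C2 s(1) box, of i j]
  obtain p q where pq: "p \<in> {0..s}" "q \<in> {0..s}" and 1: "\<phi> (x + s *\<^sub>R axis i 1 + s *\<^sub>R axis j 1) - \<phi> (x + s *\<^sub>R axis i 1) - \<phi> (x + s *\<^sub>R axis j 1) + \<phi> x
    = s * s * ?B (x + p *\<^sub>R axis i 1 + q *\<^sub>R axis j 1)" by auto
  from second_difference_mvt[OF C2 s(1) box, of j i]
  obtain p' q' where pq': "p' \<in> {0..s}" "q' \<in> {0..s}" and 2: "\<phi> (x + s *\<^sub>R axis j 1 + s *\<^sub>R axis i 1) - \<phi> (x + s *\<^sub>R axis j 1) - \<phi> (x + s *\<^sub>R axis i 1) + \<phi> x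
    = s * s * ?A (x + p' *\<^sub>R axis j 1 + q' *\<^sub>R axis i 1)" by auto
  have "s * s * ?B (x + p *\<^sub>R axis i 1 + q *\<^sub>R axis j 1) = s * s * ?A (x + p' *\<^sub>R axis j 1 + q' *\<^sub>R axis i 1)"
    using 1 2 by (simp add: algebra_simps)
  then have "?B (x + p *\<^sub>R axis i 1 + q *\<^sub>R axis j 1) = ?A (x + p' *\<^sub>R axis j 1 + q' *\<^sub>R axis i 1)"
    using s by simp
  moreover have "dist (?B (x + p *\<^sub>R axis i 1 + q *\<^sub>R axis j 1)) (?B x) < e"
    using near[OF pq, of i j] s by (intro d2) auto
  moreover have "dist (?A (x + p' *\<^sub>R axis j 1 + q' *\<^sub>R axis i 1)) (?A x) < e"
    using near[OF pq', of j i] s by (intro d1) auto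
  ultimately have "\<bar>?A x - ?B x\<bar> < 2 * e" unfolding dist_real_def by linarith
  then show False by (simp add: e_def)
qed

lemma partial_deriv_cong:
  assumes "open U" "\<And>y. y \<in> U \<Longrightarrow> \<phi> y = \<psi> y" "x \<in> U"
  shows "partial_deriv i \<phi> x = partial_deriv i \<psi> x"
proof -
  have "((\<lambda>t::real. x + t *\<^sub>R axis i 1) \<longlongrightarrow> x + 0 *\<^sub>R axis i 1) (nhds 0)"
    by (intro tendsto_intros) (simp add: filterlim_ident)
  then have "\<forall>\<^sub>F t::real in nhds 0. x + t *\<^sub>R axis i 1 \<in> U"
    by (rule topological_tendstoD) (use assms in auto)
  then have "\<forall>\<^sub>F t::real in nhds 0. t \<in> UNIV \<longrightarrow> \<phi> (x + t *\<^sub>R axis i 1) = \<psi> (x + t *\<^sub>R axis i 1)"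
    by eventually_elim (use assms in auto)
  then show ?thesis unfolding partial_deriv_def
    by (rule vector_derivative_cong_eq) auto
qed

lemma iter_partial_cong:
  assumes "open U" "\<And>y. y \<in> U \<Longrightarrow> \<phi> y = \<psi> y" "x \<in> U"
  shows "iter_partial l \<phi> x = iter_partial l \<psi> x"
  using assms(3)
proof (induction l arbitrary: x)
  case (Cons i l)
  then show ?case using partial_deriv_cong[OF assms(1), of "iter_partial l \<phi>"] by simp
qed (use assms in auto)

lemma iter_partial_has_vector_derivative:
  assumes "Ck_on k U \<phi>" "length l < k" "x \<in> U"
  shows "((\<lambda>t. iter_partial l \<phi> (x + t *\<^sub>R axis i 1)) has_vector_derivative
           iter_partial (i # l) \<phi> x) (at 0)"
  using assms unfolding Ck_on_def
  by (simp add: partial_deriv_def vector_derivative_works)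

lemma has_vector_derivative_line_cong:
  fixes x :: "real^'n::finite"
  assumes U: "open U" "x \<in> U" and eq: "\<And>y. y \<in> U \<Longrightarrow> \<phi> y = \<psi> y"
    and D: "((\<lambda>t. \<phi> (x + t *\<^sub>R axis i 1)) has_vector_derivative D) (at 0)"
  shows "((\<lambda>t. \<psi> (x + t *\<^sub>R axis i 1)) has_vector_derivative D) (at 0)"
proof -
  have "((\<lambda>t::real. x + t *\<^sub>R axis i 1) \<longlongrightarrow> x + 0 *\<^sub>R axis i 1) (nhds 0)"
    by (intro tendsto_intros) (simp add: filterlim_ident)
  then have "\<forall>\<^sub>F t::real in nhds 0. x + t *\<^sub>R axis i 1 \<in> U"
    by (rule topological_tendstoD) (use assms in auto)
  then have "\<forall>\<^sub>F t::real in nhds 0. \<phi> (x + t *\<^sub>R axis i 1) = \<psi> (x + t *\<^sub>R axis i 1)"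
    by eventually_elim (use assms in auto)
  then have "((\<lambda>t. \<phi> (x + t *\<^sub>R axis i 1)) has_vector_derivative D) (at 0 within UNIV) \<longleftrightarrow>
      ((\<lambda>t. \<psi> (x + t *\<^sub>R axis i 1)) has_vector_derivative D) (at 0 within UNIV)"
    by (intro has_vector_derivative_cong_ev) (use eq U in \<open>auto elim!: eventually_mono\<close>)
  then show ?thesis using D by simp
qed

lemma iter_partial_lincomb_deriv:
  fixes \<phi> \<psi> :: "real^'n::finite \<Rightarrow> 'b::real_normed_vector"
  assumes U: "open U" and \<phi>: "Ck_on k U \<phi>" and \<psi>: "Ck_on k U \<psi>"
    and IH: "\<And>y. y \<in> U \<Longrightarrow> iter_partial l (\<lambda>x. r *\<^sub>R \<phi> x + s *\<^sub>R \<psi> x) y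
         = r *\<^sub>R iter_partial l \<phi> y + s *\<^sub>R iter_partial l \<psi> y"
    and l: "length l < k" and x: "x \<in> U"
  shows "((\<lambda>t. iter_partial l (\<lambda>x. r *\<^sub>R \<phi> x + s *\<^sub>R \<psi> x) (x + t *\<^sub>R axis i 1)) has_vector_derivative
          (r *\<^sub>R iter_partial (i # l) \<phi> x + s *\<^sub>R iter_partial (i # l) \<psi> x)) (at 0)"
proof (rule has_vector_derivative_line_cong[OF U x IH[symmetric]])
  show "((\<lambda>t. r *\<^sub>R iter_partial l \<phi> (x + t *\<^sub>R axis i 1) + s *\<^sub>R iter_partial l \<psi> (x + t *\<^sub>R axis i 1))
      has_vector_derivative (r *\<^sub>R iter_partial (i # l) \<phi> x + s *\<^sub>R iter_partial (i # l) \<psi> x)) (at 0)"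
    using iter_partial_has_vector_derivative[OF \<phi> l x, of i] iter_partial_has_vector_derivative[OF \<psi> l x, of i]
    unfolding has_vector_derivative_def
    by (auto intro!: derivative_eq_intros simp: algebra_simps)
qed

lemma iter_partial_lincomb:
  fixes \<phi> \<psi> :: "real^'n::finite \<Rightarrow> 'b::real_normed_vector"
  assumes U: "open U" and \<phi>: "Ck_on k U \<phi>" and \<psi>: "Ck_on k U \<psi>"
    and "length l \<le> k" "x \<in> U"
  shows "iter_partial l (\<lambda>x. r *\<^sub>R \<phi> x + s *\<^sub>R \<psi> x) x = r *\<^sub>R iter_partial l \<phi> x + s *\<^sub>R iter_partial l \<psi> x"
  using assms(4,5)
proof (induction l arbitrary: x)
  case (Cons i l)
  have "((\<lambda>t. iter_partial l (\<lambda>x. r *\<^sub>R \<phi> x + s *\<^sub>R \<psi> x) (x + t *\<^sub>R axis i 1)) has_vector_derivative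
          (r *\<^sub>R iter_partial (i # l) \<phi> x + s *\<^sub>R iter_partial (i # l) \<psi> x)) (at 0)"
    using Cons by (intro iter_partial_lincomb_deriv[OF U \<phi> \<psi>]) auto
  then show ?case by (simp add: partial_deriv_eqI)
qed auto

lemma Ck_on_lincomb:
  fixes \<phi> \<psi> :: "real^'n::finite \<Rightarrow> 'b::real_normed_vector"
  assumes U: "open U" and \<phi>: "Ck_on k U \<phi>" and \<psi>: "Ck_on k U \<psi>"
  shows "Ck_on k U (\<lambda>x. r *\<^sub>R \<phi> x + s *\<^sub>R \<psi> x)"
  unfolding Ck_on_def
proof (intro conjI allI impI ballI)
  fix l x i assume l: "length (l::'n list) < k" and x: "x \<in> U"
  show "(\<lambda>t. iter_partial l (\<lambda>x. r *\<^sub>R \<phi> x + s *\<^sub>R \<psi> x) (x + t *\<^sub>R axis i 1)) differentiable (at 0)"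
    using iter_partial_lincomb_deriv[OF U \<phi> \<psi> iter_partial_lincomb[OF U \<phi> \<psi>] l x] l
    by (auto intro: differentiableI_vector)
next
  fix l :: "'n list" assume l: "length l \<le> k"
  have "continuous_on U (\<lambda>x. r *\<^sub>R iter_partial l \<phi> x + s *\<^sub>R iter_partial l \<psi> x)"
    using \<phi> \<psi> l unfolding Ck_on_def by (intro continuous_intros) auto
  then show "continuous_on U (iter_partial l (\<lambda>x. r *\<^sub>R \<phi> x + s *\<^sub>R \<psi> x))"
    by (rule continuous_on_eq) (use iter_partial_lincomb[OF U \<phi> \<psi> l] in auto)
qed

lemma partial_deriv_scaled:
  fixes \<phi> :: "real^'k::finite \<Rightarrow> real"
  assumes "Ck_on (Suc k) UNIV \<phi>"
  shows "((\<lambda>t. c * \<phi> (s *\<^sub>R (x + t *\<^sub>R axis i 1))) has_vector_derivative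
           (c * s) * partial_deriv i \<phi> (s *\<^sub>R x)) (at 0)"
proof -
  have "((\<lambda>t. \<phi> (s *\<^sub>R x + t *\<^sub>R axis i 1)) has_vector_derivative partial_deriv i \<phi> (s *\<^sub>R x)) (at (0 * s))"
    using partial_deriv_at[OF assms, of "s *\<^sub>R x" 0 i] by simp
  then have "(((\<lambda>t. \<phi> (s *\<^sub>R x + t *\<^sub>R axis i 1)) \<circ> (\<lambda>t. t * s)) has_vector_derivative s *\<^sub>R partial_deriv i \<phi> (s *\<^sub>R x)) (at 0)"
    by (intro vector_diff_chain_at) (auto intro!: derivative_eq_intros simp: has_real_derivative_iff_has_vector_derivative[symmetric])
  then have "((\<lambda>t. c * \<phi> (s *\<^sub>R (x + t *\<^sub>R axis i 1))) has_vector_derivative c * (s *\<^sub>R partial_deriv i \<phi> (s *\<^sub>R x))) (at 0)"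
    by (intro has_vector_derivative_mult_right) (simp add: o_def scaleR_add_right mult.commute)
  then show ?thesis by (simp add: mult.assoc)
qed

lemma Ck_on_scaled:
  fixes \<phi> :: "real^'k::finite \<Rightarrow> real"
  assumes "Ck_on k UNIV \<phi>"
  shows "Ck_on k UNIV (\<lambda>x. c * \<phi> (s *\<^sub>R x))"
  using assms
proof (induction k arbitrary: c \<phi>)
  case 0
  then show ?case unfolding Ck_on_0
    by (auto intro!: continuous_intros continuous_on_compose2[of UNIV \<phi>])
next
  case (Suc k)
  note d = partial_deriv_scaled[OF Suc.prems]
  have "partial_deriv i (\<lambda>x. c * \<phi> (s *\<^sub>R x)) = (\<lambda>x. (c * s) * partial_deriv i \<phi> (s *\<^sub>R x))" for i
    using d by (intro ext partial_deriv_eqI)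
  moreover have "Ck_on k UNIV (\<lambda>x. (c * s) * partial_deriv i \<phi> (s *\<^sub>R x))" for i
    by (rule Suc.IH[OF Ck_on_partial[OF Suc.prems]])
  moreover have "continuous_on UNIV (\<lambda>x. c * \<phi> (s *\<^sub>R x))"
    using Ck_on_continuous[OF Suc.prems]
    by (auto intro!: continuous_intros continuous_on_compose2[of UNIV \<phi>])
  ultimately show ?case
    by (intro Ck_on_SucI differentiableI_vector[OF d]) auto
qed

lemma multi_deriv_eq:
  obtains l where "mset l = \<gamma>" "length l = size \<gamma>" "\<And>\<phi>::real^'n::finite \<Rightarrow> 'b::real_normed_vector. multi_deriv \<gamma> \<phi> = iter_partial l \<phi>"
proof -
  have "\<exists>l. mset l = \<gamma>" by (rule ex_mset)
  then have "mset (SOME l. mset l = \<gamma>) = \<gamma>" by (rule someI_ex)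
  then show ?thesis using that[of "SOME l. mset l = \<gamma>"] by (auto simp: multi_deriv_def simp flip: size_mset)
qed

lemma multi_deriv_single: "multi_deriv {#i#} \<phi> = partial_deriv i \<phi>"
proof -
  obtain l where l: "mset l = {#i#}" "multi_deriv {#i#} \<phi> = iter_partial l \<phi>"
    using multi_deriv_eq by metis
  then show ?thesis by (auto simp: mset_single_iff)
qed

lemma multi_deriv_pair:
  fixes \<phi> :: "real^'n::finite \<Rightarrow> real"
  assumes "open U" "Ck_on 2 U \<phi>" "x \<in> U"
  shows "multi_deriv {#i, j#} \<phi> x = partial_deriv i (partial_deriv j \<phi>) x"
proof -
  obtain l where l: "mset l = {#i, j#}" "length l = size {#i,j#}" "multi_deriv {#i,j#} \<phi> = iter_partial l \<phi>"
    using multi_deriv_eq by metis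
  then obtain p q where pq: "l = [p, q]" by (auto simp: length_Suc_conv numeral_2_eq_2)
  then have "(p = i \<and> q = j) \<or> (p = j \<and> q = i)" using l(1) by (auto simp: add_eq_conv_ex)
  then show ?thesis using l(3) pq Schwarz_partial_deriv[OF assms] by auto
qed

lemma multi_deriv_cong:
  assumes "open U" "\<And>y. y \<in> U \<Longrightarrow> \<phi> y = \<psi> y" "x \<in> U"
  shows "multi_deriv \<gamma> \<phi> x = multi_deriv \<gamma> \<psi> x"
  unfolding multi_deriv_def by (rule iter_partial_cong[OF assms])

lemma multi_deriv_lincomb:
  fixes \<phi> \<psi> :: "real^'n::finite \<Rightarrow> 'b::real_normed_vector"
  assumes U: "open U" and C: "Ck_on k U \<phi>" "Ck_on k U \<psi>" and \<gamma>: "size \<gamma> \<le> k" and x: "x \<in> U"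
  shows "multi_deriv \<gamma> (\<lambda>x. r *\<^sub>R \<phi> x + s *\<^sub>R \<psi> x) x = r *\<^sub>R multi_deriv \<gamma> \<phi> x + s *\<^sub>R multi_deriv \<gamma> \<psi> x"
proof -
  obtain l where l: "length l = size \<gamma>" "\<And>\<phi>::real^'n::finite \<Rightarrow> 'b::real_normed_vector. multi_deriv \<gamma> \<phi> = iter_partial l \<phi>"
    using multi_deriv_eq by metis
  show ?thesis
    unfolding l using iter_partial_lincomb[OF U C _ x, of l] l \<gamma> by simp
qed

lemma deriv_cl_empty [simp]: "deriv_cl U {#} \<phi> x = \<phi> x"
  by (simp add: deriv_cl_def)

lemma deriv_cl_inside: "x \<in> U \<Longrightarrow> deriv_cl U \<gamma> \<phi> x = multi_deriv \<gamma> \<phi> x"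
proof (cases "\<gamma> = {#}")
  case True
  obtain l where "mset l = \<gamma>" "multi_deriv \<gamma> \<phi> = iter_partial l \<phi>" using multi_deriv_eq by metis
  then show ?thesis using True by simp
qed (simp add: deriv_cl_def)

lemma deriv_cl_cong:
  assumes U: "open U" and eq: "\<And>y. y \<in> closure U \<Longrightarrow> \<phi> y = \<psi> y" and x: "x \<in> closure U"
  shows "deriv_cl U \<gamma> \<phi> x = deriv_cl U \<gamma> \<psi> x"
proof -
  have m: "multi_deriv \<gamma> \<phi> y = multi_deriv \<gamma> \<psi> y" if "y \<in> U" for y
    using multi_deriv_cong[OF U _ that, of \<phi> \<psi>] eq closure_subset by blast
  have "Lim (at x within U) (multi_deriv \<gamma> \<phi>) = Lim (at x within U) (multi_deriv \<gamma> \<psi>)"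
    unfolding Topological_Spaces.Lim_def
    by (intro arg_cong[where f = The] ext tendsto_cong) (auto simp: eventually_at_filter m)
  then show ?thesis using m eq[OF x] by (auto simp: deriv_cl_def)
qed

text \<open>For elements of a Hoelder space the limits that define \<^const>\<open>deriv_cl\<close> on the boundary exist.
  Linearity of \<^const>\<open>deriv_cl\<close> follows, which fails for arbitrary functions.\<close>

lemma multi_deriv_tendsto:
  assumes \<phi>: "\<phi> \<in> holder_space U k \<theta>" and \<gamma>: "size \<gamma> \<le> k" and x: "x \<in> closure U"
  shows "(multi_deriv \<gamma> \<phi> \<longlongrightarrow> deriv_cl U \<gamma> \<phi> x) (at x within U)"
proof -
  have "continuous_on (closure U) (deriv_cl U \<gamma> \<phi>)"
    using \<phi> \<gamma> by (simp add: holder_space_def)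
  then have "(deriv_cl U \<gamma> \<phi> \<longlongrightarrow> deriv_cl U \<gamma> \<phi> x) (at x within closure U)"
    using x by (simp add: continuous_on_def)
  then have "(deriv_cl U \<gamma> \<phi> \<longlongrightarrow> deriv_cl U \<gamma> \<phi> x) (at x within U)"
    by (rule tendsto_within_subset) (rule closure_subset)
  then show ?thesis
    by (rule Lim_transform_eventually) (auto simp: eventually_at_filter deriv_cl_inside)
qed

lemma deriv_cl_lincomb:
  fixes \<phi> \<psi> :: "real^'n::finite \<Rightarrow> 'b::real_normed_vector"
  assumes U: "open U" and \<phi>: "\<phi> \<in> holder_space U k \<theta>" and \<psi>: "\<psi> \<in> holder_space U k \<theta>"
    and \<gamma>: "size \<gamma> \<le> k" and x: "x \<in> closure U"
  shows "deriv_cl U \<gamma> (\<lambda>x. r *\<^sub>R \<phi> x + s *\<^sub>R \<psi> x) x = r *\<^sub>R deriv_cl U \<gamma> \<phi> x + s *\<^sub>R deriv_cl U \<gamma> \<psi> x"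
proof -
  have C: "Ck_on k U \<phi>" "Ck_on k U \<psi>" using \<phi> \<psi> by (auto simp: holder_space_def)
  note m = multi_deriv_lincomb[OF U C \<gamma>]
  consider "\<gamma> = {#}" | "x \<in> U" | "\<gamma> \<noteq> {#}" "x \<notin> U" by auto
  then show ?thesis
  proof cases
    case 1 then show ?thesis by simp
  next
    case 2 then show ?thesis by (simp add: deriv_cl_inside m)
  next
    case 3
    have "((\<lambda>y. r *\<^sub>R multi_deriv \<gamma> \<phi> y + s *\<^sub>R multi_deriv \<gamma> \<psi> y) \<longlongrightarrow>
       r *\<^sub>R deriv_cl U \<gamma> \<phi> x + s *\<^sub>R deriv_cl U \<gamma> \<psi> x) (at x within U)"
      by (intro tendsto_intros multi_deriv_tendsto[OF \<phi> \<gamma> x] multi_deriv_tendsto[OF \<psi> \<gamma> x])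
    then have "(multi_deriv \<gamma> (\<lambda>x. r *\<^sub>R \<phi> x + s *\<^sub>R \<psi> x) \<longlongrightarrow>
       r *\<^sub>R deriv_cl U \<gamma> \<phi> x + s *\<^sub>R deriv_cl U \<gamma> \<psi> x) (at x within U)"
      by (rule Lim_transform_eventually) (auto simp: eventually_at_filter m)
    moreover have "\<not> trivial_limit (at x within U)"
      using 3 x by (metis closure_def Un_iff islimpt_def mem_Collect_eq trivial_limit_within)
    ultimately show ?thesis using 3 by (simp add: deriv_cl_def tendsto_Lim)
  qed
qed

lemma gradient_component: "gradient F x $ k = partial_deriv k F x"
  by (simp add: gradient_def multi_deriv_single)

lemma hessian_component:
  assumes "Ck_on 2 UNIV F"
  shows "hessian F x $ k $ l = partial_deriv l (partial_deriv k F) x"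
  unfolding hessian_def
  by (simp add: multi_deriv_pair[OF open_UNIV assms UNIV_I] Schwarz_partial_deriv[OF open_UNIV assms UNIV_I, of k l])

section \<open>Hoelder bounds and Hoelder spaces\<close>

text \<open>One constant that controls both the supremum and the Hoelder quotients passes through sums,
  products and compositions more easily than the norm does, and membership in the space need not be
  proved separately at each step: a bound of this kind implies it. On \<open>C\<^sup>0\<^sup>,\<^sup>\<beta>\<close> the optimal constant
  and the norm are equivalent.\<close>

definition holder_bound :: "real \<Rightarrow> 'a::metric_space set \<Rightarrow> real \<Rightarrow> ('a \<Rightarrow> 'b::real_normed_vector) \<Rightarrow> bool"
  where "holder_bound \<beta> S M f \<longleftrightarrow>
    (\<forall>x\<in>S. norm (f x) \<le> M) \<and> (\<forall>x\<in>S. \<forall>y\<in>S. norm (f x - f y) \<le> M * dist x y powr \<beta>)"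

lemma holder_boundI:
  assumes "\<And>x. x \<in> S \<Longrightarrow> norm (f x) \<le> M"
    "\<And>x y. x \<in> S \<Longrightarrow> y \<in> S \<Longrightarrow> norm (f x - f y) \<le> M * dist x y powr \<beta>"
  shows "holder_bound \<beta> S M f"
  using assms by (auto simp: holder_bound_def)

lemma holder_boundD:
  assumes "holder_bound \<beta> S M f" "x \<in> S"
  shows "norm (f x) \<le> M" "y \<in> S \<Longrightarrow> norm (f x - f y) \<le> M * dist x y powr \<beta>"
  using assms by (auto simp: holder_bound_def)

lemma holder_bound_nonneg: "holder_bound \<beta> S M f \<Longrightarrow> S \<noteq> {} \<Longrightarrow> 0 \<le> M"
  unfolding holder_bound_def by (meson ex_in_conv norm_ge_zero order_trans)

lemma holder_bound_mono:
  assumes "holder_bound \<beta> S M f" "M \<le> N" shows "holder_bound \<beta> S N f"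
proof (rule holder_boundI)
  show "norm (f x) \<le> N" if "x \<in> S" for x using holder_boundD(1)[OF assms(1) that] assms(2) by simp
  show "norm (f x - f y) \<le> N * dist x y powr \<beta>" if "x \<in> S" "y \<in> S" for x y
    using holder_boundD(2)[OF assms(1) that] mult_right_mono[OF assms(2), of "dist x y powr \<beta>"] by simp
qed

lemma holder_bound_cong:
  assumes "holder_bound \<beta> S M f" "\<And>x. x \<in> S \<Longrightarrow> f x = g x" shows "holder_bound \<beta> S M g"
  using assms by (simp add: holder_bound_def)

lemma holder_bound_add:
  assumes "holder_bound \<beta> S M f" "holder_bound \<beta> S N g"
  shows "holder_bound \<beta> S (M + N) (\<lambda>x. f x + g x)"
proof (rule holder_boundI)
  show "norm (f x + g x) \<le> M + N" if "x \<in> S" for x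
    using holder_boundD(1)[OF assms(1) that] holder_boundD(1)[OF assms(2) that] norm_triangle_mono by blast
  show "norm (f x + g x - (f y + g y)) \<le> (M + N) * dist x y powr \<beta>" if "x \<in> S" "y \<in> S" for x y
    using norm_triangle_mono[OF holder_boundD(2)[OF assms(1) that] holder_boundD(2)[OF assms(2) that]]
    by (simp add: algebra_simps)
qed

lemma holder_bound_scaleR:
  assumes "holder_bound \<beta> S M f"
  shows "holder_bound \<beta> S (\<bar>r\<bar> * M) (\<lambda>x. r *\<^sub>R f x)"
proof (rule holder_boundI)
  show "norm (r *\<^sub>R f x) \<le> \<bar>r\<bar> * M" if "x \<in> S" for x
    using holder_boundD(1)[OF assms(1) that] by (simp add: mult_left_mono)
  show "norm (r *\<^sub>R f x - r *\<^sub>R f y) \<le> (\<bar>r\<bar> * M) * dist x y powr \<beta>" if "x \<in> S" "y \<in> S" for x y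
    using mult_left_mono[OF holder_boundD(2)[OF assms(1) that], of "\<bar>r\<bar>"]
    by (simp add: mult.assoc flip: scaleR_diff_right)
qed

lemma holder_bound_minus:
  assumes "holder_bound \<beta> S M f" shows "holder_bound \<beta> S M (\<lambda>x. - f x)"
  using holder_bound_scaleR[OF assms, of "-1"] by simp

lemma holder_bound_diff:
  assumes "holder_bound \<beta> S M f" "holder_bound \<beta> S N g"
  shows "holder_bound \<beta> S (M + N) (\<lambda>x. f x - g x)"
  using holder_bound_add[OF assms(1) holder_bound_minus[OF assms(2)]] by simp

lemma holder_bound_sum:
  assumes "\<And>i. i \<in> I \<Longrightarrow> holder_bound \<beta> S (M i) (f i)"
  shows "holder_bound \<beta> S (\<Sum>i\<in>I. M i) (\<lambda>x. \<Sum>i\<in>I. f i x)"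
  using assms
proof (induction I rule: infinite_finite_induct)
  case (insert i I)
  then show ?case using holder_bound_add[of \<beta> S "M i" "f i" "sum M I" "\<lambda>x. \<Sum>i\<in>I. f i x"] by simp
qed (auto simp: holder_bound_def)

lemma holder_bound_mult:
  fixes f g :: "'a::metric_space \<Rightarrow> real"
  assumes f: "holder_bound \<beta> S M f" and g: "holder_bound \<beta> S N g"
  shows "holder_bound \<beta> S (2 * (M * N)) (\<lambda>x. f x * g x)"
proof (cases "S = {}")
  case False
  then have MN: "0 \<le> M" "0 \<le> N" using f g holder_bound_nonneg by blast+
  show ?thesis
  proof (rule holder_boundI)
    show "norm (f x * g x) \<le> 2 * (M * N)" if "x \<in> S" for x
    proof -
      have "norm (f x) * norm (g x) \<le> M * N"
        using holder_boundD(1)[OF f that] holder_boundD(1)[OF g that] MN by (intro mult_mono) auto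
      moreover have "0 \<le> M * N" using MN by simp
      ultimately show ?thesis unfolding norm_mult by linarith
    qed
    show "norm (f x * g x - f y * g y) \<le> 2 * (M * N) * dist x y powr \<beta>" if "x \<in> S" "y \<in> S" for x y
    proof -
      have "f x * g x - f y * g y = f x * (g x - g y) + (f x - f y) * g y" by (simp add: algebra_simps)
      moreover have "norm (f x * (g x - g y)) \<le> M * (N * dist x y powr \<beta>)"
        unfolding norm_mult using holder_boundD[OF f that(1)] holder_boundD(2)[OF g that] MN
        by (intro mult_mono) auto
      moreover have "norm ((f x - f y) * g y) \<le> (M * dist x y powr \<beta>) * N"
        unfolding norm_mult using holder_boundD(2)[OF f that] holder_boundD(1)[OF g that(2)] MN
        by (intro mult_mono) auto
      ultimately show ?thesis
        using norm_triangle_mono[of "f x * (g x - g y)" "M * (N * dist x y powr \<beta>)" "(f x - f y) * g y"]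
        by (simp add: algebra_simps)
    qed
  qed
qed (simp add: holder_bound_def)

lemma holder_bound_nth:
  fixes f :: "'a::metric_space \<Rightarrow> 'b::real_normed_vector^'k::finite"
  assumes "holder_bound \<beta> S M f" shows "holder_bound \<beta> S M (\<lambda>x. f x $ k)"
proof (rule holder_boundI)
  show "norm (f x $ k) \<le> M" if "x \<in> S" for x
    using holder_boundD(1)[OF assms(1) that] Finite_Cartesian_Product.norm_nth_le order_trans by blast
  show "norm (f x $ k - f y $ k) \<le> M * dist x y powr \<beta>" if "x \<in> S" "y \<in> S" for x y
    using holder_boundD(2)[OF assms(1) that] Finite_Cartesian_Product.norm_nth_le[of "f x - f y" k] by simp
qed

lemma holder_bound_vec:
  fixes f :: "'a::metric_space \<Rightarrow> real^'k::finite"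
  assumes "\<And>k. holder_bound \<beta> S (M k) (\<lambda>x. f x $ k)"
  shows "holder_bound \<beta> S (\<Sum>k\<in>UNIV. M k) f"
proof (rule holder_boundI)
  show "norm (f x) \<le> (\<Sum>k\<in>UNIV. M k)" if "x \<in> S" for x
    using holder_boundD(1)[OF assms that] by (intro order_trans[OF norm_le_l1_cart] sum_mono) auto
  show "norm (f x - f y) \<le> (\<Sum>k\<in>UNIV. M k) * dist x y powr \<beta>" if "x \<in> S" "y \<in> S" for x y
    unfolding sum_distrib_right
    using holder_boundD(2)[OF assms that] by (intro order_trans[OF norm_le_l1_cart] sum_mono) auto
qed

lemma holder_bound_continuous:
  assumes f: "holder_bound \<beta> S M f" and \<beta>: "0 < \<beta>"
  shows "continuous_on S f"
  unfolding continuous_on_iff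
proof (intro ballI allI impI)
  fix x and e :: real assume x: "x \<in> S" and e: "0 < e"
  have M: "0 \<le> M" using holder_bound_nonneg[OF f] x by blast
  define d where "d = (e / (M + 1)) powr (1 / \<beta>)"
  have "d > 0" using e M by (simp add: d_def)
  moreover have "dist (f y) (f x) < e" if "y \<in> S" "dist y x < d" for y
  proof -
    have "dist y x powr \<beta> < d powr \<beta>" using that \<beta> by (intro powr_less_mono2) auto
    also have "\<dots> = e / (M + 1)" using \<beta> e M by (simp add: d_def powr_powr)
    finally have "(M + 1) * dist y x powr \<beta> < e" using M by (simp add: field_simps)
    moreover have "dist (f y) (f x) \<le> M * dist y x powr \<beta>"
      using holder_boundD(2)[OF f that(1) x] by (simp add: dist_norm)
    moreover have "M * dist y x powr \<beta> \<le> (M + 1) * dist y x powr \<beta>" by (intro mult_right_mono) auto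
    ultimately show ?thesis by linarith
  qed
  ultimately show "\<exists>d>0. \<forall>y\<in>S. dist y x < d \<longrightarrow> dist (f y) (f x) < e" by blast
qed

lemma bdd_above_holder_quotients_iff:
  "bdd_above (holder_quotients \<beta> S f) \<longleftrightarrow> (\<exists>C. \<forall>x\<in>S. \<forall>y\<in>S. norm (f x - f y) \<le> C * dist x y powr \<beta>)"
proof
  assume "bdd_above (holder_quotients \<beta> S f)"
  then obtain C where C: "\<And>q. q \<in> holder_quotients \<beta> S f \<Longrightarrow> q \<le> C" by (auto simp: bdd_above_def)
  have "norm (f x - f y) \<le> C * dist x y powr \<beta>" if "x \<in> S" "y \<in> S" for x y
  proof (cases "x = y")
    case False
    then have "norm (f x - f y) / dist x y powr \<beta> \<le> C"
      using that by (intro C) (auto simp: holder_quotients_def)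
    then show ?thesis using False by (simp add: divide_le_eq)
  qed auto
  then show "\<exists>C. \<forall>x\<in>S. \<forall>y\<in>S. norm (f x - f y) \<le> C * dist x y powr \<beta>" by blast
next
  assume "\<exists>C. \<forall>x\<in>S. \<forall>y\<in>S. norm (f x - f y) \<le> C * dist x y powr \<beta>"
  then obtain C where "\<And>x y. x\<in>S \<Longrightarrow> y\<in>S \<Longrightarrow> norm (f x - f y) \<le> C * dist x y powr \<beta>" by blast
  then show "bdd_above (holder_quotients \<beta> S f)"
    by (intro bdd_aboveI[of _ C]) (auto simp: holder_quotients_def divide_le_eq)
qed

lemma holder_seminorm_bound:
  assumes "bdd_above (holder_quotients \<beta> S f)" "x \<in> S" "y \<in> S"
  shows "norm (f x - f y) \<le> holder_seminorm \<beta> S f * dist x y powr \<beta>"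
proof (cases "x = y")
  case False
  then have "norm (f x - f y) / dist x y powr \<beta> \<le> holder_seminorm \<beta> S f"
    unfolding holder_seminorm_def
    using assms by (intro cSup_upper) (auto simp: holder_quotients_def)
  then show ?thesis using False by (simp add: divide_le_eq)
qed auto

lemma sup_seminorm_bound:
  assumes "bounded (f ` S)" "x \<in> S" shows "norm (f x) \<le> sup_seminorm S f"
  unfolding sup_seminorm_def
  using assms bounded_imp_bdd_above[of "(\<lambda>x. norm (f x)) ` S"]
  by (intro cSUP_upper) (auto simp: bounded_iff)

lemma sup_seminorm_nonneg:
  assumes "bounded (f ` S)" "S \<noteq> {}" shows "0 \<le> sup_seminorm S f"
  using sup_seminorm_bound[OF assms(1)] assms(2) by (meson ex_in_conv norm_ge_zero order_trans)

lemma open_two_points: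
  fixes U :: "(real^'n::finite) set"
  assumes "open U" "U \<noteq> {}"
  obtains x y where "x \<in> U" "y \<in> U" "x \<noteq> y"
proof -
  obtain x where x: "x \<in> U" using assms by blast
  moreover have "U \<noteq> {x}" using assms not_open_singleton by blast
  ultimately show ?thesis using that by blast
qed

lemma holder_seminorm_nonneg:
  fixes U :: "(real^'n::finite) set"
  assumes "bdd_above (holder_quotients \<beta> (closure U) f)" "open U" "U \<noteq> {}"
  shows "0 \<le> holder_seminorm \<beta> (closure U) f"
proof -
  obtain x y where xy: "x \<in> U" "y \<in> U" "x \<noteq> y" using open_two_points assms by metis
  then have "0 \<le> holder_seminorm \<beta> (closure U) f * dist x y powr \<beta>"
    using holder_seminorm_bound[OF assms(1), of x y] closure_subset[of U]
    by (metis norm_ge_zero order_trans subsetD)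
  then show ?thesis using xy by (simp add: zero_le_mult_iff)
qed

lemma finite_multisets_of_size: "finite {\<gamma>::'n::finite multiset. size \<gamma> = m}"
proof -
  have "{\<gamma>::'n multiset. size \<gamma> = m} \<subseteq> mset ` {l. set l \<subseteq> UNIV \<and> length l = m}"
  proof
    fix \<gamma> :: "'n multiset" assume "\<gamma> \<in> {\<gamma>. size \<gamma> = m}"
    moreover obtain l where "mset l = \<gamma>" using ex_mset by blast
    ultimately show "\<gamma> \<in> mset ` {l. set l \<subseteq> UNIV \<and> length l = m}"
      by (intro image_eqI[of _ _ l]) auto
  qed
  then show ?thesis
    by (rule finite_subset) (intro finite_imageI finite_lists_length_eq finite)
qed

context
  fixes U :: "(real^'n::finite) set" and k :: nat and \<theta> :: real
  assumes U: "open U" "U \<noteq> {}"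
begin

lemma closure_nonempty: "closure U \<noteq> {}"
  using U by simp

lemma holder_space_sup_term:
  assumes "\<phi> \<in> holder_space U k \<theta>" "size \<gamma> \<le> k"
  shows "0 \<le> sup_seminorm (closure U) (deriv_cl U \<gamma> \<phi>)"
  using assms closure_nonempty by (intro sup_seminorm_nonneg) (auto simp: holder_space_def)

lemma holder_space_holder_term:
  assumes "\<phi> \<in> holder_space U k \<theta>" "size \<gamma> = k"
  shows "0 \<le> holder_seminorm \<theta> (closure U) (deriv_cl U \<gamma> \<phi>)"
  using assms U by (intro holder_seminorm_nonneg) (auto simp: holder_space_def)

lemma holder_norm_nonneg:
  assumes "\<phi> \<in> holder_space U k \<theta>" shows "0 \<le> holder_norm U k \<theta> \<phi>"
  unfolding holder_norm_def
  using holder_space_sup_term[OF assms] holder_space_holder_term[OF assms]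
  by (intro add_nonneg_nonneg sum_nonneg) auto

lemma holder_norm_bounds_sup:
  assumes \<phi>: "\<phi> \<in> holder_space U k \<theta>" and \<gamma>: "size \<gamma> \<le> k" and x: "x \<in> closure U"
  shows "norm (deriv_cl U \<gamma> \<phi> x) \<le> holder_norm U k \<theta> \<phi>"
proof -
  have "norm (deriv_cl U \<gamma> \<phi> x) \<le> sup_seminorm (closure U) (deriv_cl U \<gamma> \<phi>)"
    using \<phi> \<gamma> x by (intro sup_seminorm_bound) (auto simp: holder_space_def)
  also have "\<dots> \<le> (\<Sum>\<gamma>' | size \<gamma>' = size \<gamma>. sup_seminorm (closure U) (deriv_cl U \<gamma>' \<phi>))"
    by (rule member_le_sum) (use holder_space_sup_term[OF \<phi>] \<gamma> finite_multisets_of_size in auto)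
  also have "\<dots> \<le> (\<Sum>m\<le>k. \<Sum>\<gamma>' | size \<gamma>' = m. sup_seminorm (closure U) (deriv_cl U \<gamma>' \<phi>))"
    by (rule member_le_sum[of "size \<gamma>" _ "\<lambda>m. \<Sum>\<gamma>' | size \<gamma>' = m. sup_seminorm (closure U) (deriv_cl U \<gamma>' \<phi>)"])
       (use holder_space_sup_term[OF \<phi>] \<gamma> in \<open>auto intro!: sum_nonneg\<close>)
  also have "\<dots> \<le> holder_norm U k \<theta> \<phi>"
    unfolding holder_norm_def using holder_space_holder_term[OF \<phi>] by (auto intro!: sum_nonneg)
  finally show ?thesis .
qed

lemma holder_norm_bounds_holder:
  assumes \<phi>: "\<phi> \<in> holder_space U k \<theta>" and \<gamma>: "size \<gamma> = k" and xy: "x \<in> closure U" "y \<in> closure U"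
  shows "norm (deriv_cl U \<gamma> \<phi> x - deriv_cl U \<gamma> \<phi> y) \<le> holder_norm U k \<theta> \<phi> * dist x y powr \<theta>"
proof -
  have "norm (deriv_cl U \<gamma> \<phi> x - deriv_cl U \<gamma> \<phi> y)
      \<le> holder_seminorm \<theta> (closure U) (deriv_cl U \<gamma> \<phi>) * dist x y powr \<theta>"
    using \<phi> \<gamma> xy by (intro holder_seminorm_bound) (auto simp: holder_space_def)
  also have "\<dots> \<le> holder_norm U k \<theta> \<phi> * dist x y powr \<theta>"
  proof (rule mult_right_mono)
    have "holder_seminorm \<theta> (closure U) (deriv_cl U \<gamma> \<phi>)
        \<le> (\<Sum>\<gamma>' | size \<gamma>' = k. holder_seminorm \<theta> (closure U) (deriv_cl U \<gamma>' \<phi>))"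
      by (rule member_le_sum) (use holder_space_holder_term[OF \<phi>] \<gamma> finite_multisets_of_size in auto)
    also have "\<dots> \<le> holder_norm U k \<theta> \<phi>"
      unfolding holder_norm_def using holder_space_sup_term[OF \<phi>] by (auto intro!: sum_nonneg)
    finally show "holder_seminorm \<theta> (closure U) (deriv_cl U \<gamma> \<phi>) \<le> holder_norm U k \<theta> \<phi>" .
  qed auto
  finally show ?thesis .
qed

lemma holder_bound_top_deriv:
  assumes "\<phi> \<in> holder_space U k \<theta>" "size \<gamma> = k"
  shows "holder_bound \<theta> (closure U) (holder_norm U k \<theta> \<phi>) (deriv_cl U \<gamma> \<phi>)"
  using holder_norm_bounds_sup[OF assms(1), of \<gamma>] holder_norm_bounds_holder[OF assms] assms(2)
  by (intro holder_boundI) auto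

lemma holder_space_lincomb:
  fixes \<phi> \<psi> :: "real^'n \<Rightarrow> 'b::real_normed_vector"
  assumes \<phi>: "\<phi> \<in> holder_space U k \<theta>" and \<psi>: "\<psi> \<in> holder_space U k \<theta>"
  shows "(\<lambda>x. r *\<^sub>R \<phi> x + s *\<^sub>R \<psi> x) \<in> holder_space U k \<theta>"
  unfolding holder_space_def mem_Collect_eq
proof (intro conjI allI impI)
  note lc = deriv_cl_lincomb[OF U(1) \<phi> \<psi>]
  show "Ck_on k U (\<lambda>x. r *\<^sub>R \<phi> x + s *\<^sub>R \<psi> x)"
    using \<phi> \<psi> by (intro Ck_on_lincomb U) (auto simp: holder_space_def)
  fix \<gamma> :: "'n multiset"
  { assume \<gamma>: "size \<gamma> \<le> k"
    have "continuous_on (closure U) (\<lambda>x. r *\<^sub>R deriv_cl U \<gamma> \<phi> x + s *\<^sub>R deriv_cl U \<gamma> \<psi> x)"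
      using \<phi> \<psi> \<gamma> by (intro continuous_intros) (auto simp: holder_space_def)
    then show "continuous_on (closure U) (deriv_cl U \<gamma> (\<lambda>x. r *\<^sub>R \<phi> x + s *\<^sub>R \<psi> x))"
      by (rule continuous_on_eq) (use lc[OF \<gamma>] in auto)
    have "norm (deriv_cl U \<gamma> (\<lambda>x. r *\<^sub>R \<phi> x + s *\<^sub>R \<psi> x) x)
       \<le> \<bar>r\<bar> * holder_norm U k \<theta> \<phi> + \<bar>s\<bar> * holder_norm U k \<theta> \<psi>" if x: "x \<in> closure U" for x
      unfolding lc[OF \<gamma> x]
      using holder_norm_bounds_sup[OF \<phi> \<gamma> x] holder_norm_bounds_sup[OF \<psi> \<gamma> x]
      by (intro norm_triangle_mono) (auto intro: mult_left_mono)
    then show "bounded (deriv_cl U \<gamma> (\<lambda>x. r *\<^sub>R \<phi> x + s *\<^sub>R \<psi> x) ` closure U)"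
      by (auto simp: bounded_iff) }
  { assume \<gamma>: "size \<gamma> = k"
    have "holder_bound \<theta> (closure U) (\<bar>r\<bar> * holder_norm U k \<theta> \<phi> + \<bar>s\<bar> * holder_norm U k \<theta> \<psi>)
        (deriv_cl U \<gamma> (\<lambda>x. r *\<^sub>R \<phi> x + s *\<^sub>R \<psi> x))"
      using holder_bound_add[OF holder_bound_scaleR[OF holder_bound_top_deriv[OF \<phi> \<gamma>], of r]
        holder_bound_scaleR[OF holder_bound_top_deriv[OF \<psi> \<gamma>], of s]]
      by (rule holder_bound_cong) (use lc \<gamma> in simp)
    then show "bdd_above (holder_quotients \<theta> (closure U) (deriv_cl U \<gamma> (\<lambda>x. r *\<^sub>R \<phi> x + s *\<^sub>R \<psi> x)))"
      unfolding bdd_above_holder_quotients_iff holder_bound_def by blast }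
qed

lemma holder_norm_scaleR_le:
  fixes \<phi> :: "real^'n \<Rightarrow> 'b::real_normed_vector"
  assumes \<phi>: "\<phi> \<in> holder_space U k \<theta>"
  shows "holder_norm U k \<theta> (\<lambda>x. r *\<^sub>R \<phi> x) \<le> \<bar>r\<bar> * holder_norm U k \<theta> \<phi>"
proof -
  have lc: "deriv_cl U \<gamma> (\<lambda>x. r *\<^sub>R \<phi> x) x = r *\<^sub>R deriv_cl U \<gamma> \<phi> x" if "size \<gamma> \<le> k" "x \<in> closure U" for \<gamma> x
    using deriv_cl_lincomb[OF U(1) \<phi> \<phi> that, of r 0] by simp
  have 1: "sup_seminorm (closure U) (deriv_cl U \<gamma> (\<lambda>x. r *\<^sub>R \<phi> x))
      \<le> \<bar>r\<bar> * sup_seminorm (closure U) (deriv_cl U \<gamma> \<phi>)" if \<gamma>: "size \<gamma> \<le> k" for \<gamma>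
    unfolding sup_seminorm_def[of _ "deriv_cl U \<gamma> (\<lambda>x. r *\<^sub>R \<phi> x)"]
  proof (rule cSUP_least[OF closure_nonempty])
    fix x assume x: "x \<in> closure U"
    have "norm (deriv_cl U \<gamma> \<phi> x) \<le> sup_seminorm (closure U) (deriv_cl U \<gamma> \<phi>)"
      using \<phi> \<gamma> x by (intro sup_seminorm_bound) (auto simp: holder_space_def)
    then show "norm (deriv_cl U \<gamma> (\<lambda>x. r *\<^sub>R \<phi> x) x) \<le> \<bar>r\<bar> * sup_seminorm (closure U) (deriv_cl U \<gamma> \<phi>)"
      by (simp add: lc[OF \<gamma> x] mult_left_mono)
  qed
  have 2: "holder_seminorm \<theta> (closure U) (deriv_cl U \<gamma> (\<lambda>x. r *\<^sub>R \<phi> x))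
      \<le> \<bar>r\<bar> * holder_seminorm \<theta> (closure U) (deriv_cl U \<gamma> \<phi>)" if \<gamma>: "size \<gamma> = k" for \<gamma>
    unfolding holder_seminorm_def[of _ _ "deriv_cl U \<gamma> (\<lambda>x. r *\<^sub>R \<phi> x)"]
  proof (rule cSup_least)
    obtain x y where "x \<in> U" "y \<in> U" "x \<noteq> y" using open_two_points U by metis
    then show "holder_quotients \<theta> (closure U) (deriv_cl U \<gamma> (\<lambda>x. r *\<^sub>R \<phi> x)) \<noteq> {}"
      using closure_subset[of U] by (auto simp: holder_quotients_def)
    fix q assume "q \<in> holder_quotients \<theta> (closure U) (deriv_cl U \<gamma> (\<lambda>x. r *\<^sub>R \<phi> x))"
    then obtain x y where xy: "x \<in> closure U" "y \<in> closure U" "x \<noteq> y"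
      and q: "q = norm (deriv_cl U \<gamma> (\<lambda>x. r *\<^sub>R \<phi> x) x - deriv_cl U \<gamma> (\<lambda>x. r *\<^sub>R \<phi> x) y) / dist x y powr \<theta>"
      by (auto simp: holder_quotients_def)
    have "q = \<bar>r\<bar> * (norm (deriv_cl U \<gamma> \<phi> x - deriv_cl U \<gamma> \<phi> y) / dist x y powr \<theta>)"
      unfolding q using \<gamma> xy by (simp add: lc flip: scaleR_diff_right)
    moreover have "norm (deriv_cl U \<gamma> \<phi> x - deriv_cl U \<gamma> \<phi> y)
      \<le> holder_seminorm \<theta> (closure U) (deriv_cl U \<gamma> \<phi>) * dist x y powr \<theta>"
      using \<phi> \<gamma> xy by (intro holder_seminorm_bound) (auto simp: holder_space_def)
    ultimately show "q \<le> \<bar>r\<bar> * holder_seminorm \<theta> (closure U) (deriv_cl U \<gamma> \<phi>)"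
      using xy mult_left_mono[of _ "holder_seminorm \<theta> (closure U) (deriv_cl U \<gamma> \<phi>) * dist x y powr \<theta>" "\<bar>r\<bar>"]
      by (simp add: divide_le_eq mult.assoc)
  qed
  show ?thesis
    unfolding holder_norm_def distrib_left sum_distrib_left
    using 1 2 by (intro add_mono sum_mono) auto
qed

end

lemma holder_space_0I:
  fixes U :: "(real^'n::finite) set"
  assumes "holder_bound \<beta> (closure U) M \<phi>" and \<beta>: "0 < \<beta>"
  shows "\<phi> \<in> holder_space U 0 \<beta>"
proof -
  have eq: "deriv_cl U {#} \<phi> = \<phi>" by (simp add: fun_eq_iff)
  have c: "continuous_on (closure U) \<phi>" by (rule holder_bound_continuous[OF assms])
  have "bounded (\<phi> ` closure U)" using assms(1) by (auto simp: holder_bound_def bounded_iff)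
  moreover have "bdd_above (holder_quotients \<beta> (closure U) \<phi>)"
    unfolding bdd_above_holder_quotients_iff using assms(1) by (auto simp: holder_bound_def)
  ultimately show ?thesis
    using c continuous_on_subset[OF c closure_subset] by (simp add: holder_space_def eq Ck_on_0)
qed

lemma holder_norm_0_le:
  fixes U :: "(real^'n::finite) set"
  assumes U: "open U" "U \<noteq> {}" and \<phi>: "holder_bound \<beta> (closure U) M \<phi>"
  shows "holder_norm U 0 \<beta> \<phi> \<le> 2 * M"
proof -
  have eq: "deriv_cl U {#} \<phi> = \<phi>" by (simp add: fun_eq_iff)
  have "sup_seminorm (closure U) \<phi> \<le> M"
    unfolding sup_seminorm_def using U holder_boundD(1)[OF \<phi>] by (intro cSUP_least) auto
  moreover have "holder_seminorm \<beta> (closure U) \<phi> \<le> M"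
    unfolding holder_seminorm_def
  proof (rule cSup_least)
    obtain x y where "x \<in> U" "y \<in> U" "x \<noteq> y" using open_two_points U by metis
    then show "holder_quotients \<beta> (closure U) \<phi> \<noteq> {}"
      using closure_subset[of U] by (auto simp: holder_quotients_def)
  qed (use holder_boundD(2)[OF \<phi>] in \<open>auto simp: holder_quotients_def divide_le_eq\<close>)
  ultimately show ?thesis by (simp add: holder_norm_def eq)
qed

lemma holder_space_0_bound:
  fixes U :: "(real^'n::finite) set"
  assumes "open U" "U \<noteq> {}" "\<phi> \<in> holder_space U 0 \<beta>"
  shows "holder_bound \<beta> (closure U) (holder_norm U 0 \<beta> \<phi>) \<phi>"
  using holder_bound_top_deriv[OF assms, of "{#}"] by (simp add: holder_bound_def)

section \<open>Lower-order derivatives up to the boundary\<close>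

lemma holder_space_partial_bound:
  assumes "open U" "U \<noteq> {}" "\<phi> \<in> holder_space U (Suc k) \<theta>" "x \<in> U"
  shows "norm (partial_deriv i \<phi> x) \<le> holder_norm U (Suc k) \<theta> \<phi>"
  using holder_norm_bounds_sup[OF assms(1-3), of "{#i#}" x] closure_subset[of U] assms(4)
  by (auto simp: deriv_cl_inside multi_deriv_single)

text \<open>The straightening map sends a segment in the half-space back to a path between two given points
  of \<open>U\<close>, and the length of that path is at most a constant times their distance. A bounded
  gradient therefore gives a Lipschitz bound near the boundary. In a domain with a slit this would
  be false, so some regularity of the boundary has to enter.\<close>

lemma lipschitz_near_frontier:
  fixes U :: "(real^'n::finite) set"
  assumes U: "open U" and bd: "boundary_of_class (Suc k) \<theta> U" and x0: "x0 \<in> frontier U"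
  shows "\<exists>s>0. \<exists>C\<ge>0. \<forall>(\<phi>::real^'n \<Rightarrow> real) B. Ck_on (Suc 0) U \<phi> \<and> (\<forall>x\<in>U. \<forall>i. \<bar>partial_deriv i \<phi> x\<bar> \<le> B) \<longrightarrow>
     (\<forall>x\<in>U \<inter> ball x0 s. \<forall>y\<in>U \<inter> ball x0 s. \<bar>\<phi> x - \<phi> y\<bar> \<le> C * B * dist x y)"
proof -
  obtain r \<psi> \<psi>' i where r: "r > 0" and inv: "\<And>x. x \<in> ball x0 r \<Longrightarrow> \<psi>' (\<psi> x) = x"
    and P: "open (\<psi> ` ball x0 r)" and h\<psi>: "\<psi> \<in> holder_space (ball x0 r) (Suc k) \<theta>"
    and h\<psi>': "\<psi>' \<in> holder_space (\<psi> ` ball x0 r) (Suc k) \<theta>"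
    and in_half: "\<psi> ` (ball x0 r \<inter> U) \<subseteq> {y. y $ i > 0}"
    and on_plane: "\<psi> ` (ball x0 r \<inter> frontier U) \<subseteq> {y::real^'n. y $ i = 0}"
    using bd x0 unfolding boundary_of_class_def by metis
  let ?P = "\<psi> ` ball x0 r"
  let ?n = "real CARD('n)"
  define A where "A = holder_norm (ball x0 r) (Suc k) \<theta> \<psi>"
  define A' where "A' = holder_norm ?P (Suc k) \<theta> \<psi>'"
  have ne: "ball x0 r \<noteq> {}" "?P \<noteq> {}" using r by auto
  have A: "A \<ge> 0" "A' \<ge> 0" unfolding A_def A'_def
    using holder_norm_nonneg[OF open_ball ne(1) h\<psi>] holder_norm_nonneg[OF P ne(2) h\<psi>'] by auto
  have C1: "Ck_on (Suc 0) (ball x0 r) \<psi>" "Ck_on (Suc 0) ?P \<psi>'"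
    using h\<psi> h\<psi>' by (auto simp: holder_space_def intro: Ck_on_mono)
  have pA: "norm (partial_deriv j \<psi> x) \<le> A" if "x \<in> ball x0 r" for x j
    unfolding A_def by (rule holder_space_partial_bound[OF open_ball ne(1) h\<psi> that])
  have pA': "norm (partial_deriv j \<psi>' x) \<le> A'" if "x \<in> ?P" for x j
    unfolding A'_def by (rule holder_space_partial_bound[OF P ne(2) h\<psi>' that])
  have L: "norm (\<psi> x - \<psi> y) \<le> ?n * A * norm (x - y)" if "x \<in> ball x0 r" "y \<in> ball x0 r" for x y
    by (rule C1_lipschitz_on_convex[OF open_ball C1(1) subset_refl convex_ball pA that])
  have "\<psi> x0 \<in> ?P" using r by simp
  then obtain \<rho> where \<rho>: "\<rho> > 0" "ball (\<psi> x0) \<rho> \<subseteq> ?P" using P openE by blast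
  define s where "s = min r (\<rho> / (?n * A + 1))"
  have nA: "?n * A + 1 > 0" using A by (simp add: add_nonneg_pos)
  have s: "s > 0" using r \<rho> nA by (simp add: s_def)
  have near: "\<psi> x \<in> ball (\<psi> x0) \<rho>" if "x \<in> ball x0 s" for x
  proof -
    have "norm (\<psi> x0 - \<psi> x) \<le> ?n * A * norm (x0 - x)"
      using that r by (intro L) (auto simp: s_def)
    also have "\<dots> \<le> (?n * A + 1) * norm (x0 - x)" by (intro mult_right_mono) auto
    also have "\<dots> < (?n * A + 1) * (\<rho> / (?n * A + 1))"
      using that nA by (intro mult_strict_left_mono) (auto simp: s_def dist_norm)
    also have "\<dots> = \<rho>" using nA by simp
    finally show ?thesis by (simp add: dist_norm)
  qed
  show ?thesis
  proof (rule exI[of _ s], rule conjI[OF s], rule exI[of _ "?n * (?n * A') * (?n * A)"],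
      intro conjI allI impI ballI)
    show "0 \<le> ?n * (?n * A') * (?n * A)" using A by simp
    fix \<phi> :: "real^'n \<Rightarrow> real" and B x y
    assume \<phi>: "Ck_on (Suc 0) U \<phi> \<and> (\<forall>x\<in>U. \<forall>i. \<bar>partial_deriv i \<phi> x\<bar> \<le> B)"
      and x: "x \<in> U \<inter> ball x0 s" and y: "y \<in> U \<inter> ball x0 s"
    have xr: "x \<in> ball x0 r" "y \<in> ball x0 r" using x y by (auto simp: s_def)
    let ?S = "closed_segment (\<psi> x) (\<psi> y)"
    have "\<bar>partial_deriv i \<phi> x\<bar> \<le> B" using \<phi> x by blast
    then have B: "0 \<le> B" by linarith
    have S1: "?S \<subseteq> ball (\<psi> x0) \<rho>"
      by (rule closed_segment_subset) (use near x y in auto)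
    then have SP: "?S \<subseteq> ?P" using \<rho> by blast
    have S2: "?S \<subseteq> {y. y $ i > 0}"
    proof (rule closed_segment_subset)
      have "{y::real^'n. y $ i > 0} = {y. axis i 1 \<bullet> y > 0}" by (simp add: inner_axis' )
      then show "convex {y::real^'n. y $ i > 0}" using convex_halfspace_gt[of 0 "axis i (1::real)"] by simp
    qed (use subsetD[OF in_half imageI, of x] subsetD[OF in_half imageI, of y] xr x y in auto)
    have inv': "\<psi>' z \<in> ball x0 r" "\<psi> (\<psi>' z) = z" if "z \<in> ?S" for z
      using SP that inv by auto
    have "continuous_on ?S \<psi>'" using Ck_on_continuous[OF C1(2)] SP continuous_on_subset by blast
    then have conn: "connected (\<psi>' ` ?S)"
      using connected_continuous_image connected_segment by blast
    \<comment> \<open>The preimage of the segment cannot leave the domain, since it would have to cross the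
      frontier, which is mapped into the hyperplane.\<close>
    have SU: "\<psi>' ` ?S \<subseteq> U"
    proof (rule ccontr)
      assume "\<not> \<psi>' ` ?S \<subseteq> U"
      moreover have "\<psi>' (\<psi> x) \<in> \<psi>' ` ?S \<inter> U"
        using inv[OF xr(1)] x by (intro IntI imageI) auto
      ultimately have "\<psi>' ` ?S \<inter> frontier U \<noteq> {}"
        by (intro connected_Int_frontier[OF conn]) auto
      then obtain z where z: "z \<in> ?S" "\<psi>' z \<in> frontier U" by blast
      then have "\<psi> (\<psi>' z) $ i = 0" using on_plane inv'(1)[OF z(1)] by blast
      then show False using S2 z inv'(2)[OF z(1)] by auto
    qed
    have "norm ((\<phi> \<circ> \<psi>') (\<psi> x) - (\<phi> \<circ> \<psi>') (\<psi> y)) \<le> (?n * B) * (?n * A') * norm (\<psi> x - \<psi> y)"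
    proof (rule differentiable_bound[where S = ?S])
      fix z assume z: "z \<in> ?S"
      have zU: "\<psi>' z \<in> U" using SU z by blast
      have D1: "(\<psi>' has_derivative (\<lambda>h. \<Sum>j\<in>UNIV. h $ j *\<^sub>R partial_deriv j \<psi>' z)) (at z)"
        using C1_has_derivative[OF P C1(2)] SP z by blast
      have D2: "(\<phi> has_derivative (\<lambda>h. \<Sum>j\<in>UNIV. h $ j *\<^sub>R partial_deriv j \<phi> (\<psi>' z))) (at (\<psi>' z))"
        using C1_has_derivative[OF U _ zU] \<phi> by blast
      let ?D = "(\<lambda>h. \<Sum>j\<in>UNIV. h $ j *\<^sub>R partial_deriv j \<phi> (\<psi>' z)) \<circ> (\<lambda>h. \<Sum>j\<in>UNIV. h $ j *\<^sub>R partial_deriv j \<psi>' z)"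
      show "(\<phi> \<circ> \<psi>' has_derivative ?D) (at z within ?S)"
        by (rule has_derivative_at_withinI) (rule diff_chain_at[OF D1 D2])
      have "onorm ?D \<le> onorm (\<lambda>h. \<Sum>j\<in>UNIV. h $ j *\<^sub>R partial_deriv j \<phi> (\<psi>' z))
          * onorm (\<lambda>h. \<Sum>j\<in>UNIV. h $ j *\<^sub>R partial_deriv j \<psi>' z)"
        by (intro onorm_compose has_derivative_bounded_linear[OF D1] has_derivative_bounded_linear[OF D2])
      also have "\<dots> \<le> (?n * B) * (?n * A')"
        using \<phi> zU pA' SP z B
        by (intro mult_mono onorm_partials_le) (auto intro!: onorm_pos_le has_derivative_bounded_linear[OF D1])
      finally show "onorm ?D \<le> (?n * B) * (?n * A')" .
    qed auto
    also have "\<dots> \<le> (?n * B) * (?n * A') * (?n * A * norm (x - y))"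
      using L[OF xr] A B by (intro mult_left_mono) auto
    finally show "\<bar>\<phi> x - \<phi> y\<bar> \<le> ?n * (?n * A') * (?n * A) * B * dist x y"
      using inv xr by (simp add: dist_norm mult_ac)
  qed
qed

lemma lipschitz_near_interior:
  fixes U :: "(real^'n::finite) set"
  assumes U: "open U" and x0: "x0 \<in> U"
  shows "\<exists>s>0. \<exists>C\<ge>0. \<forall>(\<phi>::real^'n \<Rightarrow> real) B. Ck_on (Suc 0) U \<phi> \<and> (\<forall>x\<in>U. \<forall>i. \<bar>partial_deriv i \<phi> x\<bar> \<le> B) \<longrightarrow>
     (\<forall>x\<in>U \<inter> ball x0 s. \<forall>y\<in>U \<inter> ball x0 s. \<bar>\<phi> x - \<phi> y\<bar> \<le> C * B * dist x y)"
proof -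
  obtain s where s: "s > 0" "ball x0 s \<subseteq> U" using U x0 openE by blast
  have "\<bar>\<phi> x - \<phi> y\<bar> \<le> real CARD('n) * B * dist x y"
    if "Ck_on (Suc 0) U \<phi> \<and> (\<forall>x\<in>U. \<forall>i. \<bar>partial_deriv i \<phi> x\<bar> \<le> B)"
      "x \<in> U \<inter> ball x0 s" "y \<in> U \<inter> ball x0 s" for \<phi> :: "real^'n \<Rightarrow> real" and B x y
    using C1_lipschitz_on_convex[OF U, of \<phi> "ball x0 s" B x y] that s
    by (auto simp: dist_norm subset_iff)
  then show ?thesis using s(1) of_nat_0_le_iff[of "CARD('n)"] by blast
qed

text \<open>By compactness finitely many of the local Lipschitz bounds suffice. Points that are too far
  apart to lie in a common neighbourhood are treated with the supremum. The function \<open>f\<close> is the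
  continuous extension of \<open>\<phi>\<close> to the closure; for a first derivative the two differ on the
  boundary.\<close>

lemma C1_imp_holder_bound:
  fixes U :: "(real^'n::finite) set"
  assumes U: "open U" "bounded U" and bd: "boundary_of_class (Suc k) \<theta> U"
    and \<beta>: "0 < \<beta>" "\<beta> \<le> 1"
  shows "\<exists>C\<ge>1. \<forall>(\<phi>::real^'n \<Rightarrow> real) f B. Ck_on (Suc 0) U \<phi> \<and> (\<forall>x\<in>U. \<forall>i. \<bar>partial_deriv i \<phi> x\<bar> \<le> B) \<and>
     (\<forall>x\<in>U. f x = \<phi> x) \<and> continuous_on (closure U) f \<and> (\<forall>x\<in>closure U. \<bar>f x\<bar> \<le> B) \<longrightarrow>
     holder_bound \<beta> (closure U) (C * B) f"
proof -
  let ?Q = "\<lambda>x0 s C. \<forall>(\<phi>::real^'n \<Rightarrow> real) B. Ck_on (Suc 0) U \<phi> \<and> (\<forall>x\<in>U. \<forall>i. \<bar>partial_deriv i \<phi> x\<bar> \<le> B) \<longrightarrow>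
     (\<forall>x\<in>U \<inter> ball x0 s. \<forall>y\<in>U \<inter> ball x0 s. \<bar>\<phi> x - \<phi> y\<bar> \<le> C * B * dist x y)"
  have "\<forall>x0\<in>closure U. \<exists>s>0. \<exists>C\<ge>0. ?Q x0 s C"
  proof
    fix x0 assume "x0 \<in> closure U"
    then have "x0 \<in> U \<or> x0 \<in> frontier U" using U by (auto simp: frontier_def interior_open)
    then show "\<exists>s>0. \<exists>C\<ge>0. ?Q x0 s C"
      using lipschitz_near_interior[OF U(1)] lipschitz_near_frontier[OF U(1) bd] by auto
  qed
  then obtain s c where s: "\<And>x0. x0 \<in> closure U \<Longrightarrow> s x0 > (0::real)"
    and c: "\<And>x0. x0 \<in> closure U \<Longrightarrow> c x0 \<ge> (0::real)"
    and Q: "\<And>x0. x0 \<in> closure U \<Longrightarrow> ?Q x0 (s x0) (c x0)"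
    by metis
  have comp: "compact (closure U)" using U by (simp add: compact_closure)
  have "closure U \<subseteq> (\<Union>x0\<in>closure U. ball x0 (s x0))" using s by force
  then obtain F where F: "F \<subseteq> closure U" "finite F" "closure U \<subseteq> (\<Union>x0\<in>F. ball x0 (s x0))"
    using compactE_image[OF comp, of "closure U" "\<lambda>x0. ball x0 (s x0)"] by auto
  obtain e where e: "e > 0" and
    eG: "\<And>x. x \<in> closure U \<Longrightarrow> \<exists>G\<in>(\<lambda>x0. ball x0 (s x0)) ` F. ball x e \<subseteq> G"
    by (rule Heine_Borel_lemma[OF comp, of "(\<lambda>x0. ball x0 (s x0)) ` F"]) (use F(3) in auto)
  define K where "K = (\<Sum>x0\<in>F. c x0)"
  have K: "c x0 \<le> K" if "x0 \<in> F" for x0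
    unfolding K_def using F c that by (intro member_le_sum) auto
  have K0: "K \<ge> 0" unfolding K_def using F c by (intro sum_nonneg) auto
  define C where "C = 1 + K * e powr (1 - \<beta>) + 2 / e powr \<beta>"
  have C: "C \<ge> 1" "C \<ge> K * e powr (1 - \<beta>)" "C \<ge> 2 / e powr \<beta>"
    using K0 by (auto simp: C_def)
  show ?thesis
  proof (intro exI[of _ C] conjI C(1) allI impI)
    fix \<phi> f :: "real^'n \<Rightarrow> real" and B
    assume A: "Ck_on (Suc 0) U \<phi> \<and> (\<forall>x\<in>U. \<forall>i. \<bar>partial_deriv i \<phi> x\<bar> \<le> B) \<and>
     (\<forall>x\<in>U. f x = \<phi> x) \<and> continuous_on (closure U) f \<and> (\<forall>x\<in>closure U. \<bar>f x\<bar> \<le> B)"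
    have inside: "\<bar>f x - f y\<bar> \<le> C * B * dist x y powr \<beta>" if x: "x \<in> U" and y: "y \<in> U" for x y
    proof -
      have xc: "x \<in> closure U" "y \<in> closure U" using x y closure_subset by auto
      have B: "0 \<le> B" "\<bar>f x\<bar> \<le> B" "\<bar>f y\<bar> \<le> B" using A xc by force+
      show ?thesis
      proof (cases "dist x y < e")
        case True
        obtain x0 where x0: "x0 \<in> F" "ball x e \<subseteq> ball x0 (s x0)" using eG[OF xc(1)] by auto
        have "x \<in> U \<inter> ball x0 (s x0)" "y \<in> U \<inter> ball x0 (s x0)"
          using subsetD[OF x0(2), of x] subsetD[OF x0(2), of y] e True x y by auto
        then have "\<bar>\<phi> x - \<phi> y\<bar> \<le> c x0 * B * dist x y" using Q[of x0] A x0 F by blast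
        also have "\<dots> \<le> K * B * dist x y" using K[OF x0(1)] B by (intro mult_right_mono) auto
        also have "dist x y = dist x y powr (1 - \<beta>) * dist x y powr \<beta>"
          by (simp flip: powr_add)
        also have "K * B * (dist x y powr (1 - \<beta>) * dist x y powr \<beta>) \<le> K * B * (e powr (1 - \<beta>) * dist x y powr \<beta>)"
          using True B K0 \<beta> by (intro mult_left_mono mult_right_mono powr_mono2) auto
        also have "\<dots> = (K * e powr (1 - \<beta>)) * (B * dist x y powr \<beta>)" by simp
        also have "\<dots> \<le> C * (B * dist x y powr \<beta>)" using C B by (intro mult_right_mono) auto
        finally show ?thesis using A x y by (simp add: mult.assoc)
      next
        case False
        have "e powr \<beta> \<le> dist x y powr \<beta>" using False e \<beta> by (intro powr_mono2) auto
        then have "1 \<le> dist x y powr \<beta> / e powr \<beta>" using e by simp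
        then have "2 * B * 1 \<le> 2 * B * (dist x y powr \<beta> / e powr \<beta>)" using B by (intro mult_left_mono) auto
        also have "\<dots> = (2 / e powr \<beta>) * (B * dist x y powr \<beta>)" by simp
        also have "\<dots> \<le> C * (B * dist x y powr \<beta>)" using C B by (intro mult_right_mono) auto
        finally show ?thesis using B by (simp add: mult.assoc)
      qed
    qed
    have cf: "continuous_on (closure U) f" using A by blast
    have cd: "continuous_on (closure U) (\<lambda>x. \<bar>f x - f y\<bar> - C * B * dist x y powr \<beta>)" for y
      by (intro continuous_intros cf continuous_on_powr') (use \<beta> in auto)
    have half: "\<bar>f x - f y\<bar> \<le> C * B * dist x y powr \<beta>" if x: "x \<in> closure U" and y: "y \<in> U" for x y
      using continuous_le_on_closure[OF cd x, of y 0] inside[OF _ y] by auto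
    have full: "\<bar>f x - f y\<bar> \<le> C * B * dist x y powr \<beta>" if x: "x \<in> closure U" and y: "y \<in> closure U" for x y
      using continuous_le_on_closure[OF cd x, of y 0] half[OF y] by (auto simp: dist_commute abs_minus_commute)
    show "holder_bound \<beta> (closure U) (C * B) f"
    proof (rule holder_boundI)
      fix x assume x: "x \<in> closure U"
      then have "\<bar>f x\<bar> \<le> B" using A by blast
      moreover from this have "1 * B \<le> C * B" using C by (intro mult_right_mono) auto
      ultimately show "norm (f x) \<le> C * B" by simp
    qed (use full in auto)
  qed
qed

text \<open>The norm of \<open>C\<^sup>2\<^sup>,\<^sup>\<beta>\<close> contains Hoelder seminorms of the second derivatives only. The operators
  \<^const>\<open>Lop\<close> multiply all derivatives of order at most two by coefficients that are merely Hoelder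
  continuous, so the lower derivatives must be controlled as well.\<close>

lemma holder_space_2_deriv_bounds:
  fixes U :: "(real^'n::finite) set"
  assumes U: "open U" "bounded U" "U \<noteq> {}" and bd: "boundary_of_class 2 \<theta> U"
    and \<beta>: "0 < \<beta>" "\<beta> \<le> 1"
  shows "\<exists>C\<ge>1. \<forall>\<phi>\<in>holder_space U 2 \<beta>. \<forall>\<gamma>. size \<gamma> \<le> 2 \<longrightarrow>
     holder_bound \<beta> (closure U) (C * holder_norm U 2 \<beta> \<phi>) (deriv_cl U \<gamma> \<phi> :: real^'n \<Rightarrow> real)"
proof -
  obtain C where C: "C \<ge> 1" and CC: "\<And>(\<phi>::real^'n \<Rightarrow> real) f B. Ck_on (Suc 0) U \<phi> \<Longrightarrow>
     (\<And>x i. x \<in> U \<Longrightarrow> \<bar>partial_deriv i \<phi> x\<bar> \<le> B) \<Longrightarrow>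
     (\<And>x. x\<in>U \<Longrightarrow> f x = \<phi> x) \<Longrightarrow> continuous_on (closure U) f \<Longrightarrow> (\<And>x. x\<in>closure U \<Longrightarrow> \<bar>f x\<bar> \<le> B) \<Longrightarrow>
     holder_bound \<beta> (closure U) (C * B) f"
    using C1_imp_holder_bound[OF U(1,2), of 1 \<theta> \<beta>] bd \<beta> unfolding Suc_1 by metis
  show ?thesis
  proof (intro exI[of _ C] conjI C ballI allI impI)
    fix \<phi> :: "real^'n \<Rightarrow> real" and \<gamma> :: "'n multiset"
    assume \<phi>: "\<phi> \<in> holder_space U 2 \<beta>" and \<gamma>: "size \<gamma> \<le> 2"
    let ?N = "holder_norm U 2 \<beta> \<phi>"
    note bnd = holder_norm_bounds_sup[OF U(1,3) \<phi>]
    have C2: "Ck_on 2 U \<phi>" using \<phi> by (simp add: holder_space_def)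
    have C2': "Ck_on (Suc (Suc 0)) U \<phi>" using C2 by (simp add: numeral_2_eq_2)
    have cont: "continuous_on (closure U) (deriv_cl U \<gamma> \<phi>)" using \<phi> \<gamma> by (simp add: holder_space_def)
    have cl: "x \<in> closure U" if "x \<in> U" for x using that closure_subset by blast
    from \<gamma> consider "size \<gamma> = 0" | "size \<gamma> = 1" | "size \<gamma> = 2" by linarith
    then show "holder_bound \<beta> (closure U) (C * ?N) (deriv_cl U \<gamma> \<phi>)"
    proof cases
      case 1
      show ?thesis
      proof (rule CC[where \<phi> = \<phi>])
        show "Ck_on (Suc 0) U \<phi>" using C2 Ck_on_mono by fastforce
        show "\<bar>partial_deriv i \<phi> x\<bar> \<le> ?N" if "x \<in> U" for x i
          using bnd[of "{#i#}" x] cl[OF that] that by (simp add: deriv_cl_inside multi_deriv_single)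
      qed (use 1 bnd[OF \<gamma>] cont in auto)
    next
      case 2
      then obtain i where i: "\<gamma> = {#i#}" using size_1_singleton_mset by blast
      show ?thesis
      proof (rule CC[where \<phi> = "partial_deriv i \<phi>"])
        show "Ck_on (Suc 0) U (partial_deriv i \<phi>)" by (rule Ck_on_partial[OF C2'])
        show "\<bar>partial_deriv j (partial_deriv i \<phi>) x\<bar> \<le> ?N" if "x \<in> U" for x j
          using bnd[of "{#j, i#}" x] cl[OF that] that
          by (simp add: deriv_cl_inside multi_deriv_pair[OF U(1) C2])
        show "deriv_cl U \<gamma> \<phi> x = partial_deriv i \<phi> x" if "x \<in> U" for x
          using that by (simp add: i deriv_cl_inside multi_deriv_single)
      qed (use bnd[OF \<gamma>] cont in auto)
    next
      case 3
      have "1 * ?N \<le> C * ?N" using C holder_norm_nonneg[OF U(1,3) \<phi>] by (intro mult_right_mono) auto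
      then show ?thesis
        using holder_bound_mono[OF holder_bound_top_deriv[OF U(1,3) \<phi> 3]] by simp
    qed
  qed
qed

section \<open>The coefficient space and the operators\<close>

lemma co_add [simp]:
  "co_a (\<tau> + \<tau>') k x = co_a \<tau> k x + co_a \<tau>' k x" "co_b (\<tau> + \<tau>') k x = co_b \<tau> k x + co_b \<tau>' k x"
  "co_c (\<tau> + \<tau>') k x = co_c \<tau> k x + co_c \<tau>' k x" "co_f (\<tau> + \<tau>') k x = co_f \<tau> k x + co_f \<tau>' k x"
  "co_g (\<tau> + \<tau>') x = co_g \<tau> x + co_g \<tau>' x"
  by (simp_all add: co_a_def co_b_def co_c_def co_f_def co_g_def)

lemma co_scaleR [simp]:
  "co_a (r *\<^sub>R \<tau>) k x = r *\<^sub>R co_a \<tau> k x" "co_b (r *\<^sub>R \<tau>) k x = r *\<^sub>R co_b \<tau> k x"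
  "co_c (r *\<^sub>R \<tau>) k x = r * co_c \<tau> k x" "co_f (r *\<^sub>R \<tau>) k x = r * co_f \<tau> k x"
  "co_g (r *\<^sub>R \<tau>) x = r * co_g \<tau> x"
  by (simp_all add: co_a_def co_b_def co_c_def co_f_def co_g_def scaleR_fun_def)

lemma Lop_add_coeffs: "Lop U (\<tau> + \<tau>') \<phi> x = Lop U \<tau> \<phi> x + Lop U \<tau>' \<phi> x"
  by (simp add: Lop_def vec_eq_iff sum.distrib algebra_simps)

lemma Lop_scaleR_coeffs: "Lop U (r *\<^sub>R \<tau>) \<phi> x = r *\<^sub>R Lop U \<tau> \<phi> x"
  by (simp add: Lop_def vec_eq_iff sum_distrib_left algebra_simps)

lemma fvec_add: "fvec (\<tau> + \<tau>') x = fvec \<tau> x + fvec \<tau>' x"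
  by (simp add: fvec_def vec_eq_iff)

lemma fvec_scaleR: "fvec (r *\<^sub>R \<tau>) x = r *\<^sub>R fvec \<tau> x"
  by (simp add: fvec_def vec_eq_iff)

lemma Lop_cong:
  assumes "open U" "\<And>y. y \<in> closure U \<Longrightarrow> \<phi> y = \<psi> y" "x \<in> closure U"
  shows "Lop U \<tau> \<phi> x = Lop U \<tau> \<psi> x"
  unfolding Lop_def using deriv_cl_cong[OF assms(1), of \<phi> \<psi>, OF assms(2,3)] assms(2,3) by simp

lemma Lop_lincomb:
  assumes U: "open U" and \<phi>: "\<phi> \<in> holder_space U 2 \<theta>" and \<psi>: "\<psi> \<in> holder_space U 2 \<theta>" and x: "x \<in> closure U"
  shows "Lop U \<tau> (\<lambda>x. r * \<phi> x + s * \<psi> x) x = r *\<^sub>R Lop U \<tau> \<phi> x + s *\<^sub>R Lop U \<tau> \<psi> x"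
proof -
  have "deriv_cl U \<gamma> (\<lambda>x. r * \<phi> x + s * \<psi> x) x = r * deriv_cl U \<gamma> \<phi> x + s * deriv_cl U \<gamma> \<psi> x"
    if "size \<gamma> \<le> 2" for \<gamma>
    using deriv_cl_lincomb[OF U \<phi> \<psi> that x, of r s] by simp
  then show ?thesis
    by (simp add: Lop_def vec_eq_iff sum.distrib sum_distrib_left algebra_simps)
qed

text \<open>In the interior no boundary values of derivatives are needed, and linearity holds for all
  functions of class \<open>C\<^sup>2\<close>. The notion of a solution of the linearized problem demands no more
  regularity than that.\<close>

lemma Lop_lincomb_inside:
  assumes U: "open U" and C: "Ck_on 2 U \<phi>" "Ck_on 2 U \<psi>" and x: "x \<in> U"
  shows "Lop U \<tau> (\<lambda>x. r * \<phi> x + s * \<psi> x) x = r *\<^sub>R Lop U \<tau> \<phi> x + s *\<^sub>R Lop U \<tau> \<psi> x"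
proof -
  have "deriv_cl U \<gamma> (\<lambda>x. r * \<phi> x + s * \<psi> x) x = r * deriv_cl U \<gamma> \<phi> x + s * deriv_cl U \<gamma> \<psi> x"
    if "size \<gamma> \<le> 2" for \<gamma>
    using multi_deriv_lincomb[OF U C that x, of r s] x by (simp add: deriv_cl_inside)
  then show ?thesis
    by (simp add: Lop_def vec_eq_iff sum.distrib sum_distrib_left algebra_simps)
qed

lemma Lop_inside:
  assumes "open U" "Ck_on 2 U \<phi>" "x \<in> U"
  shows "Lop U \<tau> \<phi> x $ k = (\<Sum>i\<in>UNIV. \<Sum>j\<in>UNIV. co_a \<tau> k x $ i $ j * partial_deriv i (partial_deriv j \<phi>) x)
    + (\<Sum>i\<in>UNIV. co_b \<tau> k x $ i * partial_deriv i \<phi> x) - co_c \<tau> k x * \<phi> x"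
  using assms by (simp add: Lop_def deriv_cl_inside multi_deriv_pair multi_deriv_single)

lemma Theta_space_lincomb:
  assumes U: "open U" "U \<noteq> {}" and t: "\<tau> \<in> Theta_space U \<beta>" "\<tau>' \<in> Theta_space U \<beta>"
  shows "r *\<^sub>R \<tau> + s *\<^sub>R \<tau>' \<in> Theta_space U \<beta>"
proof -
  have eq: "co_a (r *\<^sub>R \<tau> + s *\<^sub>R \<tau>') k = (\<lambda>x. r *\<^sub>R co_a \<tau> k x + s *\<^sub>R co_a \<tau>' k x)"
    "co_b (r *\<^sub>R \<tau> + s *\<^sub>R \<tau>') k = (\<lambda>x. r *\<^sub>R co_b \<tau> k x + s *\<^sub>R co_b \<tau>' k x)"
    "co_c (r *\<^sub>R \<tau> + s *\<^sub>R \<tau>') k = (\<lambda>x. r *\<^sub>R co_c \<tau> k x + s *\<^sub>R co_c \<tau>' k x)"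
    "co_f (r *\<^sub>R \<tau> + s *\<^sub>R \<tau>') k = (\<lambda>x. r *\<^sub>R co_f \<tau> k x + s *\<^sub>R co_f \<tau>' k x)"
    "co_g (r *\<^sub>R \<tau> + s *\<^sub>R \<tau>') = (\<lambda>x. r *\<^sub>R co_g \<tau> x + s *\<^sub>R co_g \<tau>' x)" for k
    by (simp_all add: fun_eq_iff)
  show ?thesis
    using t unfolding Theta_space_def mem_Collect_eq eq
    by (intro conjI allI holder_space_lincomb[OF U]) blast+
qed

lemma Theta_norm_nonneg:
  assumes U: "open U" "U \<noteq> {}" and t: "\<tau> \<in> Theta_space U \<beta>"
  shows "0 \<le> Theta_norm U \<beta> \<tau>"
  using t unfolding Theta_norm_def Theta_space_def
  by (auto intro!: add_nonneg_nonneg sum_nonneg holder_norm_nonneg[OF U])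

lemma Theta_norm_scaleR_le:
  assumes U: "open U" "U \<noteq> {}" and t: "\<tau> \<in> Theta_space U \<beta>"
  shows "Theta_norm U \<beta> (r *\<^sub>R \<tau>) \<le> \<bar>r\<bar> * Theta_norm U \<beta> \<tau>"
proof -
  have eq: "co_a (r *\<^sub>R \<tau>) k = (\<lambda>x. r *\<^sub>R co_a \<tau> k x)" "co_b (r *\<^sub>R \<tau>) k = (\<lambda>x. r *\<^sub>R co_b \<tau> k x)"
    "co_c (r *\<^sub>R \<tau>) k = (\<lambda>x. r *\<^sub>R co_c \<tau> k x)" "co_f (r *\<^sub>R \<tau>) k = (\<lambda>x. r *\<^sub>R co_f \<tau> k x)"
    "co_g (r *\<^sub>R \<tau>) = (\<lambda>x. r *\<^sub>R co_g \<tau> x)" for k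
    by (simp_all add: fun_eq_iff)
  show ?thesis
    using t unfolding Theta_norm_def Theta_space_def mem_Collect_eq eq distrib_left sum_distrib_left
    by (intro add_mono sum_mono holder_norm_scaleR_le[OF U]) auto
qed

lemma Theta_norm_bounds:
  assumes U: "open U" "U \<noteq> {}" and t: "\<tau> \<in> Theta_space U \<beta>"
  shows "holder_bound \<beta> (closure U) (Theta_norm U \<beta> \<tau>) (co_a \<tau> k)"
    "holder_bound \<beta> (closure U) (Theta_norm U \<beta> \<tau>) (co_b \<tau> k)"
    "holder_bound \<beta> (closure U) (Theta_norm U \<beta> \<tau>) (co_c \<tau> k)"
    "holder_bound \<beta> (closure U) (Theta_norm U \<beta> \<tau>) (co_f \<tau> k)"
    "x \<in> closure U \<Longrightarrow> \<bar>co_g \<tau> x\<bar> \<le> Theta_norm U \<beta> \<tau>"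
proof -
  let ?s = "\<lambda>k. holder_norm U 0 \<beta> (co_a \<tau> k) + holder_norm U 0 \<beta> (co_b \<tau> k)
      + holder_norm U 0 \<beta> (co_c \<tau> k) + holder_norm U 0 \<beta> (co_f \<tau> k)"
  have sp: "co_a \<tau> k \<in> holder_space U 0 \<beta>" "co_b \<tau> k \<in> holder_space U 0 \<beta>"
     "co_c \<tau> k \<in> holder_space U 0 \<beta>" "co_f \<tau> k \<in> holder_space U 0 \<beta>" "co_g \<tau> \<in> holder_space U 2 \<beta>" for k
    using t by (auto simp: Theta_space_def)
  note nn = sp[THEN holder_norm_nonneg[OF U]]
  have "?s k \<le> (\<Sum>k\<in>UNIV. ?s k)"
    by (rule member_le_sum) (auto intro!: add_nonneg_nonneg nn)
  then have le: "?s k \<le> Theta_norm U \<beta> \<tau>" "holder_norm U 2 \<beta> (co_g \<tau>) \<le> Theta_norm U \<beta> \<tau>"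
    unfolding Theta_norm_def using nn(5) by (auto intro!: sum_nonneg add_nonneg_nonneg nn)
  show "holder_bound \<beta> (closure U) (Theta_norm U \<beta> \<tau>) (co_a \<tau> k)"
    "holder_bound \<beta> (closure U) (Theta_norm U \<beta> \<tau>) (co_b \<tau> k)"
    "holder_bound \<beta> (closure U) (Theta_norm U \<beta> \<tau>) (co_c \<tau> k)"
    "holder_bound \<beta> (closure U) (Theta_norm U \<beta> \<tau>) (co_f \<tau> k)"
    using le(1) nn(1-4)[of k] by (auto intro!: holder_bound_mono[OF holder_space_0_bound[OF U]] sp)
  show "\<bar>co_g \<tau> x\<bar> \<le> Theta_norm U \<beta> \<tau>" if "x \<in> closure U"
    using holder_norm_bounds_sup[OF U sp(5), of "{#}" x] that le(2) by simp
qed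

text \<open>The bilinear map \<open>(\<tau>, \<phi>) \<mapsto> L\<^sup>\<tau>\<phi>\<close> is bounded: each component is a sum of products of two
  Hoelder functions.\<close>

lemma Lop_holder_bound:
  fixes \<phi> :: "real^'n::finite \<Rightarrow> real" and \<tau> :: "('n, 'k::finite) coeffs"
  assumes U: "open U" "U \<noteq> {}" and t: "\<tau> \<in> Theta_space U \<beta>"
    and \<phi>: "\<And>\<gamma>. size \<gamma> \<le> 2 \<Longrightarrow> holder_bound \<beta> (closure U) N (deriv_cl U \<gamma> \<phi>)"
  shows "holder_bound \<beta> (closure U)
    (real CARD('k) * (2 * (real CARD('n) * real CARD('n) + real CARD('n) + 1)) * Theta_norm U \<beta> \<tau> * N) (Lop U \<tau> \<phi>)"
proof -
  let ?T = "Theta_norm U \<beta> \<tau>" and ?n = "real CARD('n)"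
  note B = Theta_norm_bounds[OF U t]
  have \<phi>0: "holder_bound \<beta> (closure U) N \<phi>"
    using \<phi>[of "{#}"] by (simp add: holder_bound_def)
  have "holder_bound \<beta> (closure U) (2 * (?n * ?n + ?n + 1) * ?T * N) (\<lambda>x. Lop U \<tau> \<phi> x $ k)" for k
  proof -
    have "holder_bound \<beta> (closure U)
        ((\<Sum>i\<in>(UNIV::'n set). \<Sum>j\<in>(UNIV::'n set). 2 * (?T * N)) + (\<Sum>i\<in>(UNIV::'n set). 2 * (?T * N)) + 2 * (?T * N))
        (\<lambda>x. (\<Sum>i\<in>UNIV. \<Sum>j\<in>UNIV. co_a \<tau> k x $ i $ j * deriv_cl U {#i, j#} \<phi> x)
          + (\<Sum>i\<in>UNIV. co_b \<tau> k x $ i * deriv_cl U {#i#} \<phi> x) - co_c \<tau> k x * \<phi> x)"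
      by (intro holder_bound_diff holder_bound_add holder_bound_sum holder_bound_mult \<phi> \<phi>0 B
            holder_bound_nth) auto
    then show ?thesis by (simp add: Lop_def algebra_simps)
  qed
  from holder_bound_vec[of \<beta> "closure U", OF this] show ?thesis by (simp add: mult.assoc)
qed

lemma Lop_bound_exists:
  fixes U :: "(real^'n::finite) set"
  assumes U: "open U" "bounded U" "U \<noteq> {}" and bd: "boundary_of_class 2 \<theta> U"
    and \<beta>: "0 < \<beta>" "\<beta> \<le> 1"
  shows "\<exists>C\<ge>0. \<forall>\<phi>\<in>holder_space U 2 \<beta>. \<forall>\<tau>\<in>(Theta_space U \<beta> :: ('n, 'k::finite) coeffs set).
    holder_bound \<beta> (closure U) (C * Theta_norm U \<beta> \<tau> * holder_norm U 2 \<beta> \<phi>) (Lop U \<tau> \<phi>)"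
proof -
  obtain C where C: "C \<ge> 1" and CC: "\<forall>\<phi>\<in>holder_space U 2 \<beta>. \<forall>\<gamma>. size \<gamma> \<le> 2 \<longrightarrow>
     holder_bound \<beta> (closure U) (C * holder_norm U 2 \<beta> \<phi>) (deriv_cl U \<gamma> \<phi> :: real^'n \<Rightarrow> real)"
    using holder_space_2_deriv_bounds[OF U bd \<beta>] by (elim exE conjE) (rule that)
  define C' where "C' = real CARD('k) * (2 * (real CARD('n) * real CARD('n) + real CARD('n) + 1)) * C"
  have "holder_bound \<beta> (closure U) (C' * Theta_norm U \<beta> \<tau> * holder_norm U 2 \<beta> \<phi>) (Lop U \<tau> \<phi>)"
    if \<phi>: "\<phi> \<in> holder_space U 2 \<beta>" and \<tau>: "\<tau> \<in> Theta_space U \<beta>" for \<phi> and \<tau> :: "('n, 'k) coeffs"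
    using Lop_holder_bound[OF U(1,3) \<tau>, of "C * holder_norm U 2 \<beta> \<phi>" \<phi>] CC \<phi>
    by (simp add: C'_def mult_ac)
  moreover have "C' \<ge> 0" using C by (simp add: C'_def)
  ultimately show ?thesis by blast
qed

lemma fvec_holder_bound:
  fixes \<tau> :: "('n::finite, 'k::finite) coeffs"
  assumes U: "open U" "U \<noteq> {}" and t: "\<tau> \<in> Theta_space U \<beta>"
  shows "holder_bound \<beta> (closure U) (real CARD('k) * Theta_norm U \<beta> \<tau>) (fvec \<tau>)"
proof -
  have "holder_bound \<beta> (closure U) (Theta_norm U \<beta> \<tau>) (\<lambda>x. fvec \<tau> x $ k)" for k
    using Theta_norm_bounds(4)[OF U t, of k] by (simp add: fvec_def)
  from holder_bound_vec[of \<beta> "closure U", OF this] show ?thesis by simp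
qed

section \<open>Superposition operators on Hoelder functions\<close>

lemma C1_locally_lipschitz:
  fixes G :: "real^'k::finite \<Rightarrow> real"
  assumes C1: "Ck_on (Suc 0) UNIV G"
  shows "\<exists>L\<ge>0. \<forall>a\<in>cball 0 M. \<bar>G a\<bar> \<le> L \<and> (\<forall>b\<in>cball 0 M. \<bar>G a - G b\<bar> \<le> L * norm (a - b))"
proof -
  have bdd: "bounded (g ` cball 0 M)" if "continuous_on UNIV g" for g :: "real^'k \<Rightarrow> real"
    by (intro compact_imp_bounded compact_continuous_image continuous_on_subset[OF that]) auto
  obtain B where B: "\<And>a. a \<in> cball 0 M \<Longrightarrow> \<bar>G a\<bar> \<le> B"
    using bdd[OF Ck_on_continuous[OF C1]] unfolding bounded_iff by (metis image_eqI real_norm_def)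
  have "\<exists>B. \<forall>a\<in>cball 0 M. \<bar>partial_deriv l G a\<bar> \<le> B" for l
    using bdd[OF Ck_on_continuous[OF Ck_on_partial[OF C1]], of l] by (auto simp: bounded_iff)
  then obtain b where b: "\<And>l a. a \<in> cball 0 M \<Longrightarrow> \<bar>partial_deriv l G a\<bar> \<le> b l" by metis
  define B' where "B' = (\<Sum>l\<in>UNIV. \<bar>b l\<bar>)"
  have B': "\<bar>partial_deriv l G a\<bar> \<le> B'" if "a \<in> cball 0 M" for l a
  proof -
    have "\<bar>partial_deriv l G a\<bar> \<le> \<bar>b l\<bar>" using b[OF that, of l] by linarith
    also have "\<dots> \<le> B'" unfolding B'_def by (intro member_le_sum) auto
    finally show ?thesis .
  qed
  have B'0: "B' \<ge> 0" unfolding B'_def by (intro sum_nonneg) auto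
  show ?thesis
  proof (intro exI[of _ "real CARD('k) * B' + \<bar>B\<bar>"] conjI ballI)
    fix a b :: "real^'k" assume ab: "a \<in> cball 0 M" "b \<in> cball 0 M"
    have "norm (G a - G b) \<le> real CARD('k) * B' * norm (a - b)"
      by (rule C1_lipschitz_on_convex[OF open_UNIV C1 _ convex_cball _ ab]) (use B' in auto)
    also have "\<dots> \<le> (real CARD('k) * B' + \<bar>B\<bar>) * norm (a - b)" by (intro mult_right_mono) auto
    finally show "\<bar>G a - G b\<bar> \<le> (real CARD('k) * B' + \<bar>B\<bar>) * norm (a - b)" by simp
  next
    fix a :: "real^'k" assume "a \<in> cball 0 M"
    then show "\<bar>G a\<bar> \<le> real CARD('k) * B' + \<bar>B\<bar>" using B[of a] B'0 by (smt (verit) mult_nonneg_nonneg of_nat_0_le_iff)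
  qed (use B'0 in auto)
qed

lemma C1_comp_holder_bound:
  fixes G :: "real^'k::finite \<Rightarrow> real" and v :: "'a::metric_space \<Rightarrow> real^'k"
  assumes C1: "Ck_on (Suc 0) UNIV G" and M: "0 \<le> M" and v: "holder_bound \<beta> S M v"
  shows "\<exists>N. holder_bound \<beta> S N (\<lambda>x. G (v x))"
proof -
  obtain L where L: "L \<ge> 0" and GL: "\<And>a. a\<in>cball 0 M \<Longrightarrow> \<bar>G a\<bar> \<le> L"
      "\<And>a b. a\<in>cball 0 M \<Longrightarrow> b\<in>cball 0 M \<Longrightarrow> \<bar>G a - G b\<bar> \<le> L * norm (a - b)"
    using C1_locally_lipschitz[OF C1, of M] by metis
  have "holder_bound \<beta> S (L * (1 + M)) (\<lambda>x. G (v x))"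
  proof (rule holder_boundI)
    have c: "v x \<in> cball 0 M" if "x \<in> S" for x using holder_boundD(1)[OF v that] by simp
    show "norm (G (v x)) \<le> L * (1 + M)" if "x \<in> S" for x
    proof -
      have "0 \<le> L * M" using L M by simp
      then show ?thesis using GL(1)[OF c[OF that]] by (simp add: algebra_simps)
    qed
    show "norm (G (v x) - G (v y)) \<le> L * (1 + M) * dist x y powr \<beta>" if "x \<in> S" "y \<in> S" for x y
    proof -
      have "norm (G (v x) - G (v y)) \<le> L * norm (v x - v y)" using GL(2) c that by simp
      also have "\<dots> \<le> L * (M * dist x y powr \<beta>)"
        using holder_boundD(2)[OF v that] L by (intro mult_left_mono) auto
      also have "\<dots> \<le> L * ((1 + M) * dist x y powr \<beta>)"
        using L by (intro mult_left_mono mult_right_mono) auto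
      finally show ?thesis by (simp add: mult.assoc)
    qed
  qed
  then show ?thesis by blast
qed

text \<open>The derivative is uniformly continuous on compact sets, so the error of the linearization at
  \<open>a\<close> is small uniformly in \<open>a\<close>. Two free end points \<open>z1\<close> and \<open>z2\<close> are needed for estimating
  differences of remainders.\<close>

lemma C1_uniform_linearization:
  fixes G :: "real^'k::finite \<Rightarrow> real"
  assumes C1: "Ck_on (Suc 0) UNIV G" and e: "e > 0"
  shows "\<exists>d>0. \<forall>a z1 z2. norm a \<le> M \<and> norm (z1 - a) \<le> d \<and> norm (z2 - a) \<le> d \<longrightarrow>
    \<bar>G z1 - G z2 - (\<Sum>l\<in>UNIV. (z1 - z2) $ l * partial_deriv l G a)\<bar> \<le> e * norm (z1 - z2)"
proof -
  define e' where "e' = e / real CARD('k)"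
  have e': "e' > 0" using e by (simp add: e'_def)
  have "\<exists>d>0. \<forall>a\<in>cball 0 (M + 1). \<forall>z\<in>cball 0 (M + 1). dist z a < d \<longrightarrow> dist (partial_deriv l G z) (partial_deriv l G a) < e'" for l
  proof -
    have "uniformly_continuous_on (cball 0 (M + 1)) (partial_deriv l G)"
      by (intro compact_uniformly_continuous continuous_on_subset[OF Ck_on_continuous[OF Ck_on_partial[OF C1]]]) auto
    then show ?thesis using e' unfolding uniformly_continuous_on_def by blast
  qed
  then obtain d where d: "\<And>l. d l > 0" and dd: "\<And>l a z. a\<in>cball 0 (M + 1) \<Longrightarrow> z\<in>cball 0 (M + 1) \<Longrightarrow> dist z a < d l \<Longrightarrow>
      dist (partial_deriv l G z) (partial_deriv l G a) < e'" by metis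
  define m where "m = min 1 (Min (range d))"
  have m: "m > 0" "m \<le> 1" "\<And>l. m \<le> d l" using d by (auto simp: m_def min_le_iff_disj)
  show ?thesis
  proof (intro exI[of _ "m/2"] conjI allI impI)
    fix a z1 z2 :: "real^'k" assume A: "norm a \<le> M \<and> norm (z1 - a) \<le> m/2 \<and> norm (z2 - a) \<le> m/2"
    let ?g = "\<lambda>z. G z - (\<Sum>l\<in>UNIV. z $ l * partial_deriv l G a)"
    have "norm (?g z1 - ?g z2) \<le> (real CARD('k) * e') * norm (z1 - z2)"
    proof (rule differentiable_bound[where S = "cball a (m/2)"])
      fix z assume z: "z \<in> cball a (m/2)"
      have "(G has_derivative (\<lambda>h. \<Sum>l\<in>UNIV. h $ l *\<^sub>R partial_deriv l G z)) (at z)"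
        using C1_has_derivative[OF open_UNIV C1] by simp
      moreover have "bounded_linear (\<lambda>z::real^'k. \<Sum>l\<in>UNIV. z $ l * partial_deriv l G a)"
        by (intro bounded_linear_sum bounded_linear_mult_const bounded_linear_vec_nth)
      ultimately have "(?g has_derivative (\<lambda>h. (\<Sum>l\<in>UNIV. h $ l *\<^sub>R partial_deriv l G z)
          - (\<Sum>l\<in>UNIV. h $ l * partial_deriv l G a))) (at z)"
        by (intro has_derivative_diff bounded_linear_imp_has_derivative)
      moreover have "(\<lambda>h. (\<Sum>l\<in>UNIV. h $ l *\<^sub>R partial_deriv l G z) - (\<Sum>l\<in>UNIV. h $ l * partial_deriv l G a))
          = (\<lambda>h::real^'k. \<Sum>l\<in>UNIV. h $ l *\<^sub>R (partial_deriv l G z - partial_deriv l G a))"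
        by (simp only: real_scaleR_def right_diff_distrib sum_subtractf)
      ultimately have "(?g has_derivative (\<lambda>h. \<Sum>l\<in>UNIV. h $ l *\<^sub>R (partial_deriv l G z - partial_deriv l G a))) (at z)"
        by simp
      then show "(?g has_derivative (\<lambda>h. \<Sum>l\<in>UNIV. h $ l *\<^sub>R (partial_deriv l G z - partial_deriv l G a))) (at z within cball a (m/2))"
        by (rule has_derivative_at_withinI)
      show "onorm (\<lambda>h. \<Sum>l\<in>UNIV. h $ l *\<^sub>R (partial_deriv l G z - partial_deriv l G a)) \<le> real CARD('k) * e'"
      proof (rule onorm_partials_le)
        fix l
        have "norm z \<le> norm a + norm (z - a)" by (metis add.commute diff_add_cancel norm_triangle_ineq)
        then have "z \<in> cball 0 (M + 1)" using z A m by (auto simp: dist_norm norm_minus_commute)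
        moreover have "a \<in> cball 0 (M + 1)" using A by auto
        moreover have "dist z a < d l" using z m(1) m(3)[of l] by (auto simp: dist_commute)
        ultimately show "norm (partial_deriv l G z - partial_deriv l G a) \<le> e'"
          using dd[of a z l] by (simp add: dist_norm)
      qed
    qed (use A in \<open>auto simp: dist_norm norm_minus_commute\<close>)
    then show "\<bar>G z1 - G z2 - (\<Sum>l\<in>UNIV. (z1 - z2) $ l * partial_deriv l G a)\<bar> \<le> e * norm (z1 - z2)"
      by (simp add: e'_def sum_subtractf algebra_simps)
  qed (use m in auto)
qed

text \<open>Differentiability of \<open>v \<mapsto> G \<circ> v\<close> on Hoelder functions costs one derivative of \<open>G\<close> more than it
  does on continuous functions. For two points \<open>x\<close> and \<open>y\<close> the difference of the remainders is
  split in two parts. Changing \<open>w x\<close> into \<open>w y\<close> with base point \<open>v x\<close> gives the linearization error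
  of \<open>G\<close>. Changing the base point from \<open>v x\<close> to \<open>v y\<close> gives, by the mean value theorem, the
  linearization errors of the partial derivatives of \<open>G\<close>.\<close>

lemma superposition_remainder:
  fixes G :: "real^'k::finite \<Rightarrow> real" and v :: "'a::metric_space \<Rightarrow> real^'k"
  assumes C2: "Ck_on 2 UNIV G" and M: "M \<ge> 0" and e: "e > 0" and v: "holder_bound \<beta> S M v"
  shows "\<exists>d>0. \<forall>w \<mu>. holder_bound \<beta> S \<mu> w \<and> \<mu> \<le> d \<longrightarrow>
    holder_bound \<beta> S (e * \<mu>) (\<lambda>x. G (v x + w x) - G (v x) - (\<Sum>l\<in>UNIV. w x $ l * partial_deriv l G (v x)))"
proof -
  let ?K = "real CARD('k)"
  have C2': "Ck_on (Suc (Suc 0)) UNIV G" using C2 by (simp add: numeral_2_eq_2)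
  have C1: "Ck_on (Suc 0) UNIV G" using C2' Ck_on_mono by fastforce
  have C1': "Ck_on (Suc 0) UNIV (partial_deriv l G)" for l by (rule Ck_on_partial[OF C2'])
  \<comment> \<open>The two parts of the Hoelder quotient contribute \<open>1\<close> and \<open>K M\<close> times the linearization error.\<close>
  define e' where "e' = e / (1 + ?K * M)"
  have KM: "1 + ?K * M > 0" using M by (simp add: add_pos_nonneg)
  have e': "e' > 0" "e' * (1 + ?K * M) = e" "e' \<le> e" using e KM M by (auto simp: e'_def divide_le_eq)
  obtain d0 where d0: "d0 > 0" and lin: "\<forall>a z1 z2. norm a \<le> M \<and> norm (z1 - a) \<le> d0 \<and> norm (z2 - a) \<le> d0 \<longrightarrow>
      \<bar>G z1 - G z2 - (\<Sum>l\<in>UNIV. (z1 - z2) $ l * partial_deriv l G a)\<bar> \<le> e' * norm (z1 - z2)"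
    using C1_uniform_linearization[OF C1 e'(1), of M] by (elim exE conjE) (rule that)
  have "\<forall>m. \<exists>d>0. \<forall>a z1 z2. norm a \<le> M \<and> norm (z1 - a) \<le> d \<and> norm (z2 - a) \<le> d \<longrightarrow>
      \<bar>(partial_deriv m G) z1 - (partial_deriv m G) z2 - (\<Sum>l\<in>UNIV. (z1 - z2) $ l * partial_deriv l (partial_deriv m G) a)\<bar> \<le> e' * norm (z1 - z2)"
    by (intro allI C1_uniform_linearization[OF C1' e'(1)])
  then obtain d1 where d1': "\<forall>m. d1 m > 0 \<and> (\<forall>a z1 z2. norm a \<le> M \<and> norm (z1 - a) \<le> d1 m \<and> norm (z2 - a) \<le> d1 m \<longrightarrow>
      \<bar>(partial_deriv m G) z1 - (partial_deriv m G) z2 - (\<Sum>l\<in>UNIV. (z1 - z2) $ l * partial_deriv l (partial_deriv m G) a)\<bar> \<le> e' * norm (z1 - z2))"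
    by (elim choice[THEN exE]) (rule that)
  have d1: "d1 m > 0" and lin1: "\<forall>a z1 z2. norm a \<le> M \<and> norm (z1 - a) \<le> d1 m \<and> norm (z2 - a) \<le> d1 m \<longrightarrow>
      \<bar>(partial_deriv m G) z1 - (partial_deriv m G) z2 - (\<Sum>l\<in>UNIV. (z1 - z2) $ l * partial_deriv l (partial_deriv m G) a)\<bar> \<le> e' * norm (z1 - z2)" for m
    using d1' by auto
  define d where "d = min d0 (Min (range d1))"
  have d: "d > 0" "d \<le> d0" "\<And>m. d \<le> d1 m" using d0 d1 by (auto simp: d_def min_le_iff_disj)
  show ?thesis
  proof (intro exI[of _ d] conjI d(1) allI impI)
    fix w :: "'a \<Rightarrow> real^'k" and \<mu> :: real
    assume "holder_bound \<beta> S \<mu> w \<and> \<mu> \<le> d"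
    then have w: "holder_bound \<beta> S \<mu> w" and \<mu>: "\<mu> \<le> d" by auto
    have vn: "norm (v x) \<le> M" and wn: "norm (w x) \<le> \<mu>" if "x \<in> S" for x
      using holder_boundD(1)[OF v that] holder_boundD(1)[OF w that] by auto
    show "holder_bound \<beta> S (e * \<mu>) (\<lambda>x. G (v x + w x) - G (v x) - (\<Sum>l\<in>UNIV. w x $ l * partial_deriv l G (v x)))"
    proof (rule holder_boundI)
      fix x assume x: "x \<in> S"
      have \<mu>0: "0 \<le> \<mu>" using wn[OF x] norm_ge_zero order_trans by blast
      have "\<bar>G (v x + w x) - G (v x) - (\<Sum>l\<in>UNIV. w x $ l * partial_deriv l G (v x))\<bar> \<le> e' * norm (w x)"
        using lin[rule_format, of "v x" "v x + w x" "v x"] vn[OF x] wn[OF x] \<mu> d by simp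
      also have "\<dots> \<le> e * \<mu>" using e' e wn[OF x] by (intro mult_mono) auto
      finally show "norm (G (v x + w x) - G (v x) - (\<Sum>l\<in>UNIV. w x $ l * partial_deriv l G (v x))) \<le> e * \<mu>" by simp
    next
      fix x y assume x: "x \<in> S" and y: "y \<in> S"
      have \<mu>0: "0 \<le> \<mu>" using wn[OF x] norm_ge_zero order_trans by blast
      let ?b = "w y"
      let ?p = "\<lambda>z. G (z + ?b) - G z - (\<Sum>l\<in>UNIV. ?b $ l * partial_deriv l G z)"
      have 1: "\<bar>G (v x + w x) - G (v x + ?b) - (\<Sum>l\<in>UNIV. (w x - ?b) $ l * partial_deriv l G (v x))\<bar>
          \<le> e' * norm (w x - ?b)"
        using lin[rule_format, of "v x" "v x + w x" "v x + ?b"] vn[OF x] wn[OF x] wn[OF y] \<mu> d by simp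
      have 2: "norm (?p (v x) - ?p (v y)) \<le> (?K * (e' * \<mu>)) * norm (v x - v y)"
      proof (rule differentiable_bound[where S = "cball 0 M"])
        fix z :: "real^'k" assume z: "z \<in> cball 0 M"
        let ?D = "\<lambda>m. partial_deriv m G (z + ?b) - partial_deriv m G z - (\<Sum>l\<in>UNIV. ?b $ l * partial_deriv m (partial_deriv l G) z)"
        have g: "(G has_derivative (\<lambda>h. \<Sum>m\<in>UNIV. h $ m *\<^sub>R partial_deriv m G z)) (at z)" for z
          using C1_has_derivative[OF open_UNIV C1] by simp
        have "((\<lambda>z. z + ?b) has_derivative (\<lambda>h. h)) (at z)" by (auto intro!: derivative_eq_intros)
        from has_derivative_compose[OF this g]
        have g1: "((\<lambda>z. G (z + ?b)) has_derivative (\<lambda>h. \<Sum>m\<in>UNIV. h $ m *\<^sub>R partial_deriv m G (z + ?b))) (at z)" .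
        have g2: "(partial_deriv l G has_derivative (\<lambda>h. \<Sum>m\<in>UNIV. h $ m *\<^sub>R partial_deriv m (partial_deriv l G) z)) (at z)" for l
          using C1_has_derivative[OF open_UNIV C1'] by simp
        have "(?p has_derivative (\<lambda>h. (\<Sum>m\<in>UNIV. h $ m *\<^sub>R partial_deriv m G (z + ?b)) - (\<Sum>m\<in>UNIV. h $ m *\<^sub>R partial_deriv m G z)
            - (\<Sum>l\<in>UNIV. ?b $ l * (\<Sum>m\<in>UNIV. h $ m *\<^sub>R partial_deriv m (partial_deriv l G) z)))) (at z)"
          by (intro has_derivative_diff g g1 has_derivative_sum has_derivative_mult_right g2)
        moreover have "(\<Sum>m\<in>UNIV. h $ m *\<^sub>R partial_deriv m G (z + ?b)) - (\<Sum>m\<in>UNIV. h $ m *\<^sub>R partial_deriv m G z)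
            - (\<Sum>l\<in>UNIV. ?b $ l * (\<Sum>m\<in>UNIV. h $ m *\<^sub>R partial_deriv m (partial_deriv l G) z))
            = (\<Sum>m\<in>UNIV. h $ m *\<^sub>R ?D m)" for h
        proof -
          have "(\<Sum>l\<in>UNIV. ?b $ l * (\<Sum>m\<in>UNIV. h $ m *\<^sub>R partial_deriv m (partial_deriv l G) z))
             = (\<Sum>m\<in>UNIV. h $ m * (\<Sum>l\<in>UNIV. ?b $ l * partial_deriv m (partial_deriv l G) z))"
            unfolding sum_distrib_left by (subst sum.swap) (simp add: mult_ac)
          then show ?thesis by (simp add: right_diff_distrib sum_subtractf)
        qed
        ultimately have "(?p has_derivative (\<lambda>h. \<Sum>m\<in>UNIV. h $ m *\<^sub>R ?D m)) (at z)" by simp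
        then show "(?p has_derivative (\<lambda>h. \<Sum>m\<in>UNIV. h $ m *\<^sub>R ?D m)) (at z within cball 0 M)"
          by (rule has_derivative_at_withinI)
        show "onorm (\<lambda>h. \<Sum>m\<in>UNIV. h $ m *\<^sub>R ?D m) \<le> ?K * (e' * \<mu>)"
        proof (rule onorm_partials_le)
          fix m
          have "(\<Sum>l\<in>UNIV. ?b $ l * partial_deriv m (partial_deriv l G) z)
              = (\<Sum>l\<in>UNIV. (z + ?b - z) $ l * partial_deriv l (partial_deriv m G) z)"
            by (intro sum.cong refl arg_cong2[where f = "(*)"] Schwarz_partial_deriv[OF open_UNIV C2]) auto
          then have "\<bar>?D m\<bar> \<le> e' * norm ?b"
            using lin1[rule_format, of z "z + ?b" m z] z wn[OF y] \<mu> d(1) d(3)[of m]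
            by simp
          also have "\<dots> \<le> e' * \<mu>" using wn[OF y] e' by (intro mult_left_mono) auto
          finally show "norm (?D m) \<le> e' * \<mu>" by simp
        qed
      qed (use vn x y in auto)
      have "(G (v x + w x) - G (v x) - (\<Sum>l\<in>UNIV. w x $ l * partial_deriv l G (v x)))
        - (G (v y + w y) - G (v y) - (\<Sum>l\<in>UNIV. w y $ l * partial_deriv l G (v y)))
        = (G (v x + w x) - G (v x + ?b) - (\<Sum>l\<in>UNIV. (w x - ?b) $ l * partial_deriv l G (v x)))
          + (?p (v x) - ?p (v y))"
        by (simp add: sum_subtractf algebra_simps)
      also have "norm \<dots> \<le> e' * norm (w x - ?b) + ?K * (e' * \<mu>) * norm (v x - v y)"
        by (rule norm_triangle_mono) (use 1 2 in auto)
      also have "\<dots> \<le> e' * (\<mu> * dist x y powr \<beta>) + ?K * (e' * \<mu>) * (M * dist x y powr \<beta>)"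
        using holder_boundD(2)[OF v x y] holder_boundD(2)[OF w x y] e' \<mu>0
        by (intro add_mono mult_left_mono) auto
      also have "\<dots> = (e' * (1 + ?K * M)) * \<mu> * dist x y powr \<beta>" by (simp add: algebra_simps)
      also have "\<dots> = e * \<mu> * dist x y powr \<beta>" by (simp add: e')
      finally show "norm ((G (v x + w x) - G (v x) - (\<Sum>l\<in>UNIV. w x $ l * partial_deriv l G (v x)))
        - (G (v y + w y) - G (v y) - (\<Sum>l\<in>UNIV. w y $ l * partial_deriv l G (v y)))) \<le> e * \<mu> * dist x y powr \<beta>" .
    qed
  qed
qed

lemma gradient_comp_holder_bound:
  fixes F :: "real^'k::finite \<Rightarrow> real" and v :: "'a::metric_space \<Rightarrow> real^'k"
  assumes C2: "Ck_on 2 UNIV F" and v: "holder_bound \<beta> S M v" and M: "0 \<le> M"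
  shows "\<exists>N. holder_bound \<beta> S N (\<lambda>x. gradient F (v x))"
proof -
  have "Ck_on (Suc 0) UNIV (partial_deriv k F)" for k
    by (rule Ck_on_partial) (rule C2[unfolded numeral_2_eq_2])
  then have "\<exists>N. holder_bound \<beta> S N (\<lambda>x. gradient F (v x) $ k)" for k
    unfolding gradient_component by (rule C1_comp_holder_bound[OF _ M v])
  then obtain N where "\<And>k. holder_bound \<beta> S (N k) (\<lambda>x. gradient F (v x) $ k)" by metis
  from holder_bound_vec[OF this] show ?thesis by blast
qed

text \<open>The remainder of the expansion of \<open>\<nabla>F\<close> for a direction \<open>w - r\<close> that agrees with the true
  increment \<open>w\<close> only up to an error \<open>r\<close>; the error enters through the Hessian, hence with a fixed
  factor \<open>N\<close>. Since \<open>\<nabla>F\<close> has to be of class \<open>C\<^sup>2\<close>, three derivatives of \<open>F\<close> are required.\<close>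

lemma gradient_superposition:
  fixes F :: "real^'k::finite \<Rightarrow> real" and S :: "'a::metric_space set"
  assumes C3: "Ck_on 3 UNIV F" and M: "0 \<le> M" and S: "S \<noteq> {}" and v: "holder_bound \<beta> S M v"
  shows "\<exists>N\<ge>0. \<forall>e>0. \<exists>d>0. \<forall>w r \<mu> \<eta>. holder_bound \<beta> S \<mu> w \<and> \<mu> \<le> d \<and> holder_bound \<beta> S \<eta> r \<longrightarrow>
    holder_bound \<beta> S (e * \<mu> + N * \<eta>)
      (\<lambda>x. gradient F (v x + w x) - (gradient F (v x) + hessian F (v x) *v (w x - r x)))"
proof -
  let ?G = "\<lambda>k. partial_deriv k F"
  have C3': "Ck_on (Suc 2) UNIV F" using C3 by (simp add: numeral_3_eq_3 numeral_2_eq_2)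
  have C2: "Ck_on 2 UNIV F" using C3' Ck_on_mono by fastforce
  have G2: "Ck_on 2 UNIV (?G k)" for k by (rule Ck_on_partial[OF C3'])
  have G1: "Ck_on (Suc 0) UNIV (partial_deriv l (?G k))" for k l
    by (rule Ck_on_partial) (rule G2[unfolded numeral_2_eq_2])
  define n where "n = (\<lambda>k l. SOME N. holder_bound \<beta> S N (\<lambda>x. partial_deriv l (?G k) (v x)))"
  have n: "holder_bound \<beta> S (n k l) (\<lambda>x. partial_deriv l (?G k) (v x))" for k l
    unfolding n_def by (rule someI_ex) (rule C1_comp_holder_bound[OF G1 M v])
  define N where "N = (\<Sum>k\<in>(UNIV::'k set). \<Sum>l\<in>(UNIV::'k set). 2 * n k l)"
  have n0: "n k l \<ge> 0" for k l using holder_bound_nonneg[OF n S] .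
  have N: "N \<ge> 0" unfolding N_def using n0 by (intro sum_nonneg) auto
  have "\<exists>d>0. \<forall>w r \<mu> \<eta>. holder_bound \<beta> S \<mu> w \<and> \<mu> \<le> d \<and> holder_bound \<beta> S \<eta> r \<longrightarrow>
    holder_bound \<beta> S (e * \<mu> + N * \<eta>)
      (\<lambda>x. gradient F (v x + w x) - (gradient F (v x) + hessian F (v x) *v (w x - r x)))" if e: "e > 0" for e
  proof -
    define e' where "e' = e / real CARD('k)"
    have e': "e' > 0" using e by (simp add: e'_def)
    have "\<forall>k. \<exists>d>0. \<forall>w \<mu>. holder_bound \<beta> S \<mu> w \<and> \<mu> \<le> d \<longrightarrow>
      holder_bound \<beta> S (e' * \<mu>) (\<lambda>x. ?G k (v x + w x) - ?G k (v x) - (\<Sum>l\<in>UNIV. w x $ l * partial_deriv l (?G k) (v x)))"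
      by (intro allI superposition_remainder[OF G2 M e' v])
    then obtain d where d: "\<forall>k. d k > 0 \<and> (\<forall>w \<mu>. holder_bound \<beta> S \<mu> w \<and> \<mu> \<le> d k \<longrightarrow>
      holder_bound \<beta> S (e' * \<mu>) (\<lambda>x. ?G k (v x + w x) - ?G k (v x) - (\<Sum>l\<in>UNIV. w x $ l * partial_deriv l (?G k) (v x))))"
      by (elim choice[THEN exE]) (rule that)
    define d0 where "d0 = Min (range d)"
    have d0: "d0 > 0" "\<And>k. d0 \<le> d k" using d by (auto simp: d0_def)
    show ?thesis
    proof (intro exI[of _ d0] conjI d0(1) allI impI)
      fix w r :: "'a \<Rightarrow> real^'k" and \<mu> \<eta>
      assume A: "holder_bound \<beta> S \<mu> w \<and> \<mu> \<le> d0 \<and> holder_bound \<beta> S \<eta> r"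
      have "holder_bound \<beta> S (e' * \<mu> + (\<Sum>l\<in>UNIV. 2 * (n k l * \<eta>)))
          (\<lambda>x. (gradient F (v x + w x) - (gradient F (v x) + hessian F (v x) *v (w x - r x))) $ k)" for k
      proof -
        have "\<mu> \<le> d k" using A d0(2)[of k] by linarith
        then have 1: "holder_bound \<beta> S (e' * \<mu>) (\<lambda>x. ?G k (v x + w x) - ?G k (v x) - (\<Sum>l\<in>UNIV. w x $ l * partial_deriv l (?G k) (v x)))"
          using d A by blast
        have 2: "holder_bound \<beta> S (\<Sum>l\<in>UNIV. 2 * (n k l * \<eta>)) (\<lambda>x. \<Sum>l\<in>UNIV. partial_deriv l (?G k) (v x) * r x $ l)"
          using A by (intro holder_bound_sum holder_bound_mult n holder_bound_nth) auto
        show ?thesis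
          by (rule holder_bound_cong[OF holder_bound_add[OF 1 2]])
             (simp add: gradient_component matrix_vector_mult_def hessian_component[OF C2]
               right_diff_distrib sum_subtractf mult.commute)
      qed
      from holder_bound_vec[OF this]
      have "holder_bound \<beta> S (\<Sum>k\<in>(UNIV::'k set). e' * \<mu> + (\<Sum>l\<in>UNIV. 2 * (n k l * \<eta>)))
        (\<lambda>x. gradient F (v x + w x) - (gradient F (v x) + hessian F (v x) *v (w x - r x)))" .
      moreover have "(\<Sum>k\<in>(UNIV::'k set). e' * \<mu> + (\<Sum>l\<in>UNIV. 2 * (n k l * \<eta>))) = e * \<mu> + N * \<eta>"
        by (simp add: sum.distrib N_def sum_distrib_right e'_def mult.assoc)
      ultimately show "holder_bound \<beta> S (e * \<mu> + N * \<eta>)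
        (\<lambda>x. gradient F (v x + w x) - (gradient F (v x) + hessian F (v x) *v (w x - r x)))" by simp
    qed
  qed
  then show ?thesis using N by blast
qed

section \<open>The maximum principle and uniqueness for the linearized problem\<close>

text \<open>Along a line a convex function lies above its tangent, whereas \<open>F\<close> grows at most like the
  maximum of the coordinates. That maximum does not increase in the direction \<open>- e\<^sub>k\<close>, and it changes
  with speed exactly one, forwards and backwards, in the direction \<open>(1, \<dots>, 1)\<close>.\<close>

lemma gradient_in_simplex:
  fixes F :: "real^'k::finite \<Rightarrow> real"
  assumes conv: "convex_on UNIV F" and C1: "Ck_on (Suc 0) UNIV F"
    and growth: "\<And>x m. (\<And>k. x $ k \<le> m) \<Longrightarrow> F x \<le> m + C"
  shows "0 \<le> gradient F x $ k" and "(\<Sum>k\<in>UNIV. gradient F x $ k) = 1"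
proof -
  have tangent: "F x + t * (\<Sum>k\<in>UNIV. d $ k * gradient F x $ k) \<le> F (x + t *\<^sub>R d)" for t d
  proof -
    let ?q = "\<lambda>t. F (x + t *\<^sub>R d)" and ?m = "\<Sum>k\<in>UNIV. d $ k * gradient F x $ k"
    have cq: "convex_on UNIV ?q"
    proof (rule convex_onI)
      fix t a b :: real assume "0 < t" "t < 1"
      then have "F ((1 - t) *\<^sub>R (x + a *\<^sub>R d) + t *\<^sub>R (x + b *\<^sub>R d)) \<le> (1 - t) * F (x + a *\<^sub>R d) + t * F (x + b *\<^sub>R d)"
        by (intro convex_onD[OF conv]) auto
      moreover have "(1 - t) *\<^sub>R (x + a *\<^sub>R d) + t *\<^sub>R (x + b *\<^sub>R d) = x + ((1 - t) *\<^sub>R a + t *\<^sub>R b) *\<^sub>R d"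
        by (simp add: algebra_simps)
      ultimately show "F (x + ((1 - t) *\<^sub>R a + t *\<^sub>R b) *\<^sub>R d) \<le> (1 - t) * F (x + a *\<^sub>R d) + t * F (x + b *\<^sub>R d)"
        by simp
    qed auto
    have "(F has_derivative (\<lambda>h. \<Sum>k\<in>UNIV. h $ k *\<^sub>R partial_deriv k F (x + 0 *\<^sub>R d))) (at (x + 0 *\<^sub>R d))"
      using C1_has_derivative[OF open_UNIV C1] by simp
    moreover have "((\<lambda>t. x + t *\<^sub>R d) has_derivative (\<lambda>h. h *\<^sub>R d)) (at 0)"
      by (auto intro!: derivative_eq_intros)
    ultimately have "(?q has_derivative (\<lambda>h. \<Sum>k\<in>UNIV. (h *\<^sub>R d) $ k *\<^sub>R partial_deriv k F (x + 0 *\<^sub>R d))) (at 0)"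
      using has_derivative_compose by blast
    moreover have "(\<lambda>h. \<Sum>k\<in>UNIV. (h *\<^sub>R d) $ k *\<^sub>R partial_deriv k F (x + 0 *\<^sub>R d)) = (*) ?m"
      by (auto simp: fun_eq_iff gradient_def multi_deriv_single sum_distrib_left mult_ac)
    ultimately have "(?q has_real_derivative ?m) (at 0)"
      by (simp add: has_field_derivative_def)
    then have "?q t - ?q 0 \<ge> ?m * (t - 0)"
      by (intro convex_on_imp_above_tangent[OF cq]) auto
    then show ?thesis by (simp add: mult.commute)
  qed
  define m where "m = Max (range (\<lambda>k. x $ k))"
  have m: "x $ k \<le> m" for k by (simp add: m_def)
  define B where "B = m + C - F x"
  have B: "B \<ge> 0" using growth[of x m] m by (simp add: B_def)
  show "0 \<le> gradient F x $ k"
  proof (rule ccontr)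
    assume "\<not> ?thesis"
    then have neg: "gradient F x $ k < 0" by simp
    define t where "t = (B + 1) / - gradient F x $ k"
    have t: "t \<ge> 0" "t * gradient F x $ k = - (B + 1)" using neg B by (auto simp: t_def field_simps)
    have "(\<Sum>j\<in>UNIV. (- axis k 1 :: real^'k) $ j * gradient F x $ j) = - gradient F x $ k"
      by (simp add: axis_def sum_negf if_distrib[of "\<lambda>c. c * _"] if_distrib[of uminus] cong: if_cong)
    then have "F x + t * (- gradient F x $ k) \<le> F (x + t *\<^sub>R (- axis k 1))"
      using tangent[of t "- axis k 1"] by simp
    also have "\<dots> \<le> m + C"
    proof (rule growth)
      fix j
      show "(x + t *\<^sub>R (- axis k 1)) $ j \<le> m" using m[of j] t(1) by (auto simp: axis_def)
    qed
    finally show False using t(2) by (simp add: B_def)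
  qed
  show "(\<Sum>k\<in>UNIV. gradient F x $ k) = 1"
  proof (rule ccontr)
    let ?s = "\<Sum>k\<in>UNIV. gradient F x $ k"
    assume ne: "?s \<noteq> 1"
    define t where "t = (B + 1) / (?s - 1)"
    have t: "t * (?s - 1) = B + 1" using ne by (simp add: t_def)
    have "F x + t * ?s \<le> F (x + t *\<^sub>R (\<chi> i. 1))"
      using tangent[of t "\<chi> i. 1"] by simp
    also have "\<dots> \<le> (m + t) + C" by (rule growth) (use m in auto)
    finally show False using t by (simp add: B_def algebra_simps)
  qed
qed

lemma H_eps_simplex:
  fixes H :: "real^'k::finite \<Rightarrow> real"
  assumes H2: "H2 H c0 \<rho>" and \<epsilon>: "\<epsilon> > 0"
  shows "0 \<le> gradient (H_eps H \<epsilon>) x $ k" "(\<Sum>k\<in>UNIV. gradient (H_eps H \<epsilon>) x $ k) = 1"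
proof -
  have conv: "convex_on UNIV (H_eps H \<epsilon>)"
  proof (rule convex_onI)
    fix t :: real and x y :: "real^'k" assume t: "0 < t" "t < 1"
    have "H ((1 - t) *\<^sub>R ((1 / \<epsilon>) *\<^sub>R x) + t *\<^sub>R ((1 / \<epsilon>) *\<^sub>R y))
        \<le> (1 - t) * H ((1 / \<epsilon>) *\<^sub>R x) + t * H ((1 / \<epsilon>) *\<^sub>R y)"
      using H2 t unfolding H2_def by (intro convex_onD[of UNIV H]) auto
    moreover have "(1 / \<epsilon>) *\<^sub>R ((1 - t) *\<^sub>R x + t *\<^sub>R y) = (1 - t) *\<^sub>R ((1 / \<epsilon>) *\<^sub>R x) + t *\<^sub>R ((1 / \<epsilon>) *\<^sub>R y)"
      by (simp add: scaleR_add_right)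
    ultimately have "H ((1 / \<epsilon>) *\<^sub>R ((1 - t) *\<^sub>R x + t *\<^sub>R y))
        \<le> (1 - t) * H ((1 / \<epsilon>) *\<^sub>R x) + t * H ((1 / \<epsilon>) *\<^sub>R y)"
      by (simp only:)
    from mult_left_mono[OF this, of \<epsilon>]
    show "H_eps H \<epsilon> ((1 - t) *\<^sub>R x + t *\<^sub>R y) \<le> (1 - t) * H_eps H \<epsilon> x + t * H_eps H \<epsilon> y"
      unfolding H_eps_def using \<epsilon> by (simp only: distrib_left mult.left_commute less_imp_le)
  qed auto
  have "Ck_on 2 UNIV H" using H2 by (simp add: H2_def)
  then have "Ck_on (Suc 0) UNIV H" by (rule Ck_on_mono) simp
  then have C1: "Ck_on (Suc 0) UNIV (H_eps H \<epsilon>)"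
    unfolding H_eps_def by (rule Ck_on_scaled)
  have growth: "H_eps H \<epsilon> x \<le> m + \<epsilon> * c0" if m: "\<And>k. x $ k \<le> m" for x m
  proof -
    have "Max (range (\<lambda>k. ((1 / \<epsilon>) *\<^sub>R x) $ k)) \<le> m / \<epsilon>"
      using m \<epsilon> by (auto simp: divide_right_mono)
    moreover have "H ((1 / \<epsilon>) *\<^sub>R x) - c0 \<le> Max (range (\<lambda>k. ((1 / \<epsilon>) *\<^sub>R x) $ k))"
      using H2 unfolding H2_def by blast
    ultimately have "H ((1 / \<epsilon>) *\<^sub>R x) \<le> m / \<epsilon> + c0" by linarith
    from mult_left_mono[OF this, of \<epsilon>] show ?thesis using \<epsilon> by (simp add: H_eps_def algebra_simps)
  qed
  show "0 \<le> gradient (H_eps H \<epsilon>) x $ k" "(\<Sum>k\<in>UNIV. gradient (H_eps H \<epsilon>) x $ k) = 1"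
    using gradient_in_simplex[OF conv C1 growth] by auto
qed

lemma second_derivative_at_local_max:
  fixes h h' :: "real \<Rightarrow> real"
  assumes d: "d > 0" and max: "\<And>t. \<bar>t\<bar> < d \<Longrightarrow> h t \<le> h 0"
    and h': "\<And>t. \<bar>t\<bar> < d \<Longrightarrow> (h has_real_derivative h' t) (at t)"
    and h'': "(h' has_real_derivative D) (at 0)"
  shows "h' 0 = 0" "D \<le> 0"
proof -
  show 0: "h' 0 = 0"
    by (rule DERIV_local_max[OF h'[of 0] d]) (use max d in auto)
  show "D \<le> 0"
  proof (rule ccontr)
    assume "\<not> ?thesis"
    then obtain e where e: "e > 0" "\<And>t. 0 < t \<Longrightarrow> t < e \<Longrightarrow> h' 0 < h' (0 + t)"
      using DERIV_pos_inc_right[OF h''] by auto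
    define t where "t = min d e / 2"
    have t: "0 < t" "t < d" "t < e" using d e by (auto simp: t_def)
    obtain z where z: "0 < z" "z < t" "h t - h 0 = (t - 0) * h' z"
      using MVT2[OF t(1), of h h'] h' t by auto
    then have "h t - h 0 > 0" using e(2)[of z] t 0 by simp
    then show False using max[of t] t by simp
  qed
qed

text \<open>The weak maximum principle for subsolutions of class \<open>C\<^sup>2\<close> that are continuous up to the
  boundary. A small multiple of \<open>exp (\<alpha> x\<^sub>d\<^sub>i\<^sub>r)\<close> is added to \<open>v\<close>; for large \<open>\<alpha>\<close> the first and
  second order part of the operator is strictly positive on the sum wherever \<open>v\<close> is positive, which
  contradicts the first and second order conditions at an interior maximum. Positive semidefiniteness of \<open>A\<close> is stated as the inequality that is
  needed there, so that for \<open>A = \<sigma>\<sigma>\<^sup>T\<close> no spectral theory is involved.\<close>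

lemma weak_maximum_principle:
  fixes U :: "(real^'n::finite) set" and v :: "real^'n \<Rightarrow> real" and dir :: 'n
  assumes U: "open U" "bounded U"
    and v: "continuous_on (closure U) v" "Ck_on 2 U v" and bd: "\<And>x. x \<in> frontier U \<Longrightarrow> v x \<le> 0"
    and psd: "\<And>x B. x \<in> U \<Longrightarrow> (\<And>s. (\<Sum>i\<in>UNIV. \<Sum>j\<in>UNIV. s i * s j * B i j) \<le> 0) \<Longrightarrow>
                (\<Sum>i\<in>UNIV. \<Sum>j\<in>UNIV. A x i j * B i j) \<le> 0"
    and ell: "\<And>x. x \<in> U \<Longrightarrow> \<nu> \<le> A x dir dir" and \<nu>: "\<nu> > 0"
    and b: "\<And>x. x \<in> U \<Longrightarrow> \<bar>b x dir\<bar> \<le> K" and c: "\<And>x. x \<in> U \<Longrightarrow> 0 \<le> c x"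
    and sub: "\<And>x. x \<in> U \<Longrightarrow> 0 \<le> (\<Sum>i\<in>UNIV. \<Sum>j\<in>UNIV. A x i j * partial_deriv i (partial_deriv j v) x)
       + (\<Sum>i\<in>UNIV. b x i * partial_deriv i v x) - c x * v x"
    and x0: "x0 \<in> closure U"
  shows "v x0 \<le> 0"
proof (rule ccontr)
  assume "\<not> ?thesis"
  then have pos: "v x0 > 0" by simp
  \<comment> \<open>The barrier grows so fast in one direction that its second derivative dominates the drift.\<close>
  define \<alpha> where "\<alpha> = \<bar>K\<bar> / \<nu> + 1"
  have "\<alpha> * \<nu> = \<bar>K\<bar> + \<nu>" using \<nu> by (simp add: \<alpha>_def distrib_right)
  then have \<alpha>: "\<alpha> > 0" "\<alpha> * \<nu> > K" using \<nu> by (auto simp: \<alpha>_def add_nonneg_pos)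
  define E where "E = (\<lambda>x::real^'n. exp (\<alpha> * x $ dir))"
  have comp: "compact (closure U)" using U by (simp add: compact_closure)
  have ne: "closure U \<noteq> {}" using x0 by auto
  have cE: "continuous_on (closure U) E" unfolding E_def by (intro continuous_intros)
  obtain xm where xm: "\<And>x. x \<in> closure U \<Longrightarrow> E x \<le> E xm"
    using continuous_attains_sup[OF comp ne cE] by blast
  \<comment> \<open>So small that the perturbed function can only be maximal where \<open>v\<close> is positive.\<close>
  define \<eta> where "\<eta> = v x0 / (2 * E xm)"
  have \<eta>: "\<eta> > 0" "\<eta> * E xm = v x0 / 2" using pos by (auto simp: \<eta>_def E_def)
  have "continuous_on (closure U) (\<lambda>x. v x + \<eta> * E x)" by (intro continuous_intros v(1) cE)
  then obtain x1 where x1: "x1 \<in> closure U"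
    and max: "\<And>x. x \<in> closure U \<Longrightarrow> v x + \<eta> * E x \<le> v x1 + \<eta> * E x1"
    using continuous_attains_sup[OF comp ne] by blast
  have "\<eta> * E x1 \<le> v x0 / 2" using xm[OF x1] \<eta> by (metis less_imp_le mult_left_mono)
  moreover have "0 < \<eta> * E x0" using \<eta> by (simp add: E_def)
  ultimately have v1: "v x1 > 0" using max[OF x0] pos by linarith
  then have x1U: "x1 \<in> U" using bd[of x1] x1 U by (auto simp: frontier_def interior_open)
  then obtain r where r: "r > 0" "ball x1 r \<subseteq> U" using U openE by blast
  have C2: "Ck_on (Suc (Suc 0)) U v" using v(2) by (simp add: numeral_2_eq_2)
  have C1: "Ck_on (Suc 0) U v" using C2 Ck_on_mono by fastforce
  have along: "(\<Sum>i\<in>UNIV. s $ i * partial_deriv i v x1) + \<eta> * (\<alpha> * s $ dir * E x1) = 0"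
    "(\<Sum>i\<in>UNIV. s $ i * (\<Sum>j\<in>UNIV. s $ j * partial_deriv j (partial_deriv i v) x1)) + \<eta> * (\<alpha> * s $ dir * (\<alpha> * s $ dir * E x1)) \<le> 0" for s :: "real^'n"
  proof -
    define d where "d = r / (norm s + 1)"
    have n1: "norm s + 1 > 0" by (simp add: add_nonneg_pos)
    have d: "d > 0" using r n1 by (simp add: d_def)
    let ?p = "\<lambda>t::real. x1 + t *\<^sub>R s"
    have inU: "?p t \<in> U" if "\<bar>t\<bar> < d" for t
    proof -
      have "\<bar>t\<bar> * norm s \<le> \<bar>t\<bar> * (norm s + 1)" by (intro mult_left_mono) auto
      also have "\<dots> < d * (norm s + 1)" using that n1 by (intro mult_strict_right_mono) auto
      also have "\<dots> = r" using n1 by (simp add: d_def)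
      finally have "?p t \<in> ball x1 r" by (simp add: dist_norm)
      then show ?thesis using r by blast
    qed
    have p: "(?p has_derivative (\<lambda>h. h *\<^sub>R s)) (at t)" for t by (auto intro!: derivative_eq_intros)
    have chain: "((\<lambda>t. f (?p t)) has_real_derivative (\<Sum>i\<in>UNIV. s $ i * partial_deriv i f (?p t))) (at t)"
      if f: "Ck_on (Suc 0) U f" and t: "\<bar>t\<bar> < d" for f :: "real^'n \<Rightarrow> real" and t
    proof -
      have "((\<lambda>t. f (?p t)) has_derivative (\<lambda>h. \<Sum>i\<in>UNIV. (h *\<^sub>R s) $ i *\<^sub>R partial_deriv i f (?p t))) (at t)"
        by (rule has_derivative_compose[OF p C1_has_derivative[OF U(1) f inU[OF t]]])
      moreover have "(\<lambda>h. \<Sum>i\<in>UNIV. (h *\<^sub>R s) $ i *\<^sub>R partial_deriv i f (?p t)) = (*) (\<Sum>i\<in>UNIV. s $ i * partial_deriv i f (?p t))"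
        by (auto simp: fun_eq_iff sum_distrib_left mult_ac)
      ultimately show ?thesis by (simp add: has_field_derivative_def)
    qed
    have dE: "((\<lambda>t. E (?p t)) has_real_derivative (\<alpha> * s $ dir * E (?p t))) (at t)" for t
      unfolding E_def by (auto intro!: derivative_eq_intros simp: algebra_simps)
    let ?h = "\<lambda>t. v (?p t) + \<eta> * E (?p t)"
    let ?h' = "\<lambda>t. (\<Sum>i\<in>UNIV. s $ i * partial_deriv i v (?p t)) + \<eta> * (\<alpha> * s $ dir * E (?p t))"
    let ?D = "(\<Sum>i\<in>UNIV. s $ i * (\<Sum>j\<in>UNIV. s $ j * partial_deriv j (partial_deriv i v) (?p 0))) + \<eta> * (\<alpha> * s $ dir * (\<alpha> * s $ dir * E (?p 0)))"
    have 1: "?h t \<le> ?h 0" if "\<bar>t\<bar> < d" for t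
      using max[of "?p t"] inU[OF that] closure_subset by auto
    have 2: "(?h has_real_derivative ?h' t) (at t)" if "\<bar>t\<bar> < d" for t
      by (intro DERIV_add DERIV_cmult chain[OF C1 that] dE)
    have 3: "(?h' has_real_derivative ?D) (at 0)"
      by (intro DERIV_add DERIV_sum DERIV_cmult chain[OF Ck_on_partial[OF C2]] dE) (use d in auto)
    show "(\<Sum>i\<in>UNIV. s $ i * partial_deriv i v x1) + \<eta> * (\<alpha> * s $ dir * E x1) = 0"
      "(\<Sum>i\<in>UNIV. s $ i * (\<Sum>j\<in>UNIV. s $ j * partial_deriv j (partial_deriv i v) x1)) + \<eta> * (\<alpha> * s $ dir * (\<alpha> * s $ dir * E x1)) \<le> 0"
      using second_derivative_at_local_max[OF d 1 2 3] by auto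
  qed
  have grad: "partial_deriv i v x1 = - (if i = dir then \<eta> * \<alpha> * E x1 else 0)" for i
    using along(1)[of "axis i 1"]
    by (auto simp: axis_def if_distrib[of "\<lambda>c. c * _"] cong: if_cong split: if_splits)
  let ?B = "\<lambda>i j. partial_deriv i (partial_deriv j v) x1 + (if i = dir \<and> j = dir then \<eta> * \<alpha>\<^sup>2 * E x1 else 0)"
  have delta: "(\<Sum>i\<in>UNIV. \<Sum>j\<in>UNIV. f i j * (if i = dir \<and> j = dir then a else 0)) = f dir dir * (a::real)" for f a
  proof -
    have "(\<Sum>i\<in>UNIV. \<Sum>j\<in>UNIV. f i j * (if i = dir \<and> j = dir then a else 0))
        = (\<Sum>i\<in>UNIV. if i = dir then f i dir * a else 0)"
      by (intro sum.cong refl) (auto simp: if_distrib[of "\<lambda>c. _ * c"] cong: if_cong)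
    then show ?thesis by simp
  qed
  have "(\<Sum>i\<in>UNIV. \<Sum>j\<in>UNIV. A x1 i j * ?B i j) \<le> 0"
  proof (rule psd[OF x1U])
    fix s :: "'n \<Rightarrow> real"
    have "(\<Sum>i\<in>UNIV. \<Sum>j\<in>UNIV. s i * s j * ?B i j)
       = (\<Sum>i\<in>UNIV. \<Sum>j\<in>UNIV. s i * s j * partial_deriv i (partial_deriv j v) x1) + s dir * s dir * (\<eta> * \<alpha>\<^sup>2 * E x1)"
      by (simp add: distrib_left sum.distrib delta)
    also have "(\<Sum>i\<in>UNIV. \<Sum>j\<in>UNIV. s i * s j * partial_deriv i (partial_deriv j v) x1)
        = (\<Sum>i\<in>UNIV. s i * (\<Sum>j\<in>UNIV. s j * partial_deriv j (partial_deriv i v) x1))"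
      unfolding sum_distrib_left
      by (intro sum.cong refl) (simp add: mult.assoc Schwarz_partial_deriv[OF U(1) v(2) x1U])
    also have "\<dots> + s dir * s dir * (\<eta> * \<alpha>\<^sup>2 * E x1) \<le> 0"
      using along(2)[of "\<chi> i. s i"] by (simp add: power2_eq_square mult_ac)
    finally show "(\<Sum>i\<in>UNIV. \<Sum>j\<in>UNIV. s i * s j * ?B i j) \<le> 0" .
  qed
  then have 2: "(\<Sum>i\<in>UNIV. \<Sum>j\<in>UNIV. A x1 i j * partial_deriv i (partial_deriv j v) x1) \<le> - (A x1 dir dir * (\<eta> * \<alpha>\<^sup>2 * E x1))"
    by (simp add: distrib_left sum.distrib delta)
  have 1: "(\<Sum>i\<in>UNIV. b x1 i * partial_deriv i v x1) = - (b x1 dir * (\<eta> * \<alpha> * E x1))"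
    by (simp add: grad if_distrib[of "\<lambda>c. _ * c"] sum_negf cong: if_cong)
  let ?e = "\<eta> * \<alpha> * E x1"
  have e: "?e > 0" using \<eta> \<alpha> by (simp add: E_def)
  have "A x1 dir dir * (\<eta> * \<alpha>\<^sup>2 * E x1) = (\<alpha> * A x1 dir dir) * ?e" by (simp add: power2_eq_square mult_ac)
  moreover have "(\<alpha> * \<nu>) * ?e \<le> (\<alpha> * A x1 dir dir) * ?e"
    using ell[OF x1U] \<alpha> e by (intro mult_right_mono mult_left_mono) auto
  moreover have "- (b x1 dir * ?e) \<le> K * ?e"
    using b[OF x1U] e mult_right_mono[of "- b x1 dir" K ?e] by auto
  moreover have "K * ?e < (\<alpha> * \<nu>) * ?e" using \<alpha> e by (intro mult_strict_right_mono) auto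
  moreover have "0 \<le> c x1 * v x1" using c[OF x1U] v1 by simp
  ultimately show False using sub[OF x1U] 1 2 by linarith
qed

lemma matrix_transpose_component:
  "(s ** transpose s) $ i $ j = (\<Sum>m\<in>UNIV. s $ i $ m * s $ j $ m)" for s :: "real^'n^'n"
  by (simp add: matrix_matrix_mult_def transpose_def)

lemma square_matrix_psd:
  fixes s :: "real^'n^'n::finite" and B :: "'n \<Rightarrow> 'n \<Rightarrow> real"
  assumes B: "\<And>s. (\<Sum>i\<in>UNIV. \<Sum>j\<in>UNIV. s i * s j * B i j) \<le> 0"
  shows "(\<Sum>i\<in>UNIV. \<Sum>j\<in>UNIV. (s ** transpose s) $ i $ j * B i j) \<le> 0"
proof -
  have "(\<Sum>i\<in>UNIV. \<Sum>j\<in>UNIV. (s ** transpose s) $ i $ j * B i j)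
      = (\<Sum>i\<in>UNIV. \<Sum>j\<in>UNIV. \<Sum>m\<in>UNIV. s $ i $ m * s $ j $ m * B i j)"
    by (simp add: matrix_transpose_component sum_distrib_right)
  also have "\<dots> = (\<Sum>i\<in>UNIV. \<Sum>m\<in>UNIV. \<Sum>j\<in>UNIV. s $ i $ m * s $ j $ m * B i j)"
    by (intro sum.cong refl sum.swap)
  also have "\<dots> = (\<Sum>m\<in>UNIV. \<Sum>i\<in>UNIV. \<Sum>j\<in>UNIV. s $ i $ m * s $ j $ m * B i j)"
    by (rule sum.swap)
  also have "\<dots> \<le> 0" by (rule sum_nonpos) (rule B)
  finally show ?thesis .
qed

text \<open>Since \<open>\<nabla>H\<^sub>\<epsilon>\<close> lies in the simplex, \<open>\<lambda>\<^sup>T L\<close> is a convex combination of the operators \<open>L\<^sub>k\<close> and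
  inherits uniform ellipticity, the bound on the drift and the sign of the zeroth-order term. The
  weak maximum principle applies to the difference of two solutions.\<close>

lemma linearized_solution_le:
  fixes U :: "(real^'n::finite) set" and \<sigma> :: "real^'n \<Rightarrow> 'a \<Rightarrow> real^'n^'n" and a :: "'k::finite \<Rightarrow> 'a"
  assumes H1: "H1 U A a \<nu> \<Lambda> \<theta> b \<sigma> c f g" and H2: "H2 H c0 \<rho>" and \<epsilon>: "\<epsilon> > 0"
    and w: "linearized_solution U H \<epsilon> (base_coeffs a b \<sigma> c f g) u \<delta>\<tau> w1"
      "linearized_solution U H \<epsilon> (base_coeffs a b \<sigma> c f g) u \<delta>\<tau> w2"
    and x: "x \<in> closure U"
  shows "w1 x \<le> w2 x"
proof -
  let ?\<tau> = "base_coeffs a b \<sigma> c f g"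
  define \<l> where "\<l> = feedback_control U H \<epsilon> ?\<tau> u"
  have U: "open U" "bounded U" "U \<noteq> {}" "\<nu> > 0" using H1 by (auto simp: H1_def)
  have l0: "0 \<le> \<l> x $ k" and l1: "(\<Sum>k\<in>UNIV. \<l> x $ k) = 1" for x k
    using H_eps_simplex[OF H2 \<epsilon>] by (simp_all add: \<l>_def feedback_control_def)
  have W: "continuous_on (closure U) w1" "Ck_on 2 U w1" "continuous_on (closure U) w2" "Ck_on 2 U w2"
    using w by (auto simp: linearized_solution_def)
  define v where "v = (\<lambda>x. 1 * w1 x + (-1) * w2 x)"
  have v2: "Ck_on 2 U v" using Ck_on_lincomb[OF U(1) W(2,4), of 1 "-1"] by (simp add: v_def)
  have Lv: "\<l> x \<bullet> Lop U ?\<tau> v x = 0" if "x \<in> U" for x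
  proof -
    have "\<l> x \<bullet> (Lop U ?\<tau> w1 x + Lop U \<delta>\<tau> u x + fvec \<delta>\<tau> x) = 0"
      "\<l> x \<bullet> (Lop U ?\<tau> w2 x + Lop U \<delta>\<tau> u x + fvec \<delta>\<tau> x) = 0"
      using w that by (auto simp: linearized_solution_def \<l>_def)
    then show ?thesis
      unfolding v_def Lop_lincomb_inside[OF U(1) W(2,4) that] by (simp add: inner_add_right inner_diff_right)
  qed
  let ?A = "\<lambda>x i j. \<Sum>k\<in>UNIV. \<l> x $ k * co_a ?\<tau> k x $ i $ j"
  let ?b = "\<lambda>x i. \<Sum>k\<in>UNIV. \<l> x $ k * co_b ?\<tau> k x $ i"
  let ?c = "\<lambda>x. \<Sum>k\<in>UNIV. \<l> x $ k * co_c ?\<tau> k x"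
  have swap2: "(\<Sum>i\<in>UNIV. \<Sum>j\<in>UNIV. ?A x i j * B i j) = (\<Sum>k\<in>UNIV. \<l> x $ k * (\<Sum>i\<in>UNIV. \<Sum>j\<in>UNIV. co_a ?\<tau> k x $ i $ j * B i j))" for x B
  proof -
    have "(\<Sum>i\<in>UNIV. \<Sum>j\<in>UNIV. ?A x i j * B i j) = (\<Sum>i\<in>UNIV. \<Sum>j\<in>UNIV. \<Sum>k\<in>UNIV. \<l> x $ k * (co_a ?\<tau> k x $ i $ j * B i j))"
      by (simp add: sum_distrib_right mult.assoc)
    also have "\<dots> = (\<Sum>i\<in>UNIV. \<Sum>k\<in>UNIV. \<Sum>j\<in>UNIV. \<l> x $ k * (co_a ?\<tau> k x $ i $ j * B i j))"
      by (intro sum.cong refl sum.swap)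
    also have "\<dots> = (\<Sum>k\<in>UNIV. \<Sum>i\<in>UNIV. \<Sum>j\<in>UNIV. \<l> x $ k * (co_a ?\<tau> k x $ i $ j * B i j))"
      by (rule sum.swap)
    finally show ?thesis by (simp add: sum_distrib_left)
  qed
  have swap1: "(\<Sum>i\<in>UNIV. ?b x i * B i) = (\<Sum>k\<in>UNIV. \<l> x $ k * (\<Sum>i\<in>UNIV. co_b ?\<tau> k x $ i * B i))" for x B
  proof -
    have "(\<Sum>i\<in>UNIV. ?b x i * B i) = (\<Sum>i\<in>UNIV. \<Sum>k\<in>UNIV. \<l> x $ k * (co_b ?\<tau> k x $ i * B i))"
      by (simp add: sum_distrib_right mult.assoc)
    also have "\<dots> = (\<Sum>k\<in>UNIV. \<Sum>i\<in>UNIV. \<l> x $ k * (co_b ?\<tau> k x $ i * B i))"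
      by (rule sum.swap)
    finally show ?thesis by (simp add: sum_distrib_left)
  qed
  have co_a: "co_a ?\<tau> k x $ i $ j = (1/2) * (\<sigma> x (a k) ** transpose (\<sigma> x (a k))) $ i $ j" for k x i j
    by (simp add: co_a_def base_coeffs_def)
  \<comment> \<open>Ellipticity holds in all directions, so any coordinate serves for the barrier.\<close>
  define dir :: 'n where "dir = (SOME i. True)"
  define K where "K = (\<Sum>k\<in>UNIV. holder_norm UNIV 0 1 (\<lambda>x. b x (a k) $ dir))"
  have hb: "(\<lambda>x. b x (a k) $ dir) \<in> holder_space UNIV 0 1" for k using H1 by (auto simp: H1_def)
  have bK: "\<bar>co_b ?\<tau> k x $ dir\<bar> \<le> K" for k x
  proof -
    have "\<bar>b x (a k) $ dir\<bar> \<le> holder_norm UNIV 0 1 (\<lambda>x. b x (a k) $ dir)"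
      using holder_norm_bounds_sup[OF open_UNIV UNIV_not_empty hb, of "{#}" x] by simp
    also have "\<dots> \<le> K" unfolding K_def
      by (rule member_le_sum) (use holder_norm_nonneg[OF open_UNIV UNIV_not_empty hb] in auto)
    finally show ?thesis by (simp add: co_b_def base_coeffs_def)
  qed
  have "v x \<le> 0"
  proof (rule weak_maximum_principle[where A = ?A and b = ?b and c = ?c and \<nu> = "\<nu> / 2" and K = K and dir = dir])
    show "open U" "bounded U" "\<nu> / 2 > 0" "x \<in> closure U" using U x by auto
    show "continuous_on (closure U) v" unfolding v_def by (intro continuous_intros W)
    show "Ck_on 2 U v" by (rule v2)
    show "v y \<le> 0" if "y \<in> frontier U" for y using w that by (auto simp: linearized_solution_def v_def)
  next
    fix y and B :: "'n \<Rightarrow> 'n \<Rightarrow> real"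
    assume B: "\<And>s. (\<Sum>i\<in>UNIV. \<Sum>j\<in>UNIV. s i * s j * B i j) \<le> 0"
    show "(\<Sum>i\<in>UNIV. \<Sum>j\<in>UNIV. ?A y i j * B i j) \<le> 0"
      unfolding swap2
    proof (rule sum_nonpos, rule mult_nonneg_nonpos, rule l0)
      fix k
      have "(\<Sum>i\<in>UNIV. \<Sum>j\<in>UNIV. co_a ?\<tau> k y $ i $ j * B i j)
          = (1/2) * (\<Sum>i\<in>UNIV. \<Sum>j\<in>UNIV. (\<sigma> y (a k) ** transpose (\<sigma> y (a k))) $ i $ j * B i j)"
        unfolding co_a sum_distrib_left by (simp only: mult.assoc)
      then show "(\<Sum>i\<in>UNIV. \<Sum>j\<in>UNIV. co_a ?\<tau> k y $ i $ j * B i j) \<le> 0"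
        using square_matrix_psd[OF B, of "\<sigma> y (a k)"] by simp
    qed
  next
    fix y assume y: "y \<in> U"
    have "\<nu> / 2 = (\<Sum>k\<in>UNIV. \<l> y $ k * (\<nu> / 2))" by (simp only: sum_distrib_right[symmetric] l1 mult_1_left)
    also have "\<dots> \<le> ?A y dir dir"
    proof (intro sum_mono mult_left_mono l0)
      fix k
      have "axis dir 1 \<bullet> ((\<sigma> y (a k) ** transpose (\<sigma> y (a k))) *v axis dir 1) \<ge> \<nu> * (axis dir 1 \<bullet> (axis dir 1 :: real^'n))"
        using H1 unfolding H1_def by blast
      then show "\<nu> / 2 \<le> co_a ?\<tau> k y $ dir $ dir"
        unfolding co_a by (simp add: inner_axis' matrix_vector_mult_basis column_def inner_axis_axis)
    qed
    finally show "\<nu> / 2 \<le> ?A y dir dir" .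
    have "\<bar>?b y dir\<bar> \<le> (\<Sum>k\<in>UNIV. \<bar>\<l> y $ k * co_b ?\<tau> k y $ dir\<bar>)" by (rule sum_abs)
    also have "\<dots> \<le> (\<Sum>k\<in>UNIV. \<l> y $ k * K)"
      using bK l0 by (intro sum_mono) (simp add: abs_mult mult_left_mono)
    also have "\<dots> = K" by (simp only: sum_distrib_right[symmetric] l1 mult_1_left)
    finally show "\<bar>?b y dir\<bar> \<le> K" .
    have "0 \<le> co_c ?\<tau> k y" for k
      using H1 y closure_subset[of U] unfolding H1_def by (auto simp: co_c_def base_coeffs_def)
    then show "0 \<le> ?c y" by (intro sum_nonneg mult_nonneg_nonneg l0)
    have "0 = \<l> y \<bullet> Lop U ?\<tau> v y" using Lv[OF y] by simp
    also have "\<dots> = (\<Sum>k\<in>UNIV. \<l> y $ k * (\<Sum>i\<in>UNIV. \<Sum>j\<in>UNIV. co_a ?\<tau> k y $ i $ j * partial_deriv i (partial_deriv j v) y))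
      + (\<Sum>k\<in>UNIV. \<l> y $ k * (\<Sum>i\<in>UNIV. co_b ?\<tau> k y $ i * partial_deriv i v y)) - (\<Sum>k\<in>UNIV. \<l> y $ k * (co_c ?\<tau> k y * v y))"
      by (simp add: inner_vec_def Lop_inside[OF U(1) v2 y] distrib_left right_diff_distrib sum.distrib sum_subtractf)
    also have "(\<Sum>k\<in>UNIV. \<l> y $ k * (co_c ?\<tau> k y * v y)) = ?c y * v y"
      by (simp add: sum_distrib_right mult.assoc)
    finally show "0 \<le> (\<Sum>i\<in>UNIV. \<Sum>j\<in>UNIV. ?A y i j * partial_deriv i (partial_deriv j v) y)
       + (\<Sum>i\<in>UNIV. ?b y i * partial_deriv i v y) - ?c y * v y"
      unfolding swap2 swap1 by simp
  qed
  then show ?thesis by (simp add: v_def)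
qed

section \<open>The expansion of the feedback control\<close>

theorem mainTheorem6:
  fixes U :: "(real^'n::finite) set"
    and A :: "'a set"
    and a :: "'k::finite \<Rightarrow> 'a"
    and \<nu> \<Lambda> \<theta> c0 \<epsilon> \<beta> :: real
    and b :: "real^'n \<Rightarrow> 'a \<Rightarrow> real^'n"
    and \<sigma> :: "real^'n \<Rightarrow> 'a \<Rightarrow> real^'n^'n"
    and c f :: "real^'n \<Rightarrow> 'a \<Rightarrow> real"
    and g u :: "real^'n \<Rightarrow> real"
    and H :: "real^'k \<Rightarrow> real"
    and \<rho> :: "real^'k \<Rightarrow> ereal"
    and \<beta>0 :: "real \<Rightarrow> real \<Rightarrow> real"
    and \<tau>0 :: "('n, 'k) coeffs"
    and V :: "('n, 'k) coeffs set"
    and W :: "(real^'n \<Rightarrow> real) set"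
    and S :: "('n, 'k) coeffs \<Rightarrow> real^'n \<Rightarrow> real"
  assumes H1: "H1 U A a \<nu> \<Lambda> \<theta> b \<sigma> c f g"
    and H2: "H2 H c0 \<rho>"
    and eps: "\<epsilon> > 0"
    and H_C3: "Ck_on 3 UNIV H"
    and theta0: "\<tau>0 = base_coeffs a b \<sigma> c f g"
    and u: "classical_solution U H \<epsilon> \<tau>0 u"
    and beta0: "regularity_exponent TYPE('n) TYPE('k) TYPE('a) \<beta>0"
    and beta: "0 < \<beta>" "\<beta> \<le> min (\<beta>0 \<nu> (sigma_bound U a \<sigma>)) \<theta>"
    and S: "solution_map U H \<epsilon> \<beta> \<tau>0 u V W S"
  shows "(\<forall>\<delta>\<tau>\<in>Theta_space U \<beta>. \<exists>\<delta>u. linearized_solution U H \<epsilon> \<tau>0 u \<delta>\<tau> \<delta>u \<and>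
            (\<forall>w. linearized_solution U H \<epsilon> \<tau>0 u \<delta>\<tau> w \<longrightarrow> (\<forall>x\<in>closure U. w x = \<delta>u x)))
    \<and> feedback_control U H \<epsilon> \<tau>0 u \<in> holder_space U 0 \<beta>
    \<and> (\<forall>e>0. \<exists>d>0. \<forall>\<delta>\<tau>\<in>Theta_space U \<beta>. \<forall>\<delta>u.
         Theta_norm U \<beta> \<delta>\<tau> < d \<and> linearized_solution U H \<epsilon> \<tau>0 u \<delta>\<tau> \<delta>u \<longrightarrow>
         \<tau>0 + \<delta>\<tau> \<in> V \<and>
         feedback_control U H \<epsilon> (\<tau>0 + \<delta>\<tau>) (S (\<tau>0 + \<delta>\<tau>)) \<in> holder_space U 0 \<beta> \<and>
         (let R = (\<lambda>x. feedback_control U H \<epsilon> (\<tau>0 + \<delta>\<tau>) (S (\<tau>0 + \<delta>\<tau>)) x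
                    - (feedback_control U H \<epsilon> \<tau>0 u x
                       + hessian (H_eps H \<epsilon>) (Lop U \<tau>0 u x + fvec \<tau>0 x)
                         *v (Lop U \<tau>0 \<delta>u x + Lop U \<delta>\<tau> u x + fvec \<delta>\<tau> x)))
          in R \<in> holder_space U 0 \<beta> \<and> holder_norm U 0 \<beta> R \<le> e * Theta_norm U \<beta> \<delta>\<tau>))"
proof -
  let ?N = "holder_norm U 2 \<beta>" and ?T = "Theta_norm U \<beta> :: ('n, 'k) coeffs \<Rightarrow> real"
  let ?X = "Theta_space U \<beta> :: ('n, 'k) coeffs set" and ?Y = "holder_space U 2 \<beta> :: (real^'n \<Rightarrow> real) set"
  let ?hb = "holder_bound \<beta> (closure U)"
  let ?F = "H_eps H \<epsilon>"
  have U: "open U" "U \<noteq> {}" and Ub: "bounded U" and bd: "boundary_of_class 2 \<theta> U" and \<theta>: "\<theta> \<le> 1"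
    using H1 by (auto simp: H1_def)
  have \<beta>: "0 < \<beta>" "\<beta> \<le> 1" using beta \<theta> by auto
  have ne: "closure U \<noteq> {}" using U by simp
  have C3: "Ck_on 3 UNIV ?F" unfolding H_eps_def by (rule Ck_on_scaled[OF H_C3])
  have C2: "Ck_on 2 UNIV ?F" by (rule Ck_on_mono[OF C3]) simp
  have C1: "Ck_on (Suc 0) UNIV ?F" by (rule Ck_on_mono[OF C3]) simp

  have Vopen: "norm_open ?X ?T V" and t0V: "\<tau>0 \<in> V" and Wopen: "norm_open ?Y ?N W" and uW: "u \<in> W"
    and SVW: "S ` V \<subseteq> W" and cd: "cont_differentiable_on ?X ?T ?Y ?N S V"
    and cl: "\<And>\<tau>. \<tau> \<in> V \<Longrightarrow> classical_solution U H \<epsilon> \<tau> (S \<tau>)"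
    using S by (auto simp: solution_map_def)
  have VX: "V \<subseteq> ?X" and WY: "W \<subseteq> ?Y" using Vopen Wopen by (auto simp: norm_open_def)
  have t0X: "\<tau>0 \<in> ?X" and uY: "u \<in> ?Y" using t0V VX uW WY by auto
  have SY: "S \<tau> \<in> ?Y" if "\<tau> \<in> V" for \<tau> using that SVW WY by auto

  \<comment> \<open>Uniqueness for the nonlinear problem is part of the regularity hypothesis. Outside the closure
    the two functions may differ, so every later step works on the closure only.\<close>
  have Su: "S \<tau>0 x = u x" if x: "x \<in> closure U" for x
  proof -
    obtain u' where u': "\<And>w. classical_solution U H \<epsilon> \<tau>0 w \<Longrightarrow> \<forall>x\<in>closure U. w x = u' x"
    proof -
      have "\<exists>u'. classical_solution U H \<epsilon> \<tau>0 u' \<and>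
             u' \<in> holder_space U 2 (min (\<beta>0 \<nu> (sigma_bound U a \<sigma>)) \<theta>) \<and>
             (\<forall>w. classical_solution U H \<epsilon> \<tau>0 w \<longrightarrow> (\<forall>x\<in>closure U. w x = u' x))"
        using conjunct2[OF beta0[unfolded regularity_exponent_def]]
      proof (elim exE, goal_cases)
        case (1 Cst)
        show ?case
          unfolding theta0
          by (rule 1[THEN spec, THEN spec, THEN spec, THEN spec, THEN spec, THEN spec, THEN spec, THEN spec, THEN spec, THEN spec, THEN spec, THEN spec, THEN spec, THEN spec, THEN spec, 
                THEN mp, OF conjI[OF H1 conjI[OF H2 eps]], THEN conjunct1])
      qed
      then show ?thesis using that by blast
    qed
    have "S \<tau>0 x = u' x" "u x = u' x"
      using u'[OF cl[OF t0V]] u'[OF u] x by auto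
    then show ?thesis by simp
  qed

  obtain D where D: "has_frechet_deriv ?X ?T ?Y ?N S \<tau>0 D"
    using cd t0V unfolding cont_differentiable_on_def by blast
  have DY: "D h \<in> ?Y" if "h \<in> ?X" for h
    using D that by (auto simp: has_frechet_deriv_def bounded_linear_between_def)
  obtain B' where B': "\<And>h. h \<in> ?X \<Longrightarrow> ?N (D h) \<le> B' * ?T h"
    using D unfolding has_frechet_deriv_def bounded_linear_between_def by blast
  define B where "B = \<bar>B'\<bar>"
  have B0: "B \<ge> 0" by (simp add: B_def)
  have T0: "?T h \<ge> 0" if "h \<in> ?X" for h by (rule Theta_norm_nonneg[OF U that])
  have N0: "?N \<phi> \<ge> 0" if "\<phi> \<in> ?Y" for \<phi> by (rule holder_norm_nonneg[OF U that])
  have B: "?N (D h) \<le> B * ?T h" if "h \<in> ?X" for h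
    using B'[OF that] mult_right_mono[OF abs_ge_self[of B'] T0[OF that]] by (simp add: B_def)
  have Nsup: "\<bar>\<phi> x\<bar> \<le> ?N \<phi>" if "\<phi> \<in> ?Y" "x \<in> closure U" for \<phi> x
    using holder_norm_bounds_sup[OF U that(1), of "{#}" x] that by simp
  have Ylin: "(\<lambda>x. r * \<phi> x + s * \<psi> x) \<in> ?Y" if "\<phi> \<in> ?Y" "\<psi> \<in> ?Y" for r s \<phi> \<psi>
    using holder_space_lincomb[OF U that, of r s] by simp
  have Xscale: "r *\<^sub>R h \<in> ?X" if "h \<in> ?X" for r h
    using Theta_space_lincomb[OF U that that, of r 0] by simp
  have Xadd: "\<tau>0 + h \<in> ?X" if "h \<in> ?X" for h
    using Theta_space_lincomb[OF U t0X that, of 1 1] by simp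
  have Tscale: "?T (r *\<^sub>R h) \<le> \<bar>r\<bar> * ?T h" if "h \<in> ?X" for r h
    by (rule Theta_norm_scaleR_le[OF U that])
  \<comment> \<open>The derivative is homogeneous only modulo functions of norm zero, that is, functions vanishing
    on the closure.\<close>
  have Dscale: "D (r *\<^sub>R h) x = r * D h x" if h: "h \<in> ?X" and x: "x \<in> closure U" for r h x
  proof -
    have N: "?N (D (r *\<^sub>R h) - r *\<^sub>R D h) = 0"
      using D h by (auto simp: has_frechet_deriv_def bounded_linear_between_def)
    have eq: "D (r *\<^sub>R h) - r *\<^sub>R D h = (\<lambda>x. 1 * D (r *\<^sub>R h) x + (- r) * D h x)"
      by (simp add: fun_eq_iff scaleR_fun_def)
    have "D (r *\<^sub>R h) - r *\<^sub>R D h \<in> ?Y"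
      unfolding eq by (rule Ylin[OF DY[OF Xscale[OF h]] DY[OF h]])
    from Nsup[OF this x] show ?thesis unfolding N by (simp add: scaleR_fun_def)
  qed

  obtain C where C: "C \<ge> 0" and Lb: "\<And>\<phi> \<tau>. \<phi> \<in> ?Y \<Longrightarrow> \<tau> \<in> ?X \<Longrightarrow> ?hb (C * ?T \<tau> * ?N \<phi>) (Lop U \<tau> \<phi>)"
    using Lop_bound_exists[OF U(1) Ub U(2) bd \<beta>, where 'k = 'k] by blast
  define K where "K = real CARD('k)"
  have K: "K > 0" by (simp add: K_def)
  have fb: "?hb (K * ?T \<tau>) (fvec \<tau>)" if "\<tau> \<in> ?X" for \<tau> :: "('n, 'k) coeffs"
    unfolding K_def by (rule fvec_holder_bound[OF U that])

  have feedback: "feedback_control U H \<epsilon> \<tau> \<phi> \<in> holder_space U 0 \<beta>" if "\<tau> \<in> ?X" "\<phi> \<in> ?Y" for \<tau> \<phi>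
  proof -
    have F: "?hb (C * ?T \<tau> * ?N \<phi> + K * ?T \<tau>) (\<lambda>x. Lop U \<tau> \<phi> x + fvec \<tau> x)"
      by (intro holder_bound_add Lb fb that)
    obtain N where "?hb N (\<lambda>x. gradient ?F (Lop U \<tau> \<phi> x + fvec \<tau> x))"
      using gradient_comp_holder_bound[OF C2 F holder_bound_nonneg[OF F ne]] by blast
    then have "?hb N (feedback_control U H \<epsilon> \<tau> \<phi>)" by (rule holder_bound_cong) (simp add: feedback_control_def)
    then show ?thesis by (rule holder_space_0I[OF _ \<beta>(1)])
  qed

  define Q where "Q = (\<lambda>\<tau> x. Lop U \<tau> (S \<tau>) x + fvec \<tau> x)"
  define Q0 where "Q0 = (\<lambda>x. Lop U \<tau>0 u x + fvec \<tau>0 x)"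
  define Q' where "Q' = (\<lambda>h x. Lop U \<tau>0 (D h) x + Lop U h u x + fvec h x)"
  have Q0: "Q \<tau>0 x = Q0 x" if "x \<in> closure U" for x
    using Lop_cong[OF U(1) Su that] by (simp add: Q_def Q0_def)

  \<comment> \<open>The argument \<open>Q\<close> of \<open>\<nabla>H\<^sub>\<epsilon>\<close> is bilinear in the coefficients and the solution. With \<open>R\<close> the
    remainder of the solution map, its own remainder is \<open>L\<^sup>\<tau>\<^sup>0 R + L\<^sup>h R + L\<^sup>h (D h)\<close>: the first term is
    small because \<open>R\<close> is, the other two because they are quadratic in \<open>h\<close>.\<close>
  have expansion: "\<exists>d>0. \<forall>h\<in>?X. ?T h < d \<longrightarrow> \<tau>0 + h \<in> V \<and> (\<forall>x\<in>closure U. \<bar>S (\<tau>0 + h) x - u x - D h x\<bar> \<le> e * ?T h) \<and>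
      ?hb (e * ?T h) (\<lambda>x. Q (\<tau>0 + h) x - Q0 x - Q' h x)" if e: "e > 0" for e
  proof -
    obtain r where r: "r > 0" "\<And>y. y \<in> ?X \<Longrightarrow> ?T (y - \<tau>0) < r \<Longrightarrow> y \<in> V"
      using Vopen t0V unfolding norm_open_def by blast
    define e1 where "e1 = min e (e / (2 * (C * ?T \<tau>0 + C + 1)))"
    have CT: "C * ?T \<tau>0 + C + 1 > 0" using C T0[OF t0X] by (simp add: add_nonneg_pos)
    have e1: "e1 > 0" "e1 \<le> e" using e CT by (auto simp: e1_def)
    have "e1 * (C * ?T \<tau>0 + C + 1) \<le> e / (2 * (C * ?T \<tau>0 + C + 1)) * (C * ?T \<tau>0 + C + 1)"
      using CT by (intro mult_right_mono) (auto simp: e1_def)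
    also have "\<dots> = e / 2" using CT by (simp add: field_simps)
    finally have e1': "e1 * (C * ?T \<tau>0 + C) \<le> e / 2" using e1 by (simp add: algebra_simps)
    obtain d1 where d1: "d1 > 0" "\<And>h. h \<in> ?X \<Longrightarrow> ?T h < d1 \<Longrightarrow> ?N (S (\<tau>0 + h) - S \<tau>0 - D h) \<le> e1 * ?T h"
      using D e1(1) unfolding has_frechet_deriv_def by blast
    define d where "d = min (min r d1) (min 1 (e / (2 * (C * B + 1))))"
    have CB: "C * B + 1 > 0" using C B0 by (simp add: add_nonneg_pos)
    have d: "d > 0" "d \<le> r" "d \<le> d1" "d \<le> 1" "d \<le> e / (2 * (C * B + 1))"
      using r d1 e CB by (auto simp: d_def)
    show ?thesis
    proof (intro exI[of _ d] conjI d(1) ballI impI)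
      fix h assume h: "h \<in> ?X" and hd: "?T h < d"
      show hV: "\<tau>0 + h \<in> V" using r(2)[OF Xadd[OF h]] hd d by simp
      define R where "R = (\<lambda>x. 1 * (1 * S (\<tau>0 + h) x + (-1) * S \<tau>0 x) + (-1) * D h x)"
      have RY: "R \<in> ?Y" unfolding R_def by (intro Ylin SY hV t0V DY h)
      have "S (\<tau>0 + h) - S \<tau>0 - D h = R" by (simp add: R_def fun_eq_iff)
      then have NR: "?N R \<le> e1 * ?T h" using d1(2)[OF h] hd d by simp
      have Th: "?T h \<ge> 0" by (rule T0[OF h])
      { fix x assume x: "x \<in> closure U"
        have "\<bar>R x\<bar> \<le> e1 * ?T h" using Nsup[OF RY x] NR by simp
        also have "\<dots> \<le> e * ?T h" using e1 Th by (intro mult_right_mono) auto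
        finally show "\<bar>S (\<tau>0 + h) x - u x - D h x\<bar> \<le> e * ?T h"
          using Su[OF x] by (simp add: R_def) }
      have eq: "Lop U \<tau>0 R x + Lop U h R x + Lop U h (D h) x = Q (\<tau>0 + h) x - Q0 x - Q' h x"
        if x: "x \<in> closure U" for x
      proof -
        have SR: "Lop U \<tau> (S (\<tau>0 + h)) x = Lop U \<tau> u x + Lop U \<tau> (D h) x + Lop U \<tau> R x" for \<tau> :: "('n, 'k) coeffs"
        proof -
          have "Lop U \<tau> R x = 1 *\<^sub>R (1 *\<^sub>R Lop U \<tau> (S (\<tau>0 + h)) x + (-1) *\<^sub>R Lop U \<tau> (S \<tau>0) x) + (-1) *\<^sub>R Lop U \<tau> (D h) x"
            unfolding R_def
            by (simp only: Lop_lincomb[OF U(1) Ylin[OF SY[OF hV] SY[OF t0V]] DY[OF h] x]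
                Lop_lincomb[OF U(1) SY[OF hV] SY[OF t0V] x])
          then show ?thesis using Lop_cong[OF U(1) Su x, where \<tau> = \<tau>] by simp
        qed
        show ?thesis
          by (simp add: Q_def Q0_def Q'_def Lop_add_coeffs SR fvec_add)
      qed
      have "?hb (C * ?T \<tau>0 * ?N R + C * ?T h * ?N R + C * ?T h * ?N (D h))
          (\<lambda>x. Lop U \<tau>0 R x + Lop U h R x + Lop U h (D h) x)"
        by (intro holder_bound_add Lb RY t0X h DY)
      then have hb: "?hb (C * ?T \<tau>0 * ?N R + C * ?T h * ?N R + C * ?T h * ?N (D h))
          (\<lambda>x. Q (\<tau>0 + h) x - Q0 x - Q' h x)"
        by (rule holder_bound_cong) (rule eq)
      have "C * ?T \<tau>0 * ?N R + C * ?T h * ?N R \<le> C * ?T \<tau>0 * (e1 * ?T h) + C * 1 * (e1 * ?T h)"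
        using C T0[OF t0X] Th NR N0[OF RY] e1 hd d
        by (intro add_mono mult_mono mult_left_mono) auto
      also have "\<dots> = (e1 * (C * ?T \<tau>0 + C)) * ?T h" by (simp add: algebra_simps)
      also have "\<dots> \<le> (e / 2) * ?T h" using e1' Th by (rule mult_right_mono)
      finally have 1: "C * ?T \<tau>0 * ?N R + C * ?T h * ?N R \<le> (e / 2) * ?T h" .
      have "C * ?T h * ?N (D h) \<le> C * ?T h * (B * ?T h)"
        using C Th B[OF h] by (intro mult_left_mono) auto
      also have "\<dots> = ((C * B) * ?T h) * ?T h" by simp
      also have "\<dots> \<le> (e / 2) * ?T h"
      proof (rule mult_right_mono[OF _ Th])
        have "(C * B) * ?T h \<le> (C * B + 1) * (e / (2 * (C * B + 1)))"
          using C B0 Th hd d CB by (intro mult_mono) auto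
        also have "\<dots> = e / 2" using CB by (simp add: field_simps)
        finally show "(C * B) * ?T h \<le> e / 2" .
      qed
      finally show "?hb (e * ?T h) (\<lambda>x. Q (\<tau>0 + h) x - Q0 x - Q' h x)"
        using 1 by (intro holder_bound_mono[OF hb]) (simp add: algebra_simps)
    qed
  qed

  have Q'scale: "Q' (r *\<^sub>R h) x = r *\<^sub>R Q' h x" if h: "h \<in> ?X" and x: "x \<in> closure U" for r h x
  proof -
    have "Lop U \<tau>0 (D (r *\<^sub>R h)) x = Lop U \<tau>0 (\<lambda>x. r * D h x + 0 * D h x) x"
      by (rule Lop_cong[OF U(1) _ x]) (simp add: Dscale[OF h])
    then show ?thesis
      using Lop_lincomb[OF U(1) DY[OF h] DY[OF h] x, of \<tau>0 r 0]
      by (simp add: Q'_def Lop_scaleR_coeffs fvec_scaleR scaleR_add_right)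
  qed

  \<comment> \<open>Differentiating the equation and the boundary condition along the ray \<open>\<tau>0 + t h\<close> shows that the
    derivative of the solution map solves the linearized problem.\<close>
  have lin: "linearized_solution U H \<epsilon> \<tau>0 u h (D h)" if h: "h \<in> ?X" for h
  proof -
    have Th: "?T h \<ge> 0" by (rule T0[OF h])
    have along: "\<exists>d>0. \<forall>t. \<bar>t\<bar> < d \<longrightarrow> \<tau>0 + t *\<^sub>R h \<in> V \<and>
        (\<forall>x\<in>closure U. \<bar>S (\<tau>0 + t *\<^sub>R h) x - u x - t * D h x\<bar> \<le> e * \<bar>t\<bar> \<and>
           norm (Q (\<tau>0 + t *\<^sub>R h) x - Q0 x - t *\<^sub>R Q' h x) \<le> e * \<bar>t\<bar>)" if e: "e > 0" for e
    proof -
      define e' where "e' = e / (?T h + 1)"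
      have e': "e' > 0" using e Th by (simp add: e'_def)
      obtain d where d: "d > 0" and dd: "\<And>h. h\<in>?X \<Longrightarrow> ?T h < d \<Longrightarrow> \<tau>0 + h \<in> V \<and> (\<forall>x\<in>closure U. \<bar>S (\<tau>0 + h) x - u x - D h x\<bar> \<le> e' * ?T h) \<and>
        ?hb (e' * ?T h) (\<lambda>x. Q (\<tau>0 + h) x - Q0 x - Q' h x)"
        using expansion[OF e'] by blast
      show ?thesis
      proof (intro exI[of _ "d / (?T h + 1)"] conjI allI impI ballI)
        show "0 < d / (?T h + 1)" using d Th by simp
        fix t assume t: "\<bar>t\<bar> < d / (?T h + 1)"
        have "?T (t *\<^sub>R h) \<le> \<bar>t\<bar> * ?T h" by (rule Tscale[OF h])
        also have t1: "\<bar>t\<bar> * ?T h \<le> \<bar>t\<bar> * (?T h + 1)" by (intro mult_left_mono) auto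
        also have "\<dots> < d" using t Th by (simp add: pos_less_divide_eq)
        finally have small: "?T (t *\<^sub>R h) < d" .
        note dt = dd[OF Xscale[OF h] small]
        show "\<tau>0 + t *\<^sub>R h \<in> V" using dt by blast
        have "e' * ?T (t *\<^sub>R h) \<le> e' * (\<bar>t\<bar> * (?T h + 1))"
          using Tscale[OF h, of t] t1 e' by (intro mult_left_mono) auto
        also have "\<dots> = e * \<bar>t\<bar>" using Th by (simp add: e'_def)
        finally have le: "e' * ?T (t *\<^sub>R h) \<le> e * \<bar>t\<bar>" .
        fix x assume x: "x \<in> closure U"
        show "\<bar>S (\<tau>0 + t *\<^sub>R h) x - u x - t * D h x\<bar> \<le> e * \<bar>t\<bar>"
          using dt x le by (auto simp: Dscale[OF h x])
        show "norm (Q (\<tau>0 + t *\<^sub>R h) x - Q0 x - t *\<^sub>R Q' h x) \<le> e * \<bar>t\<bar>"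
          using holder_boundD(1)[OF _ x, of \<beta> "e' * ?T (t *\<^sub>R h)" "\<lambda>x. Q (\<tau>0 + t *\<^sub>R h) x - Q0 x - Q' (t *\<^sub>R h) x"] dt le
          by (simp add: Q'scale[OF h x])
      qed
    qed
    obtain d0 where d0: "d0 > 0" "\<And>t. \<bar>t\<bar> < d0 \<Longrightarrow> \<tau>0 + t *\<^sub>R h \<in> V"
      using along[of 1] by auto
    have near0: "\<forall>\<^sub>F t in nhds (0::real). \<tau>0 + t *\<^sub>R h \<in> V"
      unfolding eventually_nhds_metric using d0 by (auto simp: dist_real_def)
    have Sd: "((\<lambda>t. S (\<tau>0 + t *\<^sub>R h) x) has_vector_derivative D h x) (at 0)" if x: "x \<in> closure U" for x
    proof (rule has_vector_derivative_at_0I)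
      fix e :: real assume "e > 0"
      from along[OF this] show "\<exists>d>0. \<forall>t. \<bar>t\<bar> < d \<longrightarrow> norm (S (\<tau>0 + t *\<^sub>R h) x - S (\<tau>0 + 0 *\<^sub>R h) x - t *\<^sub>R D h x) \<le> e * \<bar>t\<bar>"
        using x Su[OF x] by auto
    qed
    have Qd: "((\<lambda>t. Q (\<tau>0 + t *\<^sub>R h) x) has_vector_derivative Q' h x) (at 0)" if x: "x \<in> closure U" for x
    proof (rule has_vector_derivative_at_0I)
      fix e :: real assume "e > 0"
      from along[OF this] show "\<exists>d>0. \<forall>t. \<bar>t\<bar> < d \<longrightarrow> norm (Q (\<tau>0 + t *\<^sub>R h) x - Q (\<tau>0 + 0 *\<^sub>R h) x - t *\<^sub>R Q' h x) \<le> e * \<bar>t\<bar>"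
        using x Q0[OF x] by auto
    qed
    show ?thesis
      unfolding linearized_solution_def
    proof (intro conjI ballI)
      show "Ck_on 2 U (D h)" using DY[OF h] by (simp add: holder_space_def)
      have "continuous_on (closure U) (deriv_cl U {#} (D h))"
        using DY[OF h] unfolding holder_space_def mem_Collect_eq by (metis le0 size_empty)
      then show "continuous_on (closure U) (D h)"
        by (rule continuous_on_eq) simp
    next
      fix x assume x: "x \<in> frontier U"
      then have xc: "x \<in> closure U" by (simp add: frontier_def)
      have ev: "\<forall>\<^sub>F t in nhds (0::real). t \<in> UNIV \<longrightarrow> S (\<tau>0 + t *\<^sub>R h) x = co_g \<tau>0 x + t * co_g h x"
        using near0 by eventually_elim (use cl x in \<open>auto simp: classical_solution_def\<close>)
      have "((\<lambda>t. co_g \<tau>0 x + t * co_g h x) has_vector_derivative co_g h x) (at 0)"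
        by (auto intro!: derivative_eq_intros)
      then have "((\<lambda>t. S (\<tau>0 + t *\<^sub>R h) x) has_vector_derivative co_g h x) (at 0)"
        using has_vector_derivative_cong_ev[OF ev, of "co_g h x"] cl[OF t0V] x
        by (simp add: classical_solution_def)
      with Sd[OF xc] show "D h x = co_g h x" by (rule vector_derivative_unique_at)
    next
      fix x assume x: "x \<in> U"
      then have xc: "x \<in> closure U" using closure_subset by blast
      have ev: "\<forall>\<^sub>F t in nhds (0::real). t \<in> UNIV \<longrightarrow> ?F (Q (\<tau>0 + t *\<^sub>R h) x) = 0"
        using near0 by eventually_elim (use cl x in \<open>auto simp: classical_solution_def Q_def\<close>)
      have "((\<lambda>t. 0::real) has_vector_derivative 0) (at 0)" by simp
      then have 1: "((\<lambda>t. ?F (Q (\<tau>0 + t *\<^sub>R h) x)) has_vector_derivative 0) (at 0)"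
        using has_vector_derivative_cong_ev[OF ev, of 0] eventually_nhds_x_imp_x[OF ev] by simp
      have "(?F has_derivative (\<lambda>y. \<Sum>k\<in>UNIV. y $ k *\<^sub>R partial_deriv k ?F (Q (\<tau>0 + 0 *\<^sub>R h) x))) (at (Q (\<tau>0 + 0 *\<^sub>R h) x))"
        using C1_has_derivative[OF open_UNIV C1] by simp
      from has_derivative_compose[OF Qd[OF xc, unfolded has_vector_derivative_def] this]
      have "((\<lambda>t. ?F (Q (\<tau>0 + t *\<^sub>R h) x)) has_vector_derivative
          (\<Sum>k\<in>UNIV. Q' h x $ k * partial_deriv k ?F (Q0 x))) (at 0)"
        unfolding has_vector_derivative_def by (simp add: Q0[OF xc] sum_distrib_left mult.assoc)
      from vector_derivative_unique_at[OF this 1]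
      show "feedback_control U H \<epsilon> \<tau>0 u x \<bullet> (Lop U \<tau>0 (D h) x + Lop U h u x + fvec h x) = 0"
        by (simp add: feedback_control_def inner_vec_def gradient_component Q'_def Q0_def mult.commute)
    qed
  qed
  have uniq: "w x = D h x" if h: "h \<in> ?X" and w: "linearized_solution U H \<epsilon> \<tau>0 u h w" and x: "x \<in> closure U" for h w x
    using linearized_solution_le[OF H1 H2 eps, folded theta0, OF w lin[OF h] x]
      linearized_solution_le[OF H1 H2 eps, folded theta0, OF lin[OF h] w x] by simp

  define M where "M = C * ?T \<tau>0 * ?N u + K * ?T \<tau>0"
  have Q0b: "?hb M Q0" unfolding M_def Q0_def by (intro holder_bound_add Lb fb t0X uY)
  define P where "P = C * ?T \<tau>0 * B + C * ?N u + K"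
  have P0: "P \<ge> 0" unfolding P_def using C T0[OF t0X] B0 N0[OF uY] K by (intro add_nonneg_nonneg mult_nonneg_nonneg) auto
  have Q'b: "?hb (P * ?T h) (Q' h)" if h: "h \<in> ?X" for h
  proof -
    have "?hb (C * ?T \<tau>0 * ?N (D h) + C * ?T h * ?N u + K * ?T h) (Q' h)"
      unfolding Q'_def by (intro holder_bound_add Lb fb t0X uY DY h)
    moreover have "C * ?T \<tau>0 * ?N (D h) \<le> C * ?T \<tau>0 * (B * ?T h)"
      using B[OF h] C T0[OF t0X] by (intro mult_left_mono) auto
    ultimately show ?thesis by (elim holder_bound_mono) (simp add: P_def algebra_simps)
  qed
  obtain N where N: "N \<ge> 0" and NN: "\<And>e. e > 0 \<Longrightarrow> \<exists>d>0. \<forall>w r \<mu> \<eta>. ?hb \<mu> w \<and> \<mu> \<le> d \<and> ?hb \<eta> r \<longrightarrow>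
    ?hb (e * \<mu> + N * \<eta>) (\<lambda>x. gradient ?F (Q0 x + w x) - (gradient ?F (Q0 x) + hessian ?F (Q0 x) *v (w x - r x)))"
    using gradient_superposition[OF C3 holder_bound_nonneg[OF Q0b ne] ne Q0b] by (elim exE conjE) (rule that, auto)

  show ?thesis
  proof (intro conjI ballI allI impI)
    fix h assume h: "h \<in> ?X"
    show "\<exists>\<delta>u. linearized_solution U H \<epsilon> \<tau>0 u h \<delta>u \<and>
            (\<forall>w. linearized_solution U H \<epsilon> \<tau>0 u h w \<longrightarrow> (\<forall>x\<in>closure U. w x = \<delta>u x))"
      using lin[OF h] uniq[OF h] by blast
  next
    show "feedback_control U H \<epsilon> \<tau>0 u \<in> holder_space U 0 \<beta>" by (rule feedback[OF t0X uY])
  next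
    fix e :: real assume e: "e > 0"
    \<comment> \<open>With \<open>T\<close> the norm of the perturbation, the remainder of \<open>Q\<close> is at most \<open>e1 T\<close> and enters with
      the factor \<open>N\<close>; the increment of \<open>Q\<close> is at most \<open>(P + 1) T\<close> and enters with the factor \<open>e2\<close>.
      Together they may reach \<open>e T / 2\<close>, since a Hoelder bound controls only half the norm.\<close>
    define e1 where "e1 = min 1 (e / (4 * (N + 1)))"
    have e1: "e1 > 0" "e1 \<le> 1" using e N by (auto simp: e1_def)
    have "N * e1 \<le> (N + 1) * (e / (4 * (N + 1)))" using N e1 e by (intro mult_mono) (auto simp: e1_def)
    also have "\<dots> = e / 4" using N by (simp add: field_simps)
    finally have Ne1: "N * e1 \<le> e / 4" .
    define e2 where "e2 = e / (4 * (P + 1))"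
    have e2: "e2 > 0" "e2 * (P + 1) = e / 4" using e P0 by (auto simp: e2_def field_simps)
    obtain d1 where d1: "d1 > 0" and dd1: "\<And>h. h\<in>?X \<Longrightarrow> ?T h < d1 \<Longrightarrow> \<tau>0 + h \<in> V \<and>
        ?hb (e1 * ?T h) (\<lambda>x. Q (\<tau>0 + h) x - Q0 x - Q' h x)"
      using expansion[OF e1(1)] by blast
    obtain d2 where d2: "d2 > 0" and dd2: "\<And>w r \<mu> \<eta>. ?hb \<mu> w \<Longrightarrow> \<mu> \<le> d2 \<Longrightarrow> ?hb \<eta> r \<Longrightarrow>
      ?hb (e2 * \<mu> + N * \<eta>) (\<lambda>x. gradient ?F (Q0 x + w x) - (gradient ?F (Q0 x) + hessian ?F (Q0 x) *v (w x - r x)))"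
      using NN[OF e2(1)] by blast
    show "\<exists>d>0. \<forall>\<delta>\<tau>\<in>Theta_space U \<beta>. \<forall>\<delta>u.
         Theta_norm U \<beta> \<delta>\<tau> < d \<and> linearized_solution U H \<epsilon> \<tau>0 u \<delta>\<tau> \<delta>u \<longrightarrow>
         \<tau>0 + \<delta>\<tau> \<in> V \<and>
         feedback_control U H \<epsilon> (\<tau>0 + \<delta>\<tau>) (S (\<tau>0 + \<delta>\<tau>)) \<in> holder_space U 0 \<beta> \<and>
         (let R = (\<lambda>x. feedback_control U H \<epsilon> (\<tau>0 + \<delta>\<tau>) (S (\<tau>0 + \<delta>\<tau>)) x
                    - (feedback_control U H \<epsilon> \<tau>0 u x
                       + hessian (H_eps H \<epsilon>) (Lop U \<tau>0 u x + fvec \<tau>0 x)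
                         *v (Lop U \<tau>0 \<delta>u x + Lop U \<delta>\<tau> u x + fvec \<delta>\<tau> x)))
          in R \<in> holder_space U 0 \<beta> \<and> holder_norm U 0 \<beta> R \<le> e * Theta_norm U \<beta> \<delta>\<tau>)"
    proof (intro exI[of _ "min d1 (d2 / (P + 1))"] conjI ballI allI impI)
      show "0 < min d1 (d2 / (P + 1))" using d1 d2 P0 by simp
      fix h \<delta>u assume h: "h \<in> ?X" and A: "?T h < min d1 (d2 / (P + 1)) \<and> linearized_solution U H \<epsilon> \<tau>0 u h \<delta>u"
      have Th: "?T h \<ge> 0" by (rule T0[OF h])
      have hV: "\<tau>0 + h \<in> V" and r: "?hb (e1 * ?T h) (\<lambda>x. Q (\<tau>0 + h) x - Q0 x - Q' h x)"
        using dd1[OF h] A by auto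
      show "\<tau>0 + h \<in> V" by (rule hV)
      show "feedback_control U H \<epsilon> (\<tau>0 + h) (S (\<tau>0 + h)) \<in> holder_space U 0 \<beta>"
        by (rule feedback[OF Xadd[OF h] SY[OF hV]])
      have w: "?hb ((P + 1) * ?T h) (\<lambda>x. Q (\<tau>0 + h) x - Q0 x)"
      proof -
        have "?hb (e1 * ?T h + P * ?T h) (\<lambda>x. Q (\<tau>0 + h) x - Q0 x)"
          using holder_bound_add[OF r Q'b[OF h]] by simp
        moreover have "e1 * ?T h + P * ?T h \<le> (P + 1) * ?T h"
          using mult_right_mono[OF e1(2) Th] by (simp add: algebra_simps)
        ultimately show ?thesis by (rule holder_bound_mono)
      qed
      have "(P + 1) * ?T h \<le> d2" using A P0 by (simp add: pos_less_divide_eq mult.commute less_imp_le)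
      note main = dd2[OF w this r]
      define R where "R = (\<lambda>x. feedback_control U H \<epsilon> (\<tau>0 + h) (S (\<tau>0 + h)) x
                    - (feedback_control U H \<epsilon> \<tau>0 u x
                       + hessian (H_eps H \<epsilon>) (Lop U \<tau>0 u x + fvec \<tau>0 x)
                         *v (Lop U \<tau>0 \<delta>u x + Lop U h u x + fvec h x)))"
      have du: "\<And>x. x \<in> closure U \<Longrightarrow> \<delta>u x = D h x" using uniq[OF h] A by blast
      have Rb: "?hb (e2 * ((P + 1) * ?T h) + N * (e1 * ?T h)) R"
        by (rule holder_bound_cong[OF main])
           (simp add: R_def feedback_control_def Q_def Q0_def Q'_def Lop_cong[OF U(1) du] add.assoc)
      have "e2 * ((P + 1) * ?T h) + N * (e1 * ?T h) = (e2 * (P + 1) + N * e1) * ?T h"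
        by (simp add: algebra_simps)
      also have "\<dots> \<le> (e / 2) * ?T h" using Ne1 e2(2) Th by (intro mult_right_mono) auto
      finally have Rb': "?hb ((e / 2) * ?T h) R" using Rb holder_bound_mono by blast
      have "R \<in> holder_space U 0 \<beta>" by (rule holder_space_0I[OF Rb' \<beta>(1)])
      moreover have "holder_norm U 0 \<beta> R \<le> e * ?T h" using holder_norm_0_le[OF U Rb'] by simp
      ultimately show "let R = (\<lambda>x. feedback_control U H \<epsilon> (\<tau>0 + h) (S (\<tau>0 + h)) x
                    - (feedback_control U H \<epsilon> \<tau>0 u x
                       + hessian (H_eps H \<epsilon>) (Lop U \<tau>0 u x + fvec \<tau>0 x)
                         *v (Lop U \<tau>0 \<delta>u x + Lop U h u x + fvec h x)))
          in R \<in> holder_space U 0 \<beta> \<and> holder_norm U 0 \<beta> R \<le> e * Theta_norm U \<beta> h"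
        unfolding Let_def R_def by blast
    qed
  qed
qed

end
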